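(* Let $H_n$ be the ensemble of random matrices of the long-range percolation model described in the context and let $g_n(z)$ be the Stieltjes transform of its normalized eigenvalue counting measure. If $\hat\mu_3=\sup_{i,j}\mathbf{E}\{|a(i,j)|^3\}<\infty$, then in the limit $n\to\infty$, $b_n\to\infty$, $b_n/n\to0$, for every $z\in\mathbb{C}\setminus\mathbb{R}$, $$\operatorname*{p\text{-}lim}_{n\to\infty}\ g_n(z)=w_{sc}(z),$$ where the nonrandom function $w_{sc}$ is the Stieltjes transform of the semicircle law.
   Context: Setting. Let $v>0$ and let $\{a(i,j): i\le j,\ i,j\in\mathbb{Z}\}$ be independent real random variables with $\mathbf{E}\{a(i,j)\}=0$ and $\mathbf{E}\{a(i,j)^2\}=v^2$. Let $\psi:\mathbb{R}\to[0,1]$ be a continuous even function, non-increasing on $[0,\infty)$ and vanishing at infinity, with $\int_{\mathbb{R}}\psi(t)\,dt=1$. Let $N=2n+1$ and let $b_n$ be a sequence of integers with $0<b_n\le N$, $b_n\to\infty$ and $b_n/n\to0$ as $n\to\infty$. For each $n$ let $\{d(i,j): -n\le i\le j\le n\}$ be independent Bernoulli random variables, independent of the family $\{a(i,j)\}$ and defined on the same probability space, with $d(i,j)=1$ with probability $\psi((i-j)/b_n)$ and $d(i,j)=0$ with probability $1-\psi((i-j)/b_n)$. Define the real symmetric $N\times N$ random matrix $H_n$, with rows and columns indexed by $\{-n,\dots,n\}$, by $H_n(i,j)=H_n(j,i)=b_n^{-1/2}a(i,j)d(i,j)$ for $i\le j$. $g_n(z)=\frac1N\sum_{|j|\le n}\frac{1}{\lambda_j^{(n)}-z}=\frac1N\operatorname{Tr}(H_n-zI)^{-1}$,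 where $\lambda_j^{(n)}$ are the eigenvalues of $H_n$. The Stieltjes transform of a probability measure $\mu$ is $\int\frac{\mu(d\lambda)}{\lambda-z}$. The semicircle law has density $\rho_{sc}(\lambda)=\frac{1}{2\pi v^2}\sqrt{4v^2-\lambda^2}$ for $|\lambda|\le2v$ and $0$ otherwise. $\operatorname{p\text{-}lim}$ denotes the limit in probability. *)

theory Defs
  imports "HOL-Probability.Probability" "Jordan_Normal_Form.Char_Poly"
begin

text \<open>
  The index \<open>n\<close> ranges over \<open>n \<ge> 1\<close>, since the quotient \<open>b n / n\<close> is considered.
  The families \<open>a\<close> and \<open>d n\<close> are indexed by pairs \<open>i \<le> j\<close> only; the values of these functions
  at other pairs are unconstrained and are never used.  No relation between \<open>d n\<close> and \<open>d m\<close> for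
  \<open>n \<noteq> m\<close> is assumed.
\<close>

locale long_range_percolation = prob_space M
  for M :: "'w measure" +
  fixes v :: real
    and a :: "int \<Rightarrow> int \<Rightarrow> 'w \<Rightarrow> real"
    and \<psi> :: "real \<Rightarrow> real"
    and b :: "nat \<Rightarrow> int"
    and d :: "nat \<Rightarrow> int \<Rightarrow> int \<Rightarrow> 'w \<Rightarrow> real"
  assumes v_pos: "v > 0"
    and a_indep: "indep_vars (\<lambda>_. borel) (\<lambda>(i, j). a i j) {(i, j). i \<le> j}"
    and a_mean: "\<And>i j. i \<le> j \<Longrightarrow> integrable M (a i j) \<and> expectation (a i j) = 0"
    and a_second_moment: "\<And>i j. i \<le> j \<Longrightarrow>
        integrable M (\<lambda>\<omega>. (a i j \<omega>)\<^sup>2) \<and> expectation (\<lambda>\<omega>. (a i j \<omega>)\<^sup>2) = v\<^sup>2"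
    and psi_range: "\<And>t. 0 \<le> \<psi> t \<and> \<psi> t \<le> 1"
    and psi_cont: "continuous_on UNIV \<psi>"
    and psi_even: "\<And>t. \<psi> (- t) = \<psi> t"
    and psi_noninc: "\<And>s t. 0 \<le> s \<Longrightarrow> s \<le> t \<Longrightarrow> \<psi> t \<le> \<psi> s"
    and psi_vanish: "(\<psi> \<longlongrightarrow> 0) at_infinity"
    and psi_integral: "integrable lborel \<psi> \<and> integral\<^sup>L lborel \<psi> = 1"
    and b_range: "\<And>n. n \<ge> 1 \<Longrightarrow> 0 < b n \<and> b n \<le> 2 * int n + 1"
    and b_infty: "filterlim b at_top sequentially"
    and b_small: "(\<lambda>n. real_of_int (b n) / real n) \<longlonglongrightarrow> 0"
    and d_indep: "\<And>n. n \<ge> 1 \<Longrightarrow>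
        indep_vars (\<lambda>_. borel) (\<lambda>(i, j). d n i j) {(i, j). - int n \<le> i \<and> i \<le> j \<and> j \<le> int n}"
    and d_bernoulli: "\<And>n i j. n \<ge> 1 \<Longrightarrow> - int n \<le> i \<Longrightarrow> i \<le> j \<Longrightarrow> j \<le> int n \<Longrightarrow>
        prob {\<omega> \<in> space M. d n i j \<omega> = 1} = \<psi> (real_of_int (i - j) / real_of_int (b n)) \<and>
        prob {\<omega> \<in> space M. d n i j \<omega> = 0} = 1 - \<psi> (real_of_int (i - j) / real_of_int (b n))"
    and a_d_indep: "\<And>n. n \<ge> 1 \<Longrightarrow>
        indep_var
          (Pi\<^sub>M {(i, j). i \<le> j} (\<lambda>_. borel))
          (\<lambda>\<omega>. \<lambda>(i, j)\<in>{(i, j). i \<le> j}. a i j \<omega>)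
          (Pi\<^sub>M {(i, j). - int n \<le> i \<and> i \<le> j \<and> j \<le> int n} (\<lambda>_. borel))
          (\<lambda>\<omega>. \<lambda>(i, j)\<in>{(i, j). - int n \<le> i \<and> i \<le> j \<and> j \<le> int n}. d n i j \<omega>)"

text \<open>
  Matrices have indices \<open>0, \<dots>, 2 n\<close>; position \<open>k\<close> stands for the index
  \<open>k - n \<in> {- n, \<dots>, n}\<close>.
\<close>

definition percolation_matrix ::
  "(int \<Rightarrow> int \<Rightarrow> 'w \<Rightarrow> real) \<Rightarrow> (nat \<Rightarrow> int) \<Rightarrow> (nat \<Rightarrow> int \<Rightarrow> int \<Rightarrow> 'w \<Rightarrow> real)
    \<Rightarrow> nat \<Rightarrow> 'w \<Rightarrow> real mat" where
  "percolation_matrix a b d n \<omega> =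
     mat (2 * n + 1) (2 * n + 1) (\<lambda>(k, l).
       let i = int k - int n; j = int l - int n
       in a (min i j) (max i j) \<omega> * d n (min i j) (max i j) \<omega> / sqrt (real_of_int (b n)))"

text \<open>
  The eigenvalues are listed with algebraic multiplicity, as the complex roots of the
  characteristic polynomial; a square matrix of size \<open>N\<close> thus always has \<open>N\<close> of them, and for a
  symmetric real matrix they are all real.
\<close>

definition eigenvalue_mset :: "real mat \<Rightarrow> complex multiset" where
  "eigenvalue_mset A = proots (char_poly (map_mat complex_of_real A))"

text \<open>The Stieltjes transform of the normalized eigenvalue counting measure.\<close>

definition eigenvalue_stieltjes :: "real mat \<Rightarrow> complex \<Rightarrow> complex" where
  "eigenvalue_stieltjes A z = (\<Sum>x\<in>#eigenvalue_mset A. 1 / (x - z)) / of_nat (dim_row A)"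

definition stieltjes :: "real measure \<Rightarrow> complex \<Rightarrow> complex" where
  "stieltjes \<mu> z = (LINT x|\<mu>. 1 / (complex_of_real x - z))"

definition semicircle_law :: "real \<Rightarrow> real measure" where
  "semicircle_law v = density lborel (\<lambda>x. ennreal
     (if \<bar>x\<bar> \<le> 2 * v then sqrt (4 * v\<^sup>2 - x\<^sup>2) / (2 * pi * v\<^sup>2) else 0))"

text \<open>
  Meant for measurable \<open>X n\<close>, since \<open>measure\<close> is 0 on non-measurable sets.  The function
  \<open>eigenvalue_stieltjes (percolation_matrix a b d n \<omega>) z\<close> is measurable in \<open>\<omega>\<close>: it equals
  \<open>- p' z / (N * p z)\<close> for the characteristic polynomial \<open>p\<close>, whose coefficients are polynomials
  in the matrix entries.
\<close>

definition plim_const :: "'w measure \<Rightarrow> (nat \<Rightarrow> 'w \<Rightarrow> complex) \<Rightarrow> complex \<Rightarrow> bool" where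
  "plim_const M X c \<longleftrightarrow>
     (\<forall>\<epsilon>>0. (\<lambda>n. measure M {\<omega> \<in> space M. cmod (X n \<omega> - c) > \<epsilon>}) \<longlonglongrightarrow> 0)"

end

theory Submission
  imports Defs "HOL-Complex_Analysis.Great_Picard"
begin

text \<open>
  Write \<open>G = (H - z)\<^sup>-\<^sup>1\<close> for the resolvent of the random matrix, \<open>\<eta> = \<bar>Im z\<bar>\<close>, and \<open>s i j\<close> for
  the variance of the entry \<open>H i j\<close>. The quantity of interest is the average of the diagonal
  entries \<open>G i i\<close> (\<open>eigenvalue_stieltjes_eq_trace\<close>).

  Deleting row and column \<open>i\<close> leaves a minor whose resolvent \<open>G'\<close> is independent of the \<open>i\<close>-th row
  of \<open>H\<close>, and the Schur complement formula reads
  \<open>G i i * (H i i - z - (\<Sum>j k. H i j * H i k * G' j k)) = 1\<close>. For fixed \<open>G'\<close> the quadratic form is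
  close in mean to \<open>\<Sum>j. s i j * G' j j\<close> (\<open>quadratic_form_first_moment\<close>): the off-diagonal part has
  a small variance because each \<open>s i j\<close> is of order \<open>1 / b\<close>, the diagonal part is a law of large
  numbers, and the third moments serve to truncate it. By the Ward identity, replacing \<open>G' j j\<close> by
  \<open>G j j\<close> costs \<open>O(1 / b)\<close>. So the random vector of the \<open>G i i\<close> almost solves the system
  \<open>x i * (- z - (\<Sum>j. s i j * x j)) = 1\<close>.

  The row sums \<open>\<Sum>j. s i j\<close> are Riemann sums for \<open>v\<^sup>2 * integral \<psi>\<close>. Up to any given accuracy they
  equal \<open>v\<^sup>2\<close> except in \<open>O(b)\<close> rows near the border, a negligible fraction because \<open>b / n\<close> tends
  to 0. Hence the constant vector \<open>w\<close> with \<open>w * (- z - v\<^sup>2 * w) = 1\<close>, which is the value of the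
  Stieltjes transform of the semicircle law, almost solves the same system on average over \<open>i\<close>. If
  \<open>4 * v\<^sup>2 \<le> \<eta>\<^sup>2\<close> the system is a contraction for the average over \<open>i\<close> of the absolute values
  (\<open>diagonal_near_fixed_point\<close>), so the mean of the average of \<open>cmod (G i i - w)\<close> tends to 0, and
  Markov's inequality gives convergence in probability for these \<open>z\<close>.

  The remaining \<open>z\<close> are reached by compactness. On a half-plane all the functions in question are
  holomorphic and bounded by \<open>1 / \<bar>Im x\<bar>\<close>, so by Montel's theorem and the identity theorem
  closeness to the limit at finitely many points far from the real axis forces closeness at a
  given point (\<open>half_plane_family_determined\<close>).
\<close>

section \<open>Resolvents of real symmetric matrices\<close>

text \<open>
  The entry of \<open>(H - z)\<^sup>-\<^sup>1\<close> is given by Cramer's rule, as a rational function of the entries of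
  \<open>H\<close>; this makes its measurability evident. The matrix \<open>K\<close> is \<open>z - H\<close> rather than \<open>H - z\<close> because
  its determinant is the characteristic polynomial at \<open>z\<close>; hence the minus sign.
\<close>

definition resolvent_entry :: "nat \<Rightarrow> (nat \<Rightarrow> nat \<Rightarrow> real) \<Rightarrow> complex \<Rightarrow> nat \<Rightarrow> nat \<Rightarrow> complex" where
  "resolvent_entry N H z i j =
     (let K = mat N N (\<lambda>(k, l). (if k = l then z else 0) - complex_of_real (H k l))
      in - cofactor K j i / det K)"

text \<open>
  Pairing the equation with \<open>x\<close> and taking imaginary parts removes \<open>H\<close>, since the quadratic form
  of a real symmetric matrix is real. With \<open>c = 0\<close> this shows that \<open>H - z\<close> is injective, and with
  \<open>c = 1\<close> it is the Ward identity for a column of the resolvent.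
\<close>

lemma norm_square_eq_Im_over_Im:
  fixes H :: "'a \<Rightarrow> 'a \<Rightarrow> real" and x :: "'a \<Rightarrow> complex"
  assumes "finite I" "i \<in> I"
    and sym: "\<And>j k. j \<in> I \<Longrightarrow> k \<in> I \<Longrightarrow> H j k = H k j"
    and eq: "\<And>k. k \<in> I \<Longrightarrow> (\<Sum>j\<in>I. H k j * x j) - z * x k = (if k = i then c else 0)"
  shows "Im z * (\<Sum>k\<in>I. (cmod (x k))\<^sup>2) = - Im (c * cnj (x i))"
proof -
  define S where "S = (\<Sum>k\<in>I. \<Sum>j\<in>I. cnj (x k) * (H k j * x j))"
  have "cnj S = (\<Sum>k\<in>I. \<Sum>j\<in>I. cnj (x j) * (H k j * x k))"
    by (simp add: S_def mult_ac)
  also have "\<dots> = (\<Sum>j\<in>I. \<Sum>k\<in>I. cnj (x j) * (H k j * x k))"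
    by (rule sum.swap)
  also have "\<dots> = S"
    unfolding S_def by (intro sum.cong refl) (simp add: sym)
  finally have S: "Im S = 0"
    by (simp add: complex_eq_iff)
  have "(\<Sum>k\<in>I. cnj (x k) * ((\<Sum>j\<in>I. H k j * x j) - z * x k)) = cnj (x i) * c"
    using assms(1,2) by (simp add: eq if_distrib cong: sum.cong if_cong)
  moreover have "(\<Sum>k\<in>I. cnj (x k) * ((\<Sum>j\<in>I. H k j * x j) - z * x k))
      = S - z * (\<Sum>k\<in>I. x k * cnj (x k))"
    by (simp add: S_def algebra_simps sum_subtractf sum_distrib_left)
  moreover have "(\<Sum>k\<in>I. x k * cnj (x k)) = complex_of_real (\<Sum>k\<in>I. (cmod (x k))\<^sup>2)"
    by (simp add: complex_norm_square[symmetric])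
  ultimately have "S - z * complex_of_real (\<Sum>k\<in>I. (cmod (x k))\<^sup>2) = cnj (x i) * c"
    by simp
  from arg_cong[OF this, of Im] S show ?thesis by (simp add: mult.commute)
qed

lemma sum_shifted_row:
  fixes h y :: "nat \<Rightarrow> complex"
  assumes "k < N"
  shows "(\<Sum>j<N. ((if k = j then z else 0) - h j) * y j) = z * y k - (\<Sum>j<N. h j * y j)"
proof -
  have "(\<Sum>j<N. ((if k = j then z else 0) - h j) * y j)
      = (\<Sum>j<N. (if k = j then z * y j else 0) - h j * y j)"
    by (intro sum.cong) (auto simp: algebra_simps)
  with assms show ?thesis by (simp add: sum_subtractf)
qed

lemma det_resolvent_nonzero:
  fixes H :: "nat \<Rightarrow> nat \<Rightarrow> real"
  assumes sym: "\<And>j k. j < N \<Longrightarrow> k < N \<Longrightarrow> H j k = H k j" and "Im z \<noteq> 0"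
  shows "det (mat N N (\<lambda>(k, l). (if k = l then z else 0) - complex_of_real (H k l))) \<noteq> 0"
proof
  let ?K = "mat N N (\<lambda>(k, l). (if k = l then z else 0) - complex_of_real (H k l))"
  assume "det ?K = 0"
  then obtain u where u: "u \<in> carrier_vec N" "u \<noteq> 0\<^sub>v N" "?K *\<^sub>v u = 0\<^sub>v N"
    using det_0_iff_vec_prod_zero[of ?K N] by auto
  have eq: "(\<Sum>j<N. H k j * vec_index u j) - z * vec_index u k = 0" if "k < N" for k
  proof -
    have "0 = vec_index (?K *\<^sub>v u) k" unfolding u(3) using that by simp
    also have "\<dots> = (\<Sum>j<N. ((if k = j then z else 0) - H k j) * vec_index u j)"
      using u(1) that by (simp add: scalar_prod_def atLeast0LessThan)
    also have "\<dots> = z * vec_index u k - (\<Sum>j<N. H k j * vec_index u j)"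
      by (rule sum_shifted_row) fact
    finally show ?thesis by (simp add: algebra_simps)
  qed
  have "N \<noteq> 0" using u by (auto intro!: eq_vecI)
  then have "Im z * (\<Sum>k<N. (cmod (vec_index u k))\<^sup>2) = - Im (0 * cnj (vec_index u 0))"
    by (intro norm_square_eq_Im_over_Im[of "{..<N}" 0 H "\<lambda>k. vec_index u k" z 0]) (auto simp: sym
      eq)
  then have "(\<Sum>k<N. (cmod (vec_index u k))\<^sup>2) = 0" using assms by simp
  then have "u = 0\<^sub>v N" using u by (subst (asm) sum_nonneg_eq_0_iff) (auto intro!: eq_vecI)
  with u show False by simp
qed

lemma resolvent_entry_eq:
  fixes H :: "nat \<Rightarrow> nat \<Rightarrow> real"
  assumes sym: "\<And>j k. j < N \<Longrightarrow> k < N \<Longrightarrow> H j k = H k j" and "Im z \<noteq> 0"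
    and "k < N" "i < N"
  shows "(\<Sum>j<N. H k j * resolvent_entry N H z j i) - z * resolvent_entry N H z k i
    = (if k = i then 1 else 0)"
proof -
  define K where "K = mat N N (\<lambda>(k, l). (if k = l then z else 0) - complex_of_real (H k l))"
  have K: "K \<in> carrier_mat N N" by (simp add: K_def)
  have nz: "det K \<noteq> 0" unfolding K_def by (rule det_resolvent_nonzero) fact+
  have R: "resolvent_entry N H z j i = - (adj_mat K $$ (j, i)) / det K" if "j < N" for j
    using that assms K by (simp add: resolvent_entry_def K_def[symmetric] Let_def adj_mat_def)
  have "(if k = i then det K else 0) = (K * adj_mat K) $$ (k, i)"
    using adj_mat[OF K] assms K by (simp add: one_mat_def)
  also have "\<dots> = (\<Sum>j<N. K $$ (k, j) * adj_mat K $$ (j, i))"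
    using assms K adj_mat(1)[OF K] by (simp add: times_mat_def scalar_prod_def atLeast0LessThan)
  also have "\<dots> = (\<Sum>j<N. ((if k = j then z else 0) - H k j) * adj_mat K $$ (j, i))"
    using assms by (intro sum.cong) (auto simp: K_def)
  also have "\<dots> = (\<Sum>j<N. ((if k = j then z else 0) - H k j) * (- det K * resolvent_entry N H z j i))"
    using nz by (intro sum.cong) (auto simp: R)
  also have "\<dots> = z * (- det K * resolvent_entry N H z k i)
      - (\<Sum>j<N. H k j * (- det K * resolvent_entry N H z j i))"
    by (rule sum_shifted_row) fact
  also have "\<dots> = det K * ((\<Sum>j<N. H k j * resolvent_entry N H z j i) - z
      * resolvent_entry N H z k i)"
    by (simp add: algebra_simps sum_distrib_left sum_negf)
  finally show ?thesis using nz by (auto split: if_splits)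
qed

lemma sum_inverse_roots:
  fixes z :: complex
  assumes "\<And>x. x \<in> set xs \<Longrightarrow> x \<noteq> z"
  shows "(\<Sum>x\<leftarrow>xs. 1 / (x - z)) = - poly (pderiv (\<Prod>x\<leftarrow>xs. [:- x, 1:])) z / poly (\<Prod>x\<leftarrow>xs. [:- x, 1:]) z"
  using assms
proof (induction xs)
  case (Cons x xs)
  have "poly (\<Prod>x\<leftarrow>xs. [:- x, 1:]) z \<noteq> 0"
    using Cons.prems by (fastforce simp: poly_prod_list prod_list_zero_iff)
  moreover have "pderiv [:- x, 1:] = 1" by (simp add: pderiv_pCons)
  moreover have "1 / (x - z) + - D / P = - (P + (z - x) * D) / ((z - x) * P)"
    if "P \<noteq> 0" for P D
    using that Cons.prems[of x] by (simp add: divide_simps algebra_simps)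
  ultimately show ?case
    using Cons unfolding list.map sum_list.Cons prod_list.Cons pderiv_mult
    by (simp add: add.commute del: mult_pCons_left)
qed auto

lemma char_poly_as_det:
  assumes "A \<in> carrier_mat N N"
  shows "poly (char_poly A) (z :: complex) = det (mat N N (\<lambda>(k, l). (if k
      = l then z else 0) - A $$ (k, l)))"
proof -
  have "- char_matrix A z = mat N N (\<lambda>(k, l). (if k = l then z else 0) - A $$ (k, l))"
    using assms by (intro eq_matI) (auto simp: char_matrix_def)
  then show ?thesis using char_poly_matrix[OF assms, of z] by simp
qed

text \<open>
  The logarithmic derivative of the characteristic polynomial is also the trace of the resolvent,
  because its derivative is the sum of the characteristic polynomials of the principal minors.
\<close>

lemma
  fixes H :: "nat \<Rightarrow> nat \<Rightarrow> real"
  assumes sym: "\<And>j k. j < N \<Longrightarrow> k < N \<Longrightarrow> H j k = H k j"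
  defines "A \<equiv> mat N N (\<lambda>(k, l). H k l)"
  shows eigenvalue_real: "x \<in># eigenvalue_mset A \<Longrightarrow> Im x = 0"
    and size_eigenvalue_mset: "size (eigenvalue_mset A) = N"
    and eigenvalue_stieltjes_eq_trace: "Im z \<noteq> 0 \<Longrightarrow>
        eigenvalue_stieltjes A z = (\<Sum>i<N. resolvent_entry N H z i i) / of_nat N"
proof -
  define C where "C = map_mat complex_of_real A"
  have C: "C \<in> carrier_mat N N" by (simp add: C_def A_def)
  define K where "K z = mat N N (\<lambda>(k, l). (if k = l then z else 0) - complex_of_real (H k l))" for z
  have det: "poly (char_poly C) z = det (K z)" for z
    unfolding char_poly_as_det[OF C] K_def
    by (intro arg_cong[of _ _ det] eq_matI) (auto simp: C_def A_def)
  have ndet: "det (K z) \<noteq> 0" if "Im z \<noteq> 0" for z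
    unfolding K_def by (rule det_resolvent_nonzero) (use sym that in auto)
  obtain es where es: "char_poly C = (\<Prod>x\<leftarrow>es. [:- x, 1:])" "length es = N"
    using char_poly_factorized[OF C] by blast
  have "proots (\<Prod>x\<leftarrow>es. [:- x, 1:]) = mset es"
  proof (induction es)
    case (Cons e es)
    have "(\<Prod>x\<leftarrow>es. [:- x, 1:]) \<noteq> 0" by (auto simp: prod_list_zero_iff)
    then have "proots ([:- e, 1:] * (\<Prod>x\<leftarrow>es. [:- x, 1:])) = {#e#} + mset es"
      by (subst proots_mult) (auto simp: Cons.IH)
    then show ?case by simp
  qed simp
  then have E: "eigenvalue_mset A = mset es"
    by (simp add: eigenvalue_mset_def C_def[symmetric] es)
  then show "size (eigenvalue_mset A) = N" using es by simp
  show real: "Im x = 0" if "x \<in># eigenvalue_mset A" for x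
  proof (rule ccontr)
    assume "Im x \<noteq> 0"
    moreover have "poly (char_poly C) x = 0"
      using that by (auto simp: es E poly_prod_list prod_list_zero_iff)
    ultimately show False using ndet[of x] det[of x] by simp
  qed
  assume z: "Im z \<noteq> 0"
  have "(\<Sum>x\<in>#eigenvalue_mset A. 1 / (x - z)) = (\<Sum>x\<leftarrow>es. 1 / (x - z))"
    by (simp add: E sum_mset_sum_list[symmetric] mset_map[symmetric] del: mset_map)
  also have "\<dots> = - poly (pderiv (char_poly C)) z / poly (char_poly C) z"
    unfolding es(1) by (rule sum_inverse_roots) (use real E z in auto)
  also have "pderiv (char_poly C) = (\<Sum>i<N. char_poly (mat_delete C i i))"
    by (rule pderiv_char_poly[OF C])
  also have "poly \<dots> z = (\<Sum>i<N. cofactor (K z) i i)"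
    unfolding poly_sum
  proof (intro sum.cong refl)
    fix i assume i: "i \<in> {..<N}"
    then have "mat_delete C i i \<in> carrier_mat (N - 1) (N - 1)" using C by auto
    from char_poly_as_det[OF this, of z] show "poly (char_poly (mat_delete C i i)) z
        = cofactor (K z) i i"
      using i unfolding cofactor_def
      by (auto intro!: arg_cong[of _ _ det] eq_matI simp: K_def mat_delete_def C_def A_def)
  qed
  finally show "eigenvalue_stieltjes A z = (\<Sum>i<N. resolvent_entry N H z i i) / of_nat N"
    by (simp add: eigenvalue_stieltjes_def resolvent_entry_def K_def[symmetric] Let_def det
        sum_divide_distrib sum_negf A_def)
qed

text \<open>
  Index sets are arbitrary here, so that the minor obtained by deleting the index \<open>i\<close> is just the
  same \<open>H\<close> on \<open>I - {i}\<close>, without renumbering.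
\<close>

definition is_resolvent :: "'a set \<Rightarrow> ('a \<Rightarrow> 'a \<Rightarrow> real) \<Rightarrow> complex \<Rightarrow> ('a \<Rightarrow> 'a \<Rightarrow> complex) \<Rightarrow> bool" where
  "is_resolvent I H z G \<longleftrightarrow> (\<forall>k\<in>I. \<forall>i\<in>I.
     (\<Sum>j\<in>I. complex_of_real (H k j) * G j i) - z * G k i = (if k = i then 1 else 0))"

locale symmetric_resolvent =
  fixes I :: "'a set" and H :: "'a \<Rightarrow> 'a \<Rightarrow> real" and z :: complex and G :: "'a \<Rightarrow> 'a \<Rightarrow> complex"
  assumes finite_I: "finite I"
    and sym: "\<And>j k. j \<in> I \<Longrightarrow> k \<in> I \<Longrightarrow> H j k = H k j"
    and z: "Im z \<noteq> 0"
    and res: "is_resolvent I H z G"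
begin

lemma resolvent_eq:
  "k \<in> I \<Longrightarrow> i \<in> I \<Longrightarrow> (\<Sum>j\<in>I. complex_of_real (H k j) * G j i) - z * G k i = (if k = i then 1 else 0)"
  using res by (auto simp: is_resolvent_def)

lemma ward_identity:
  assumes "i \<in> I" shows "Im z * (\<Sum>k\<in>I. (cmod (G k i))\<^sup>2) = Im (G i i)"
  using norm_square_eq_Im_over_Im[OF finite_I assms sym resolvent_eq[OF _ assms]] by simp

lemma column_norm_le: 
  assumes "i \<in> I" shows "(\<Sum>k\<in>I. (cmod (G k i))\<^sup>2) \<le> cmod (G i i) / \<bar>Im z\<bar>"
proof -
  have "\<bar>Im z\<bar> * (\<Sum>k\<in>I. (cmod (G k i))\<^sup>2) = \<bar>Im z * (\<Sum>k\<in>I. (cmod (G k i))\<^sup>2)\<bar>"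
    by (simp add: abs_mult sum_nonneg)
  also have "\<dots> \<le> cmod (G i i)"
    unfolding ward_identity[OF assms] by (rule abs_Im_le_cmod)
  finally show ?thesis using z by (simp add: field_simps)
qed

lemma norm_diagonal_le:
  assumes "i \<in> I" shows "cmod (G i i) \<le> 1 / \<bar>Im z\<bar>"
proof -
  have "(cmod (G i i))\<^sup>2 \<le> (\<Sum>k\<in>I. (cmod (G k i))\<^sup>2)"
    using finite_I assms by (intro member_le_sum) auto
  also have "\<dots> \<le> cmod (G i i) / \<bar>Im z\<bar>" by (rule column_norm_le) fact
  finally have "cmod (G i i) * (cmod (G i i) * \<bar>Im z\<bar>) \<le> cmod (G i i) * 1"
    using z by (simp add: field_simps power2_eq_square)
  then have "cmod (G i i) * \<bar>Im z\<bar> \<le> 1"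
    by (cases "G i i = 0") (auto simp: mult_le_cancel_left_pos)
  then show ?thesis using z by (simp add: field_simps)
qed

lemma column_norm_le':
  assumes "i \<in> I" shows "(\<Sum>k\<in>I. (cmod (G k i))\<^sup>2) \<le> 1 / (Im z)\<^sup>2"
proof -
  have "(\<Sum>k\<in>I. (cmod (G k i))\<^sup>2) \<le> cmod (G i i) / \<bar>Im z\<bar>" by (rule column_norm_le) fact
  also have "\<dots> \<le> (1 / \<bar>Im z\<bar>) / \<bar>Im z\<bar>"
    using assms norm_diagonal_le by (intro divide_right_mono) auto
  finally show ?thesis by (simp add: power2_eq_square abs_mult[symmetric])
qed

lemma resolvent_sym:
  assumes "i \<in> I" "j \<in> I" shows "G i j = G j i"
proof -
  have e: "(\<Sum>k\<in>I. G k p * ((\<Sum>l\<in>I. H k l * G l q) - z * G k q)) = G q p" if "q \<in> I" for p q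
    using that finite_I by (simp add: resolvent_eq if_distrib cong: if_cong sum.cong)
  have swap: "(\<Sum>k\<in>I. G k p * (\<Sum>l\<in>I. H k l * G l q)) = (\<Sum>k\<in>I. G k q * (\<Sum>l\<in>I. H k l * G l p))" for p q
  proof -
    have "(\<Sum>k\<in>I. G k p * (\<Sum>l\<in>I. H k l * G l q)) = (\<Sum>k\<in>I. \<Sum>l\<in>I. G k p * (H k l * G l q))"
      by (simp add: sum_distrib_left)
    also have "\<dots> = (\<Sum>l\<in>I. \<Sum>k\<in>I. G k p * (H k l * G l q))" by (rule sum.swap)
    also have "\<dots> = (\<Sum>l\<in>I. \<Sum>k\<in>I. G l q * (H l k * G k p))"
      by (intro sum.cong refl) (simp add: sym)
    finally show ?thesis by (simp add: sum_distrib_left)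
  qed
  have "G i j = (\<Sum>k\<in>I. G k j * (\<Sum>l\<in>I. H k l * G l i)) - z * (\<Sum>k\<in>I. G k j * G k i)"
    by (subst e[OF assms(1), symmetric]) (simp add: algebra_simps sum_subtractf sum_distrib_left)
  also have "\<dots> = (\<Sum>k\<in>I. G k i * (\<Sum>l\<in>I. H k l * G l j)) - z * (\<Sum>k\<in>I. G k i * G k j)"
    by (subst swap) (simp add: mult.commute)
  also have "\<dots> = G j i"
    by (subst e[OF assms(2), symmetric]) (simp add: algebra_simps sum_subtractf sum_distrib_left)
  finally show ?thesis .
qed

lemma solution_unique:
  assumes eq: "\<And>k. k \<in> I \<Longrightarrow> (\<Sum>j\<in>I. complex_of_real (H k j) * x j) - z * x k = f k" and "k \<in> I"
  shows "x k = (\<Sum>i\<in>I. G k i * f i)"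
proof -
  define y where "y k = x k - (\<Sum>i\<in>I. G k i * f i)" for k
  have "(\<Sum>j\<in>I. H k j * y j) - z * y k = (if k = k' then 0 else 0)" if "k \<in> I" for k k'
  proof -
    have "(\<Sum>j\<in>I. H k j * (\<Sum>i\<in>I. G j i * f i)) = (\<Sum>j\<in>I. \<Sum>i\<in>I. f i * (H k j * G j i))"
      by (simp add: sum_distrib_left mult_ac)
    also have "\<dots> = (\<Sum>i\<in>I. f i * (\<Sum>j\<in>I. H k j * G j i))"
      unfolding sum_distrib_left by (rule sum.swap)
    finally have "(\<Sum>j\<in>I. H k j * y j) - z * y k = f k
       - (\<Sum>i\<in>I. f i * ((\<Sum>j\<in>I. H k j * G j i) - z * G k i))"
      using eq[OF that]
      by (simp add: y_def algebra_simps sum_subtractf sum_distrib_left)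
    also have "(\<Sum>i\<in>I. f i * ((\<Sum>j\<in>I. H k j * G j i) - z * G k i)) = f k"
      using that finite_I by (simp add: resolvent_eq if_distrib cong: if_cong sum.cong)
    finally show ?thesis by simp
  qed
  from norm_square_eq_Im_over_Im[OF finite_I \<open>k \<in> I\<close> sym this]
  have "(\<Sum>k\<in>I. (cmod (y k))\<^sup>2) = 0" using z by simp
  then have "y k = 0" using finite_I \<open>k \<in> I\<close> by (subst (asm) sum_nonneg_eq_0_iff) auto
  then show ?thesis by (simp add: y_def)
qed

context
  fixes i and G' :: "'a \<Rightarrow> 'a \<Rightarrow> complex"
  assumes i: "i \<in> I" and res': "is_resolvent (I - {i}) H z G'"
begin

lemma minor: "symmetric_resolvent (I - {i}) H z G'"
  using finite_I sym z res' by unfold_locales auto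

lemma minor_solution:
  assumes "p \<in> I" "k \<in> I - {i}"
  shows "G k p = (\<Sum>l\<in>I - {i}. G' k l * ((if l = p then 1 else 0) - H l i * G i p))"
proof (rule symmetric_resolvent.solution_unique[OF minor _ assms(2)])
  fix k assume k: "k \<in> I - {i}"
  have "(\<Sum>j\<in>I. H k j * G j p) = H k i * G i p + (\<Sum>j\<in>I - {i}. H k j * G j p)"
    using i finite_I by (subst sum.remove) auto
  with resolvent_eq[of k p] k assms
  show "(\<Sum>j\<in>I - {i}. H k j * G j p) - z * G k p = (if k = p then 1 else 0) - H k i * G i p"
    by (simp add: algebra_simps split: if_splits)
qed

text \<open>
  The equations of column \<open>i\<close> of \<open>G\<close> in the rows other than \<open>i\<close> say that this column solves a
  linear system for the minor, with right-hand side a multiple of column \<open>i\<close> of \<open>H\<close>.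
\<close>

lemma column_from_minor:
  assumes "k \<in> I - {i}"
  shows "G k i = - (\<Sum>l\<in>I - {i}. G' k l * H l i) * G i i"
  unfolding minor_solution[OF i assms] sum_distrib_right sum_negf[symmetric]
  by (intro sum.cong) auto

lemma schur_complement:
  "G i i * (H i i - z - (\<Sum>j\<in>I - {i}. \<Sum>k\<in>I - {i}. H i j * H i k * G' j k)) = 1"
proof -
  have "1 = (\<Sum>j\<in>I. H i j * G j i) - z * G i i"
    using resolvent_eq[OF i i] by simp
  also have "(\<Sum>j\<in>I. H i j * G j i) = H i i * G i i + (\<Sum>j\<in>I - {i}. H i j * G j i)"
    using i finite_I by (subst sum.remove) auto
  also have "(\<Sum>j\<in>I - {i}. H i j * G j i)
      = (\<Sum>j\<in>I - {i}. - (\<Sum>k\<in>I - {i}. H i j * H i k * G' j k) * G i i)"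
  proof (intro sum.cong refl)
    fix j assume j: "j \<in> I - {i}"
    show "H i j * G j i = - (\<Sum>k\<in>I - {i}. H i j * H i k * G' j k) * G i i"
      unfolding column_from_minor[OF j] sum_distrib_left sum_distrib_right sum_negf[symmetric]
      using i by (intro sum.cong) (auto simp: sym[of i])
  qed
  also have "\<dots> = - (\<Sum>j\<in>I - {i}. \<Sum>k\<in>I - {i}. H i j * H i k * G' j k) * G i i"
    by (simp add: sum_distrib_right sum_negf)
  finally show ?thesis by (simp add: algebra_simps)
qed

lemma minor_diagonal:
  assumes "j \<in> I - {i}"
  shows "G i i * (G j j - G' j j) = (G j i)\<^sup>2"
proof -
  have "G j j = (\<Sum>l\<in>I - {i}. (if l = j then G' j j else 0) - G' j l * H l i * G i j)"
    unfolding minor_solution[OF DiffD1[OF assms] assms]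
    by (intro sum.cong refl) (simp add: right_diff_distrib mult.assoc)
  also have "\<dots> = G' j j - (\<Sum>l\<in>I - {i}. G' j l * H l i) * G i j"
    using assms finite_I by (simp add: sum_subtractf sum_distrib_right)
  finally have "G j j - G' j j = - (\<Sum>l\<in>I - {i}. G' j l * H l i) * G i j"
    by (simp add: algebra_simps)
  then have "G i i * (G j j - G' j j) = - (\<Sum>l\<in>I - {i}. G' j l * H l i) * G i i * G i j"
    by simp
  also have "\<dots> = G j i * G i j" using column_from_minor[OF assms] by simp
  finally show ?thesis using resolvent_sym[of i j] assms i by (simp add: power2_eq_square)
qed

text \<open>
  The change of the diagonal caused by deleting the index \<open>i\<close> is the square of an entry of column
  \<open>i\<close> of \<open>G\<close> divided by \<open>G i i\<close>. The Ward identity bounds the sum of these squares by a multiple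
  of \<open>cmod (G i i)\<close>, so the denominator cancels and no lower bound on \<open>G i i\<close> enters.
\<close>

lemma minor_diagonal_sum:
  assumes s: "\<And>j. j \<in> I \<Longrightarrow> 0 \<le> s j \<and> s j \<le> \<sigma>"
  shows "(\<Sum>j\<in>I - {i}. s j * cmod (G j j - G' j j)) \<le> \<sigma> / \<bar>Im z\<bar>"
proof -
  have nz: "G i i \<noteq> 0" using schur_complement by auto
  have "\<sigma> \<ge> 0" using s[OF i] by auto
  have "(\<Sum>j\<in>I - {i}. s j * cmod (G j j - G' j j)) * cmod (G i i)
      = (\<Sum>j\<in>I - {i}. s j * (cmod (G j i))\<^sup>2)"
    unfolding sum_distrib_right
  proof (intro sum.cong refl)
    fix j assume "j \<in> I - {i}"
    from arg_cong[OF minor_diagonal[OF this], of cmod]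
    show "s j * cmod (G j j - G' j j) * cmod (G i i) = s j * (cmod (G j i))\<^sup>2"
      by (simp add: norm_mult norm_power mult_ac)
  qed
  also have "\<dots> \<le> (\<Sum>j\<in>I - {i}. \<sigma> * (cmod (G j i))\<^sup>2)"
    using s by (intro sum_mono mult_right_mono) auto
  also have "\<dots> \<le> (\<Sum>j\<in>I. \<sigma> * (cmod (G j i))\<^sup>2)"
    using finite_I \<open>\<sigma> \<ge> 0\<close> by (intro sum_mono2) auto
  also have "\<dots> \<le> \<sigma> * (cmod (G i i) / \<bar>Im z\<bar>)"
    unfolding sum_distrib_left[symmetric] using i \<open>\<sigma> \<ge> 0\<close>
        by (intro mult_left_mono column_norm_le) auto
  finally have "(\<Sum>j\<in>I - {i}. s j * cmod (G j j - G' j j)) * cmod (G i i)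
      \<le> (\<sigma> / \<bar>Im z\<bar>) * cmod (G i i)"
    by (simp add: mult_ac)
  with nz show ?thesis by (subst (asm) mult_le_cancel_right_pos) auto
qed

end

text \<open>
  Stability of the self-consistent equation. The Schur complement formula and the equation for \<open>w\<close>
  give \<open>G i i - w = G i i * w * ((- z - V * w) - (H i i - z - Q i))\<close>, where \<open>Q i\<close> is the quadratic
  form. Both factors in front are at most \<open>1 / \<bar>Im z\<bar>\<close>, and the main part of the bracket is
  \<open>\<Sum>j. s i j * (G j j - w)\<close>. Summing over \<open>i\<close>, the column sums of \<open>s\<close> are at most half of
  \<open>(Im z)\<^sup>2\<close>, so this part is absorbed into the left-hand side. The deviation of the row sums of
  \<open>s\<close> from \<open>V\<close> enters only through its sum over all rows.
\<close>

theorem diagonal_near_fixed_point: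
  fixes w :: complex and s :: "'a \<Rightarrow> 'a \<Rightarrow> real" and G' :: "'a \<Rightarrow> 'a \<Rightarrow> 'a \<Rightarrow> complex"
  assumes s: "\<And>i j. i \<in> I \<Longrightarrow> j \<in> I \<Longrightarrow> 0 \<le> s i j \<and> s i j \<le> \<sigma> \<and> s i j = s j i"
    and C: "\<And>i. i \<in> I \<Longrightarrow> (\<Sum>j\<in>I. s i j) \<le> C" "2 * C \<le> (Im z)\<^sup>2"
    and w: "w * (- z - of_real V * w) = 1" "cmod w \<le> 1 / \<bar>Im z\<bar>"
    and G': "\<And>i. i \<in> I \<Longrightarrow> is_resolvent (I - {i}) H z (G' i)"
  shows "(\<Sum>i\<in>I. cmod (G i i - w)) \<le> 2 / (Im z)\<^sup>2 * (\<Sum>i\<in>I.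
      \<bar>(\<Sum>j\<in>I. s i j) - V\<bar> / \<bar>Im z\<bar> + 2 * \<sigma> / \<bar>Im z\<bar> + \<bar>H i i\<bar>
      + cmod ((\<Sum>j\<in>I - {i}. \<Sum>k\<in>I - {i}. H i j * H i k * G' i j k) - (\<Sum>j\<in>I - {i}. s i j * G' i j j)))"
    (is "_ \<le> _ * (\<Sum>i\<in>I. ?A i + _ + _ + cmod (?Q i - ?S i))")
proof -
  define \<eta> where "\<eta> = \<bar>Im z\<bar>"
  have \<eta>: "\<eta> > 0" "\<eta>\<^sup>2 = (Im z)\<^sup>2" using z by (auto simp: \<eta>_def)
  define E where "E i = ?A i + 2 * \<sigma> / \<eta> + \<bar>H i i\<bar> + cmod (?Q i - ?S i)" for i
  have one: "cmod (G i i - w) \<le> 1 / \<eta>\<^sup>2 * ((\<Sum>j\<in>I. s i j * cmod (G j j - w)) + E i)" if i: "i \<in> I"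
      for i
  proof -
    define T where "T = (\<Sum>j\<in>I. s i j * G j j)"
    have sch: "G i i * (H i i - z - ?Q i) = 1" by (rule schur_complement[OF i G'[OF i]])
    have "G i i - w = G i i * w * ((- z - of_real V * w) - (H i i - z - ?Q i))"
    proof -
      have "G i i * w * ((- z - of_real V * w) - (H i i - z - ?Q i))
          = G i i * (w * (- z - of_real V * w)) - w * (G i i * (H i i - z - ?Q i))"
        by (simp only: right_diff_distrib mult_ac)
      then show ?thesis unfolding sch w(1) by simp
    qed
    also have "(- z - of_real V * w) - (H i i - z - ?Q i)
        = (T - (\<Sum>j\<in>I. s i j) * w) + (of_real ((\<Sum>j\<in>I. s i j) - V)) * w + (?Q i - ?S i) - (T - ?S i)
            - H i i"
      by (simp add: algebra_simps)
    finally have "cmod (G i i - w) = cmod (G i i) * cmod w *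
        cmod ((T - (\<Sum>j\<in>I. s i j) * w) + (of_real ((\<Sum>j\<in>I. s i j) - V)) * w + (?Q i - ?S i) - (T
            - ?S i) - H i i)"
      by (simp add: norm_mult)
    also have "\<dots> \<le> 1 / \<eta> * (1 / \<eta>) * ((\<Sum>j\<in>I. s i j * cmod (G j j - w)) + E i)"
    proof (intro mult_mono)
      have a: "cmod (T - (\<Sum>j\<in>I. s i j) * w) \<le> (\<Sum>j\<in>I. s i j * cmod (G j j - w))"
      proof -
        have "T - (\<Sum>j\<in>I. s i j) * w = (\<Sum>j\<in>I. s i j * (G j j - w))"
          by (simp add: T_def algebra_simps sum_subtractf sum_distrib_left)
        also have "cmod \<dots> \<le> (\<Sum>j\<in>I. cmod (s i j * (G j j - w)))" by (rule norm_sum)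
        also have "\<dots> = (\<Sum>j\<in>I. s i j * cmod (G j j - w))"
          using s i by (intro sum.cong refl) (simp add: norm_mult)
        finally show ?thesis .
      qed
      have b: "cmod (of_real ((\<Sum>j\<in>I. s i j) - V) * w) \<le> ?A i"
        unfolding norm_mult norm_of_real using mult_left_mono[OF w(2), of "\<bar>(\<Sum>j\<in>I. s i j)
            - V\<bar>"] by simp
      have c: "cmod (T - ?S i) \<le> 2 * \<sigma> / \<eta>"
      proof -
        have "T - ?S i = s i i * G i i + (\<Sum>j\<in>I - {i}. s i j * (G j j - G' i j j))"
          unfolding T_def using i finite_I by (subst sum.remove[of _ i]) (auto simp: algebra_simps
              sum_subtractf)
        also have "cmod \<dots> \<le> cmod (s i i * G i i) + cmod (\<Sum>j\<in>I - {i}. s i j * (G j j - G' i j j))"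
          by (rule norm_triangle_ineq)
        also have "cmod (s i i * G i i) \<le> \<sigma> * (1 / \<eta>)"
          unfolding norm_mult \<eta>_def using s[OF i i] norm_diagonal_le[OF i]
          by (intro mult_mono) auto
        also have "cmod (\<Sum>j\<in>I - {i}. s i j * (G j j - G' i j j))
            \<le> (\<Sum>j\<in>I - {i}. cmod (s i j * (G j j - G' i j j)))"
          by (rule norm_sum)
        also have "\<dots> = (\<Sum>j\<in>I - {i}. s i j * cmod (G j j - G' i j j))"
          using s i by (intro sum.cong refl) (simp add: norm_mult)
        also have "\<dots> \<le> \<sigma> / \<eta>" unfolding \<eta>_def
          by (rule minor_diagonal_sum[OF i G'[OF i]]) (use s i in blast)
        finally show ?thesis by simp
      qed
      define t1 t2 t3 t4 h where "t1 = T - (\<Sum>j\<in>I. s i j) * w"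
          and "t2 = of_real ((\<Sum>j\<in>I. s i j) - V) * w"
        and "t3 = ?Q i - ?S i" and "t4 = T - ?S i" and "h = complex_of_real (H i i)"
      have "cmod (t1 + t2 + t3 - t4 - h) \<le> cmod t1 + cmod t2 + cmod t3 + cmod t4 + cmod h"
        by (smt (verit) norm_triangle_ineq norm_triangle_ineq4)
      with a b c show "cmod ((T - (\<Sum>j\<in>I. s i j) * w) + (of_real ((\<Sum>j\<in>I. s i j) - V)) * w + (?Q i
          - ?S i) - (T - ?S i) - H i i)
        \<le> (\<Sum>j\<in>I. s i j * cmod (G j j - w)) + E i"
        unfolding t1_def[symmetric] t2_def[symmetric] t3_def[symmetric] t4_def[symmetric]
            h_def[symmetric] E_def
        by (simp add: h_def)
    qed (use i norm_diagonal_le w \<eta> in \<open>auto simp: \<eta>_def\<close>)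
    finally show ?thesis by (simp add: power2_eq_square)
  qed
  let ?X = "\<Sum>i\<in>I. cmod (G i i - w)"
  have "?X \<le> (\<Sum>i\<in>I. 1 / \<eta>\<^sup>2 * ((\<Sum>j\<in>I. s i j * cmod (G j j - w)) + E i))"
    by (intro sum_mono one)
  also have "\<dots> = 1 / \<eta>\<^sup>2 * ((\<Sum>i\<in>I. \<Sum>j\<in>I. s i j * cmod (G j j - w)) + (\<Sum>i\<in>I. E i))"
    by (simp add: sum_distrib_left sum.distrib distrib_left)
  also have "(\<Sum>i\<in>I. \<Sum>j\<in>I. s i j * cmod (G j j - w)) = (\<Sum>j\<in>I. (\<Sum>i\<in>I. s j i) * cmod (G j j - w))"
    by (subst sum.swap) (auto intro!: sum.cong simp: sum_distrib_right dest: s)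
  also have "\<dots> \<le> (\<Sum>j\<in>I. (\<eta>\<^sup>2 / 2) * cmod (G j j - w))"
    using C \<eta>(2) by (intro sum_mono mult_right_mono) fastforce+
  also have "\<dots> = (\<eta>\<^sup>2 / 2) * ?X" by (simp add: sum_distrib_left)
  finally have "?X \<le> 1 / \<eta>\<^sup>2 * ((\<eta>\<^sup>2 / 2) * ?X + (\<Sum>i\<in>I. E i))"
    using \<eta> by (simp add: mult_left_mono divide_right_mono)
  also have "\<dots> = ?X / 2 + 1 / \<eta>\<^sup>2 * (\<Sum>i\<in>I. E i)" using \<eta>(1) by (simp add: distrib_left)
  finally have "?X \<le> 2 / \<eta>\<^sup>2 * (\<Sum>i\<in>I. E i)" by simp
  then show ?thesis by (simp add: E_def \<eta>_def)
qed

end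

section \<open>Quadratic forms in independent variables\<close>

context prob_space begin

lemma expectation_abs_le_sqrt:
  fixes f :: "'a \<Rightarrow> real"
  assumes [measurable]: "f \<in> borel_measurable M" and sq: "integrable M (\<lambda>\<omega>. (f \<omega>)\<^sup>2)"
  shows "integrable M f" "expectation (\<lambda>\<omega>. \<bar>f \<omega>\<bar>) \<le> sqrt (expectation (\<lambda>\<omega>. (f \<omega>)\<^sup>2))"
proof -
  show *: "integrable M f" by (rule square_integrable_imp_integrable) (use sq in auto)
  have "0 \<le> variance (\<lambda>\<omega>. \<bar>f \<omega>\<bar>)" by (rule variance_positive)
  also have "\<dots> = expectation (\<lambda>\<omega>. (f \<omega>)\<^sup>2) - (expectation (\<lambda>\<omega>. \<bar>f \<omega>\<bar>))\<^sup>2"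
    using * sq by (subst variance_eq) auto
  finally show "expectation (\<lambda>\<omega>. \<bar>f \<omega>\<bar>) \<le> sqrt (expectation (\<lambda>\<omega>. (f \<omega>)\<^sup>2))"
    by (intro real_le_rsqrt) simp
qed

text \<open>
  Products over distinct subsets are orthogonal: an index in exactly one of the two subsets
  contributes a factor of mean zero. Singletons and two-element subsets of the index set give the
  linear and the off-diagonal quadratic forms.
\<close>

lemma expectation_prod_prod:
  fixes X :: "'i \<Rightarrow> 'a \<Rightarrow> real"
  assumes J: "finite J" and ind: "indep_vars (\<lambda>_. borel) X J"
    and mean: "\<And>u. u \<in> J \<Longrightarrow> integrable M (X u) \<and> expectation (X u) = 0"
    and var: "\<And>u. u \<in> J \<Longrightarrow> integrable M (\<lambda>\<omega>. (X u \<omega>)\<^sup>2) \<and> expectation (\<lambda>\<omega>. (X u \<omega>)\<^sup>2) = s u"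
    and pq: "p \<subseteq> J" "q \<subseteq> J"
  shows "integrable M (\<lambda>\<omega>. (\<Prod>u\<in>p. X u \<omega>) * (\<Prod>u\<in>q. X u \<omega>))" (is ?I)
    and "expectation (\<lambda>\<omega>. (\<Prod>u\<in>p. X u \<omega>) * (\<Prod>u\<in>q. X u \<omega>)) = (if p = q then \<Prod>u\<in>p. s u else 0)" (is ?E)
proof -
  define e where "e u = (if u \<in> p then 1 else 0) + (if u \<in> q then 1 else 0 :: nat)" for u
  have *: "(\<Prod>u\<in>p. X u \<omega>) * (\<Prod>u\<in>q. X u \<omega>) = (\<Prod>u\<in>J. X u \<omega> ^ e u)" for \<omega>
  proof -
    have "(\<Prod>u\<in>r. X u \<omega>) = (\<Prod>u\<in>J. X u \<omega> ^ (if u \<in> r then 1 else 0))" if "r \<subseteq> J" for r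
      using that J by (intro prod.mono_neutral_cong_left) auto
    from this[OF pq(1)] this[OF pq(2)] show ?thesis
      by (simp add: e_def power_add prod.distrib)
  qed
  have ind': "indep_vars (\<lambda>_. borel) (\<lambda>u \<omega>. X u \<omega> ^ e u) J"
    by (rule indep_vars_compose2[OF ind]) auto
  have int: "integrable M (\<lambda>\<omega>. X u \<omega> ^ e u)" if "u \<in> J" for u
    using mean[OF that] var[OF that] by (auto simp: e_def power2_eq_square)
  show ?I unfolding * by (rule indep_vars_integrable[OF J ind' int])
  have "expectation (\<lambda>\<omega>. (\<Prod>u\<in>p. X u \<omega>) * (\<Prod>u\<in>q. X u \<omega>)) = (\<Prod>u\<in>J. expectation (\<lambda>\<omega>. X u \<omega> ^ e u))"
    unfolding * by (rule indep_vars_lebesgue_integral[OF J ind' int])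
  also have "\<dots> = (if p = q then \<Prod>u\<in>p. s u else 0)"
  proof (cases "p = q")
    case True
    have "(\<Prod>u\<in>p. s u) = (\<Prod>u\<in>J. expectation (\<lambda>\<omega>. X u \<omega> ^ e u))"
      using True pq J var
      by (intro prod.mono_neutral_cong_left) (auto simp: e_def prob_space subset_eq
        power2_eq_square)
    then show ?thesis using True by simp
  next
    case False
    then obtain u where "u \<in> p \<and> u \<notin> q \<or> u \<notin> p \<and> u \<in> q" by blast
    then have "u \<in> J" "e u = 1" using pq by (auto simp: e_def)
    then show ?thesis using False J mean by (auto intro!: prod_zero bexI[of _ u])
  qed
  finally show ?E .
qed

lemma chaos_second_moment:
  fixes X :: "'i \<Rightarrow> 'a \<Rightarrow> real" and c :: "'p \<Rightarrow> complex"
  assumes J: "finite J" and ind: "indep_vars (\<lambda>_. borel) X J"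
    and mean: "\<And>u. u \<in> J \<Longrightarrow> integrable M (X u) \<and> expectation (X u) = 0"
    and var: "\<And>u. u \<in> J \<Longrightarrow> integrable M (\<lambda>\<omega>. (X u \<omega>)\<^sup>2) \<and> expectation (\<lambda>\<omega>. (X u \<omega>)\<^sup>2) = s u"
    and P: "finite P" "inj_on S P" "\<And>p. p \<in> P \<Longrightarrow> S p \<subseteq> J"
  shows "integrable M (\<lambda>\<omega>. (cmod (\<Sum>p\<in>P. c p * of_real (\<Prod>u\<in>S p. X u \<omega>)))\<^sup>2)"
    and "expectation (\<lambda>\<omega>. (cmod (\<Sum>p\<in>P. c p * of_real (\<Prod>u\<in>S p. X u \<omega>)))\<^sup>2)
      = (\<Sum>p\<in>P. (cmod (c p))\<^sup>2 * (\<Prod>u\<in>S p. s u))"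
proof -
  define Y where "Y p \<omega> = (\<Prod>u\<in>S p. X u \<omega>)" for p \<omega>
  have YY: "integrable M (\<lambda>\<omega>. Y p \<omega> * Y q \<omega>)"
    "expectation (\<lambda>\<omega>. Y p \<omega> * Y q \<omega>) = (if p = q then \<Prod>u\<in>S p. s u else 0)" if "p \<in> P" "q \<in> P"
        for p q
    using expectation_prod_prod[OF J ind mean var, of "S p" "S q"] P that
    by (auto simp: Y_def inj_on_eq_iff)
  have *: "(cmod (\<Sum>p\<in>P. c p * of_real (Y p \<omega>)))\<^sup>2
      = (\<Sum>p\<in>P. \<Sum>q\<in>P. Re (c p * cnj (c q)) * (Y p \<omega> * Y q \<omega>))" for \<omega>
  proof -
    have "complex_of_real ((cmod (\<Sum>p\<in>P. c p * of_real (Y p \<omega>)))\<^sup>2)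
        = (\<Sum>p\<in>P. \<Sum>q\<in>P. (c p * cnj (c q)) * of_real (Y p \<omega> * Y q \<omega>))"
      by (simp only: complex_norm_square cnj_sum sum_product) (simp add: mult_ac)
    from arg_cong[OF this, of Re] show ?thesis by simp
  qed
  show "integrable M (\<lambda>\<omega>. (cmod (\<Sum>p\<in>P. c p * of_real (\<Prod>u\<in>S p. X u \<omega>)))\<^sup>2)"
    unfolding Y_def[symmetric] * using YY by (intro Bochner_Integration.integrable_sum
        integrable_mult_right) auto
  have "expectation (\<lambda>\<omega>. (cmod (\<Sum>p\<in>P. c p * of_real (Y p \<omega>)))\<^sup>2)
      = (\<Sum>p\<in>P. \<Sum>q\<in>P. Re (c p * cnj (c q)) * (if p = q then \<Prod>u\<in>S p. s u else 0))"
    unfolding * by (simp add: Bochner_Integration.integral_sum YY integrable_sum cong: sum.cong)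
  also have "\<dots> = (\<Sum>p\<in>P. (cmod (c p))\<^sup>2 * (\<Prod>u\<in>S p. s u))"
    using P by (intro sum.cong refl) (simp add: if_distrib cmod_power2 power2_eq_square[of "Re _"]
        power2_eq_square[of "Im _"] cong: if_cong)
  finally show "expectation (\<lambda>\<omega>. (cmod (\<Sum>p\<in>P. c p * of_real (\<Prod>u\<in>S p. X u \<omega>)))\<^sup>2)
      = (\<Sum>p\<in>P. (cmod (c p))\<^sup>2 * (\<Prod>u\<in>S p. s u))" by (simp add: Y_def)
qed

lemma chaos_first_moment:
  fixes X :: "'i \<Rightarrow> 'a \<Rightarrow> real" and c :: "'p \<Rightarrow> complex"
  assumes J: "finite J" and ind: "indep_vars (\<lambda>_. borel) X J"
    and mean: "\<And>u. u \<in> J \<Longrightarrow> integrable M (X u) \<and> expectation (X u) = 0"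
    and var: "\<And>u. u \<in> J \<Longrightarrow> integrable M (\<lambda>\<omega>. (X u \<omega>)\<^sup>2) \<and> expectation (\<lambda>\<omega>. (X u \<omega>)\<^sup>2) = s u"
    and P: "finite P" "inj_on S P" "\<And>p. p \<in> P \<Longrightarrow> S p \<subseteq> J"
    and le: "(\<Sum>p\<in>P. (cmod (c p))\<^sup>2 * (\<Prod>u\<in>S p. s u)) \<le> B"
  shows "integrable M (\<lambda>\<omega>. cmod (\<Sum>p\<in>P. c p * of_real (\<Prod>u\<in>S p. X u \<omega>)))"
    and "expectation (\<lambda>\<omega>. cmod (\<Sum>p\<in>P. c p * of_real (\<Prod>u\<in>S p. X u \<omega>))) \<le> sqrt B"
proof -
  have [measurable]: "X u \<in> borel_measurable M" if "p \<in> P" "u \<in> S p" for p u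
    using mean[of u] P(3)[OF that(1)] that(2) by auto
  have m: "(\<lambda>\<omega>. cmod (\<Sum>p\<in>P. c p * of_real (\<Prod>u\<in>S p. X u \<omega>))) \<in> borel_measurable M"
    by measurable
  note second = chaos_second_moment[OF J ind mean var P, of c]
  note * = expectation_abs_le_sqrt[OF m second(1)]
  show "integrable M (\<lambda>\<omega>. cmod (\<Sum>p\<in>P. c p * of_real (\<Prod>u\<in>S p. X u \<omega>)))" by (rule *)
  show "expectation (\<lambda>\<omega>. cmod (\<Sum>p\<in>P. c p * of_real (\<Prod>u\<in>S p. X u \<omega>))) \<le> sqrt B"
    using real_sqrt_le_mono[OF le]
    by (intro order_trans[OF *(2)[unfolded abs_norm_cancel]]) (auto simp: second(2) simp del:
      of_real_prod)
qed

text \<open>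
  Fourth moments need not exist, so the squares are truncated at the level \<open>sqrt \<kappa>\<close> for the
  variables. The bounded part has variance at most \<open>\<kappa> * s u\<close> and is treated by orthogonality; the
  rest has mean at most \<open>sqrt \<kappa> * s u\<close> by the bound on the third moment. The level balances the
  two errors.
\<close>

lemma diagonal_form_first_moment:
  fixes X :: "'i \<Rightarrow> 'a \<Rightarrow> real" and c :: "'i \<Rightarrow> complex"
  assumes J: "finite J" and ind: "indep_vars (\<lambda>_. borel) X J"
    and var: "\<And>u. u \<in> J \<Longrightarrow> integrable M (\<lambda>\<omega>. (X u \<omega>)\<^sup>2) \<and> expectation (\<lambda>\<omega>. (X u \<omega>)\<^sup>2) = s u"
    and third: "\<And>u. u \<in> J \<Longrightarrow> integrable M (\<lambda>\<omega>. \<bar>X u \<omega>\<bar> ^ 3)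
        \<and> expectation (\<lambda>\<omega>. \<bar>X u \<omega>\<bar> ^ 3) \<le> \<kappa> * s u"
    and \<kappa>: "\<kappa> > 0" and C: "(\<Sum>u\<in>J. s u) \<le> C" and B: "B \<ge> 0" "\<And>u. u \<in> J \<Longrightarrow> cmod (c u) \<le> B"
  shows "integrable M (\<lambda>\<omega>. cmod (\<Sum>u\<in>J. c u * of_real ((X u \<omega>)\<^sup>2 - s u)))"
    and "expectation (\<lambda>\<omega>. cmod (\<Sum>u\<in>J. c u * of_real ((X u \<omega>)\<^sup>2 - s u)))
      \<le> B * (sqrt (\<kappa> * C) + 2 * sqrt \<kappa> * C)"
proof -
  have [measurable]: "X u \<in> borel_measurable M" if "u \<in> J" for u
    using ind that by (auto simp: indep_vars_def)
  define y z where "y x = (if \<bar>x\<bar> \<le> sqrt \<kappa> then x\<^sup>2 else 0)"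
      and "z x = (if \<bar>x\<bar> \<le> sqrt \<kappa> then 0 else x\<^sup>2)" for x :: real
  have [measurable]: "y \<in> borel_measurable borel" "z \<in> borel_measurable borel"
    unfolding y_def[abs_def] z_def[abs_def] by measurable
  have yz: "x\<^sup>2 = y x + z x" for x by (simp add: y_def z_def)
  have nonneg: "y x \<ge> 0" "z x \<ge> 0" for x by (auto simp: y_def z_def)
  have iy: "integrable M (\<lambda>\<omega>. y (X u \<omega>))" if "u \<in> J" for u
    using conjunct1[OF var[OF that]] by (rule Bochner_Integration.integrable_bound) (use that in
        \<open>auto simp: y_def\<close>)
  have iz: "integrable M (\<lambda>\<omega>. z (X u \<omega>))" if "u \<in> J" for u
    using conjunct1[OF var[OF that]] by (rule Bochner_Integration.integrable_bound) (use that in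
        \<open>auto simp: z_def\<close>)
  have y2: "(y x)\<^sup>2 \<le> \<kappa> * x\<^sup>2" for x
  proof (cases "\<bar>x\<bar> \<le> sqrt \<kappa>")
    case True
    from power_mono[OF True, of 2] \<kappa> have "x\<^sup>2 \<le> \<kappa>" by simp
    then show ?thesis using True by (simp only: y_def power2_eq_square[of "x\<^sup>2"] if_True
        mult_right_mono zero_le_power2)
  qed (use \<kappa> in \<open>auto simp: y_def\<close>)
  have z3: "z x \<le> \<bar>x\<bar> ^ 3 / sqrt \<kappa>" for x
  proof (cases "\<bar>x\<bar> \<le> sqrt \<kappa>")
    case False
    then have "sqrt \<kappa> * \<bar>x\<bar>\<^sup>2 \<le> \<bar>x\<bar> * \<bar>x\<bar>\<^sup>2" by (intro mult_right_mono) auto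
    then show ?thesis using False \<kappa> by (simp add: z_def field_simps power3_eq_cube power2_eq_square)
  qed (use \<kappa> in \<open>auto simp: z_def\<close>)
  have iy2: "integrable M (\<lambda>\<omega>. (y (X u \<omega>))\<^sup>2)" if "u \<in> J" for u
  proof -
    have "integrable M (\<lambda>\<omega>. \<kappa> * (X u \<omega>)\<^sup>2)" using var[OF that] by simp
    then show ?thesis
      by (rule Bochner_Integration.integrable_bound) (use that y2 \<kappa> in \<open>auto simp: abs_mult\<close>)
  qed
  define my mz where "my u = expectation (\<lambda>\<omega>. y (X u \<omega>))" and "mz u = expectation (\<lambda>\<omega>. z (X u \<omega>))"
      for u
  have s: "s u = my u + mz u" if "u \<in> J" for u
    using var[OF that] iy[OF that] iz[OF that] by (simp add: my_def mz_def yz)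
  define U where "U u \<omega> = y (X u \<omega>) - my u" for u \<omega>
  have "indep_vars (\<lambda>_. borel) U J"
    unfolding U_def by (rule indep_vars_compose2[OF ind]) auto
  moreover have "integrable M (U u) \<and> expectation (U u) = 0" if "u \<in> J" for u
    using iy[OF that] by (simp add: U_def[abs_def] my_def prob_space)
  moreover have "integrable M (\<lambda>\<omega>. (U u \<omega>)\<^sup>2)
      \<and> expectation (\<lambda>\<omega>. (U u \<omega>)\<^sup>2) = variance (\<lambda>\<omega>. y (X u \<omega>))" if "u \<in> J" for u
    using iy[OF that] iy2[OF that] by (simp add: U_def[abs_def] my_def power2_diff)
  moreover have "(\<Sum>p\<in>J. (cmod (c p))\<^sup>2 * (\<Prod>u\<in>{p}. variance (\<lambda>\<omega>. y (X u \<omega>)))) \<le> B\<^sup>2 * (\<kappa> * C)"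
  proof -
    have "(\<Sum>p\<in>J. (cmod (c p))\<^sup>2 * (\<Prod>u\<in>{p}. variance (\<lambda>\<omega>. y (X u \<omega>)))) \<le> (\<Sum>p\<in>J. B\<^sup>2 * (\<kappa> * s p))"
    proof (intro sum_mono mult_mono)
      fix p assume p: "p \<in> J"
      have "variance (\<lambda>\<omega>. y (X p \<omega>)) \<le> expectation (\<lambda>\<omega>. (y (X p \<omega>))\<^sup>2)"
        using iy iy2 p by (subst variance_eq) auto
      also have "\<dots> \<le> expectation (\<lambda>\<omega>. \<kappa> * (X p \<omega>)\<^sup>2)"
        using iy2 var y2 p by (intro integral_mono) auto
      also have "\<dots> = \<kappa> * s p" using var[OF p] by simp
      finally show "(\<Prod>u\<in>{p}. variance (\<lambda>\<omega>. y (X u \<omega>))) \<le> \<kappa> * s p" by simp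
      show "(cmod (c p))\<^sup>2 \<le> B\<^sup>2" using B p by (intro power_mono) auto
    qed auto
    also have "\<dots> = B\<^sup>2 * (\<kappa> * (\<Sum>p\<in>J. s p))" by (simp add: sum_distrib_left)
    also have "\<dots> \<le> B\<^sup>2 * (\<kappa> * C)" using C \<kappa> by (intro mult_left_mono) auto
    finally show ?thesis .
  qed
  ultimately have U: "integrable M (\<lambda>\<omega>. cmod (\<Sum>p\<in>J. c p * of_real (\<Prod>u\<in>{p}. U u \<omega>)))"
    "expectation (\<lambda>\<omega>. cmod (\<Sum>p\<in>J. c p * of_real (\<Prod>u\<in>{p}. U u \<omega>))) \<le> sqrt (B\<^sup>2 * (\<kappa> * C))"
    by (intro chaos_first_moment[OF J, of U "\<lambda>u. variance (\<lambda>\<omega>. y (X u \<omega>))" J "\<lambda>p. {p}" c] J; auto)+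
  define W where "W \<omega> = (\<Sum>u\<in>J. c u * of_real (z (X u \<omega>) - mz u))" for \<omega>
  have mz: "mz u \<le> sqrt \<kappa> * s u" "mz u \<ge> 0" if "u \<in> J" for u
  proof -
    have "mz u \<le> expectation (\<lambda>\<omega>. \<bar>X u \<omega>\<bar> ^ 3 / sqrt \<kappa>)"
      unfolding mz_def using iz[OF that] third[OF that] z3 by (intro integral_mono) auto
    also have "\<dots> \<le> \<kappa> * s u / sqrt \<kappa>" using third[OF that] \<kappa> by (simp add: divide_right_mono)
    also have "\<dots> = sqrt \<kappa> * s u" using \<kappa> by (simp add: real_div_sqrt field_simps)
    finally show "mz u \<le> sqrt \<kappa> * s u" .
    show "mz u \<ge> 0" unfolding mz_def by (intro integral_nonneg_AE) (auto simp: nonneg)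
  qed
  have Wle: "cmod (W \<omega>) \<le> (\<Sum>u\<in>J. B * (z (X u \<omega>) + mz u))" for \<omega>
  proof -
    have "cmod (W \<omega>) \<le> (\<Sum>u\<in>J. cmod (c u) * \<bar>z (X u \<omega>) - mz u\<bar>)"
      unfolding W_def by (rule order_trans[OF norm_sum]) (auto simp: norm_mult simp del:
          of_real_diff intro!: sum_mono)
    also have "\<dots> \<le> (\<Sum>u\<in>J. B * (z (X u \<omega>) + mz u))"
    proof (intro sum_mono mult_mono B)
      fix u assume "u \<in> J"
      then show "\<bar>z (X u \<omega>) - mz u\<bar> \<le> z (X u \<omega>) + mz u" using mz[of u] nonneg(2)[of "X u \<omega>"] by auto
    qed auto
    finally show ?thesis .
  qed
  have ib: "integrable M (\<lambda>\<omega>. \<Sum>u\<in>J. B * (z (X u \<omega>) + mz u))" using iz by auto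
  have [measurable]: "W \<in> borel_measurable M" unfolding W_def[abs_def] by measurable
  have iW: "integrable M (\<lambda>\<omega>. cmod (W \<omega>))"
    using ib by (rule Bochner_Integration.integrable_bound) (auto intro!: AE_I2 order_trans[OF Wle])
  have "expectation (\<lambda>\<omega>. cmod (W \<omega>)) \<le> expectation (\<lambda>\<omega>. \<Sum>u\<in>J. B * (z (X u \<omega>) + mz u))"
    using iW ib Wle by (rule integral_mono)
  also have "\<dots> = (\<Sum>u\<in>J. B * (2 * mz u))"
    using iz by (simp add: Bochner_Integration.integral_sum mz_def prob_space)
  also have "\<dots> \<le> (\<Sum>u\<in>J. B * (2 * (sqrt \<kappa> * s u)))"
    using mz B by (intro sum_mono mult_left_mono) auto
  also have "\<dots> = B * (2 * sqrt \<kappa> * (\<Sum>u\<in>J. s u))"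
      by (simp add: sum_distrib_left[symmetric] sum_distrib_right[symmetric])
  also have "\<dots> \<le> B * (2 * sqrt \<kappa> * C)" using B C \<kappa> by (intro mult_left_mono) auto
  finally have EW: "expectation (\<lambda>\<omega>. cmod (W \<omega>)) \<le> B * (2 * sqrt \<kappa> * C)" .
  define V where "V \<omega> = (\<Sum>p\<in>J. c p * of_real (U p \<omega>))" for \<omega>
  have V: "integrable M (\<lambda>\<omega>. cmod (V \<omega>))" "expectation (\<lambda>\<omega>. cmod (V \<omega>)) \<le> B * sqrt (\<kappa> * C)"
    using U B by (simp_all add: V_def real_sqrt_mult)
  have [measurable]: "V \<in> borel_measurable M" unfolding V_def[abs_def] U_def by measurable
  have VW: "(\<Sum>u\<in>J. c u * of_real ((X u \<omega>)\<^sup>2 - s u)) = V \<omega> + W \<omega>" for \<omega>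
    unfolding V_def W_def U_def sum.distrib[symmetric]
    by (intro sum.cong refl) (simp add: s yz algebra_simps)
  have iVW: "integrable M (\<lambda>\<omega>. cmod (V \<omega>) + cmod (W \<omega>))" using V iW by auto
  show i: "integrable M (\<lambda>\<omega>. cmod (\<Sum>u\<in>J. c u * of_real ((X u \<omega>)\<^sup>2 - s u)))"
    unfolding VW using iVW by (rule Bochner_Integration.integrable_bound) (auto intro!: AE_I2
        norm_triangle_ineq)
  have "expectation (\<lambda>\<omega>. cmod (V \<omega> + W \<omega>)) \<le> expectation (\<lambda>\<omega>. cmod (V \<omega>) + cmod (W \<omega>))"
    using i[unfolded VW] iVW by (intro integral_mono) (auto intro: norm_triangle_ineq)
  also have "\<dots> \<le> B * sqrt (\<kappa> * C) + B * (2 * sqrt \<kappa> * C)" using V iW EW by simp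
  finally show "expectation (\<lambda>\<omega>. cmod (\<Sum>u\<in>J. c u * of_real ((X u \<omega>)\<^sup>2 - s u)))
      \<le> B * (sqrt (\<kappa> * C) + 2 * sqrt \<kappa> * C)"
    unfolding VW by (simp add: distrib_left)
qed

end

lemma sum_square_split:
  fixes f :: "'i::linorder \<Rightarrow> 'i \<Rightarrow> 'b::comm_monoid_add"
  assumes "finite J"
  shows "(\<Sum>j\<in>J. \<Sum>k\<in>J. f j k) = (\<Sum>j\<in>J. f j j) + (\<Sum>(j, k)\<in>{(j, k). j \<in> J \<and> k \<in> J
      \<and> j < k}. f j k + f k j)"
proof -
  let ?P = "{(j, k). j \<in> J \<and> k \<in> J \<and> j < k}" and ?D = "(\<lambda>j. (j, j)) ` J" and ?Q
      = "(\<lambda>(j, k). (k, j)) ` {(j, k). j \<in> J \<and> k \<in> J \<and> j < k}"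
  have fin: "finite ?P" by (rule finite_subset[of _ "J \<times> J"]) (use assms in auto)
  have J: "J \<times> J = ?D \<union> (?P \<union> ?Q)" by (auto simp: image_iff)
  have "(\<Sum>j\<in>J. \<Sum>k\<in>J. f j k) = (\<Sum>(j, k)\<in>J \<times> J. f j k)" by (rule sum.cartesian_product)
  also have "\<dots> = (\<Sum>(j, k)\<in>?D. f j k) + ((\<Sum>(j, k)\<in>?P. f j k) + (\<Sum>(j, k)\<in>?Q. f j k))"
    unfolding J using assms fin by (subst sum.union_disjoint; (subst sum.union_disjoint)?) auto
  also have "(\<Sum>(j, k)\<in>?D. f j k) = (\<Sum>j\<in>J. f j j)" by (subst sum.reindex) (auto simp: inj_on_def)
  also have "(\<Sum>(j, k)\<in>?Q. f j k) = (\<Sum>(j, k)\<in>?P. f k j)"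
    by (subst sum.reindex) (auto simp: inj_on_def intro!: sum.cong)
  finally show ?thesis by (simp add: sum.distrib case_prod_unfold)
qed

context prob_space begin

text \<open>
  The bound on the columns of \<open>c\<close> is the one that the Ward identity provides for a resolvent. The
  off-diagonal part is a combination of products over two-element subsets, with second moment at
  most \<open>2 * \<Sum>j k. s j * s k * (cmod (c j k))\<^sup>2\<close>; one of the two variances is bounded by \<open>\<sigma>\<close> and
  the sum over \<open>j\<close> by \<open>B\<^sup>2\<close>.
\<close>

lemma quadratic_form_first_moment:
  fixes X :: "'i::linorder \<Rightarrow> 'a \<Rightarrow> real" and c :: "'i \<Rightarrow> 'i \<Rightarrow> complex"
  assumes J: "finite J" and ind: "indep_vars (\<lambda>_. borel) X J"
    and mean: "\<And>u. u \<in> J \<Longrightarrow> integrable M (X u) \<and> expectation (X u) = 0"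
    and var: "\<And>u. u \<in> J \<Longrightarrow> integrable M (\<lambda>\<omega>. (X u \<omega>)\<^sup>2) \<and> expectation (\<lambda>\<omega>. (X u \<omega>)\<^sup>2) = s u"
    and third: "\<And>u. u \<in> J \<Longrightarrow> integrable M (\<lambda>\<omega>. \<bar>X u \<omega>\<bar> ^ 3)
        \<and> expectation (\<lambda>\<omega>. \<bar>X u \<omega>\<bar> ^ 3) \<le> \<kappa> * s u"
    and \<kappa>: "\<kappa> > 0" and \<sigma>: "\<And>u. u \<in> J \<Longrightarrow> s u \<le> \<sigma>" and C: "(\<Sum>u\<in>J. s u) \<le> C"
    and B: "B \<ge> 0" "\<And>k. k \<in> J \<Longrightarrow> (\<Sum>j\<in>J. (cmod (c j k))\<^sup>2) \<le> B\<^sup>2"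
  shows "(\<integral>\<^sup>+\<omega>. ennreal (cmod ((\<Sum>j\<in>J. \<Sum>k\<in>J. of_real (X j \<omega>) * of_real (X k \<omega>) * c j k)
      - (\<Sum>j\<in>J. s j * c j j))) \<partial>M)
    \<le> ennreal (B * (sqrt (2 * \<sigma> * C) + sqrt (\<kappa> * C) + 2 * sqrt \<kappa> * C))"
proof (cases "J = {}")
  case False
  let ?P = "{(j, k). j \<in> J \<and> k \<in> J \<and> j < k}"
  define D where "D \<omega> = (\<Sum>u\<in>J. c u u * of_real ((X u \<omega>)\<^sup>2 - s u))" for \<omega>
  define Off where "Off \<omega> = (\<Sum>p\<in>?P. (case p of (j, k) \<Rightarrow> c j k + c k j)
      * of_real (\<Prod>u\<in>(case p of (j, k) \<Rightarrow> {j, k}). X u \<omega>))" for \<omega>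
  have fin: "finite ?P" by (rule finite_subset[of _ "J \<times> J"]) (use J in auto)
  have s0: "s u \<ge> 0" if "u \<in> J" for u
  proof -
    have "0 \<le> expectation (\<lambda>\<omega>. (X u \<omega>)\<^sup>2)" by simp
    then show ?thesis using var[OF that] by simp
  qed
  have \<sigma>0: "\<sigma> \<ge> 0" using False s0 \<sigma> by (meson all_not_in_conv order_trans)
  have cB: "cmod (c u u) \<le> B" if "u \<in> J" for u
  proof -
    have "(cmod (c u u))\<^sup>2 \<le> (\<Sum>j\<in>J. (cmod (c j u))\<^sup>2)"
      by (rule member_le_sum) (use that J in auto)
    with B(2)[OF that] have "(cmod (c u u))\<^sup>2 \<le> B\<^sup>2" by simp
    then show ?thesis using B(1) by (rule power2_le_imp_le)
  qed
  have D: "integrable M (\<lambda>\<omega>. cmod (D \<omega>))" "expectation (\<lambda>\<omega>. cmod (D \<omega>))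
      \<le> B * (sqrt (\<kappa> * C) + 2 * sqrt \<kappa> * C)"
    unfolding D_def by (rule diagonal_form_first_moment[OF J ind var third \<kappa> C B(1) cB];
        assumption)+
  have "(\<Sum>p\<in>?P. (cmod (case p of (j, k) \<Rightarrow> c j k + c k j))\<^sup>2 * (\<Prod>u\<in>(case p of (j, k) \<Rightarrow> {j, k}). s u))
      \<le> (\<Sum>(j, k)\<in>?P. 2 * ((cmod (c j k))\<^sup>2 * (s j * s k)) + 2 * ((cmod (c k j))\<^sup>2 * (s k * s j)))"
  proof (intro sum_mono, clarify)
    fix j k assume jk: "j \<in> J" "k \<in> J" "j < k"
    have "(cmod (c j k + c k j))\<^sup>2 \<le> (cmod (c j k) + cmod (c k j))\<^sup>2"
      by (intro power_mono norm_triangle_ineq) auto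
    also have "\<dots> \<le> 2 * (cmod (c j k))\<^sup>2 + 2 * (cmod (c k j))\<^sup>2"
      using sum_squares_bound[of "cmod (c j k)" "cmod (c k j)"] by (simp add: power2_sum)
    finally have "(cmod (c j k + c k j))\<^sup>2 * (s j * s k)
        \<le> (2 * (cmod (c j k))\<^sup>2 + 2 * (cmod (c k j))\<^sup>2) * (s j * s k)"
      using s0 jk by (intro mult_right_mono) auto
    then show "(cmod (c j k + c k j))\<^sup>2 * (\<Prod>u\<in>{j, k}. s u)
        \<le> 2 * ((cmod (c j k))\<^sup>2 * (s j * s k)) + 2 * ((cmod (c k j))\<^sup>2 * (s k * s j))"
      using jk by (simp add: algebra_simps)
  qed
  also have "\<dots> \<le> (\<Sum>j\<in>J. 2 * ((cmod (c j j))\<^sup>2 * (s j * s j))) + (\<Sum>(j, k)\<in>?P. 2 * ((cmod (c j k))\<^sup>2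
      * (s j * s k)) + 2 * ((cmod (c k j))\<^sup>2 * (s k * s j)))"
    using s0 by (simp add: sum_nonneg)
  also have "\<dots> = (\<Sum>j\<in>J. \<Sum>k\<in>J. 2 * ((cmod (c j k))\<^sup>2 * (s j * s k)))"
    by (rule sum_square_split[OF J, symmetric])
  also have "\<dots> = (\<Sum>k\<in>J. \<Sum>j\<in>J. 2 * ((cmod (c j k))\<^sup>2 * (s j * s k)))" by (rule sum.swap)
  also have "\<dots> \<le> (\<Sum>k\<in>J. \<Sum>j\<in>J. 2 * ((cmod (c j k))\<^sup>2 * (\<sigma> * s k)))"
    using s0 \<sigma> by (intro sum_mono mult_left_mono mult_right_mono) auto
  also have "\<dots> = (\<Sum>k\<in>J. (2 * \<sigma> * s k) * (\<Sum>j\<in>J. (cmod (c j k))\<^sup>2))"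
    by (simp add: sum_distrib_left mult_ac)
  also have "\<dots> \<le> (\<Sum>k\<in>J. (2 * \<sigma> * s k) * B\<^sup>2)"
    using B s0 \<sigma>0 by (intro sum_mono mult_left_mono) auto
  also have "\<dots> = 2 * \<sigma> * B\<^sup>2 * (\<Sum>k\<in>J. s k)"
    by (simp add: sum_distrib_left[symmetric] sum_distrib_right[symmetric])
  also have "\<dots> \<le> 2 * \<sigma> * B\<^sup>2 * C" using C \<sigma>0 by (intro mult_left_mono) auto
  finally have le: "(\<Sum>p\<in>?P. (cmod (case p of (j, k) \<Rightarrow> c j k + c k j))\<^sup>2
      * (\<Prod>u\<in>(case p of (j, k) \<Rightarrow> {j, k}). s u))
      \<le> B\<^sup>2 * (2 * \<sigma> * C)" by (simp add: mult_ac)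
  have inj: "inj_on (\<lambda>p. case p of (j, k) \<Rightarrow> {j, k}) ?P"
    by (auto simp: inj_on_def doubleton_eq_iff)
  have Off: "integrable M (\<lambda>\<omega>. cmod (Off \<omega>))" "expectation (\<lambda>\<omega>. cmod (Off \<omega>))
      \<le> sqrt (B\<^sup>2 * (2 * \<sigma> * C))"
    unfolding Off_def by (rule chaos_first_moment[OF J ind mean var fin inj _ le]; (assumption |
        force))+
  have eq: "(\<Sum>j\<in>J. \<Sum>k\<in>J. of_real (X j \<omega>) * of_real (X k \<omega>) * c j k) - (\<Sum>j\<in>J. s j * c j j)
      = D \<omega> + Off \<omega>" for \<omega>
  proof -
    have "Off \<omega> = (\<Sum>(j, k)\<in>?P. of_real (X j \<omega>) * of_real (X k \<omega>) * c j k + of_real (X k \<omega>)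
        * of_real (X j \<omega>) * c k j)"
      unfolding Off_def by (intro sum.cong refl) (auto simp: algebra_simps)
    then show ?thesis unfolding D_def sum_square_split[OF J, of "\<lambda>j k. of_real (X j \<omega>)
        * of_real (X k \<omega>) * c j k"]
      by (simp add: algebra_simps sum_subtractf power2_eq_square)
  qed
  have "(\<integral>\<^sup>+\<omega>. ennreal (cmod (D \<omega> + Off \<omega>)) \<partial>M) \<le> (\<integral>\<^sup>+\<omega>. ennreal (cmod (D \<omega>) + cmod (Off \<omega>)) \<partial>M)"
    by (intro nn_integral_mono ennreal_leI norm_triangle_ineq)
  also have "\<dots> = ennreal (expectation (\<lambda>\<omega>. cmod (D \<omega>) + cmod (Off \<omega>)))"
    using D Off by (intro nn_integral_eq_integral) auto
  also have "\<dots> \<le> ennreal (B * (sqrt (2 * \<sigma> * C) + sqrt (\<kappa> * C) + 2 * sqrt \<kappa> * C))"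
    using D Off B(1) by (intro ennreal_leI) (simp add: real_sqrt_mult algebra_simps)
  finally show ?thesis unfolding eq .
qed simp

text \<open>
  A bound in mean that is uniform in the value of an independent variable survives inserting the
  variable. It is used with \<open>X\<close> a row of the matrix and \<open>Y\<close> the remaining entries, which determine
  the resolvent of the minor.
\<close>

lemma freezing:
  assumes ind: "indep_var S X T Y" and F[measurable]: "F \<in> borel_measurable (S \<Otimes>\<^sub>M T)"
    and le: "\<And>y. y \<in> space T \<Longrightarrow> (\<integral>\<^sup>+\<omega>. F (X \<omega>, y) \<partial>M) \<le> B"
  shows "(\<integral>\<^sup>+\<omega>. F (X \<omega>, Y \<omega>) \<partial>M) \<le> (B :: ennreal)"
proof -
  have [measurable]: "X \<in> measurable M S" "Y \<in> measurable M T"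
    using ind by (auto dest: indep_var_rv1 indep_var_rv2)
  interpret X: prob_space "distr M S X" by (rule prob_space_distr) measurable
  interpret Y: prob_space "distr M T Y" by (rule prob_space_distr) measurable
  interpret XY: pair_sigma_finite "distr M S X" "distr M T Y" ..
  have "(\<integral>\<^sup>+\<omega>. F (X \<omega>, Y \<omega>) \<partial>M) = (\<integral>\<^sup>+p. F p \<partial>distr M (S \<Otimes>\<^sub>M T) (\<lambda>\<omega>. (X \<omega>, Y \<omega>)))"
    by (subst nn_integral_distr) auto
  also have "\<dots> = (\<integral>\<^sup>+p. F p \<partial>(distr M S X \<Otimes>\<^sub>M distr M T Y))"
    using ind by (simp add: indep_var_distribution_eq)
  also have "\<dots> = (\<integral>\<^sup>+y. (\<integral>\<^sup>+x. F (x, y) \<partial>distr M S X) \<partial>distr M T Y)"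
    by (rule XY.nn_integral_snd[symmetric]) simp
  also have "\<dots> \<le> (\<integral>\<^sup>+y. B \<partial>distr M T Y)"
    by (intro nn_integral_mono) (simp add: nn_integral_distr le)
  also have "\<dots> = B" using Y.emeasure_space_1 by simp
  finally show ?thesis .
qed

end

section \<open>The resolvent of a random matrix with independent entries\<close>

text \<open>
  The symmetric matrix whose upper triangle is given by \<open>x\<close>; the independent entries are indexed
  by pairs \<open>(j, k)\<close> with \<open>j \<le> k\<close>.
\<close>

definition sym_entry :: "('i::linorder \<times> 'i \<Rightarrow> 'b) \<Rightarrow> 'i \<Rightarrow> 'i \<Rightarrow> 'b" where
  "sym_entry x j k = x (min j k, max j k)"

lemma sym_entry_commute: "sym_entry x j k = sym_entry x k j"
  by (simp add: sym_entry_def min.commute max.commute)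

lemma borel_measurable_det:
  assumes "\<And>i j. i < n \<Longrightarrow> j < n \<Longrightarrow> (\<lambda>\<omega>. f \<omega> i j) \<in> borel_measurable M"
  shows "(\<lambda>\<omega>. det (mat n n (\<lambda>(i, j). f \<omega> i j)) :: complex) \<in> borel_measurable M"
proof -
  have "det (mat n n (\<lambda>(i, j). f \<omega> i j))
      = (\<Sum>p\<in>{p. p permutes {0..<n}}. signof p * (\<Prod>i = 0..<n. f \<omega> i (p i)))" for \<omega>
    by (subst det_def'[of _ n])
      (auto intro!: sum.cong prod.cong arg_cong2[of _ _ _ _ "(*)"] dest: permutes_in_image)
  moreover have "(\<lambda>\<omega>. \<Sum>p\<in>{p. p permutes {0..<n}}. signof p * (\<Prod>i = 0..<n. f \<omega> i (p i)))
      \<in> borel_measurable M"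
    by (intro borel_measurable_sum borel_measurable_times borel_measurable_const
      borel_measurable_prod assms)
      (auto dest: permutes_in_image)
  ultimately show ?thesis by simp
qed

lemma resolvent_entry_cong:
  assumes "\<And>j k. j < N \<Longrightarrow> k < N \<Longrightarrow> H j k = H' j k"
  shows "resolvent_entry N H z = resolvent_entry N H' z"
proof -
  have "mat N N (\<lambda>(k, l). (if k = l then z else 0) - complex_of_real (H k l))
      = mat N N (\<lambda>(k, l). (if k = l then z else 0) - complex_of_real (H' k l))"
    by (intro eq_matI) (use assms in auto)
  then show ?thesis by (simp add: resolvent_entry_def fun_eq_iff)
qed

lemma borel_measurable_resolvent_entry:
  assumes H: "\<And>k l. k < N \<Longrightarrow> l < N \<Longrightarrow> (\<lambda>\<omega>. H \<omega> k l) \<in> borel_measurable M" and "i < N" "j < N"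
  shows "(\<lambda>\<omega>. resolvent_entry N (H \<omega>) z i j) \<in> borel_measurable M"
proof -
  define f where "f \<omega> k l = (if k = l then z else 0) - complex_of_real (H \<omega> k l)" for \<omega> k l
  have f: "(\<lambda>\<omega>. f \<omega> k l) \<in> borel_measurable M" if "k < N" "l < N" for k l
    unfolding f_def using H[OF that] by measurable
  have "cofactor (mat N N (\<lambda>(k, l). f \<omega> k l)) j i = (-1) ^ (j + i) *
      det (mat (N - 1) (N - 1) (\<lambda>(k, l). f \<omega> (if k < j then k else Suc k) (if l
          < i then l else Suc l)))" for \<omega>
    unfolding cofactor_def mat_delete_def using assms
    by (intro arg_cong2[of _ _ _ _ "(*)"] arg_cong[of _ _ det] eq_matI) auto
  then have "resolvent_entry N (H \<omega>) z i j = - ((-1) ^ (j + i) *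
      det (mat (N - 1) (N - 1) (\<lambda>(k, l). f \<omega> (if k < j then k else Suc k) (if l
          < i then l else Suc l))))
      / det (mat N N (\<lambda>(k, l). f \<omega> k l))" for \<omega>
    by (simp add: resolvent_entry_def f_def)
  moreover have "(\<lambda>\<omega>. - ((-1) ^ (j + i) *
      det (mat (N - 1) (N - 1) (\<lambda>(k, l). f \<omega> (if k < j then k else Suc k) (if l
          < i then l else Suc l))))
      / det (mat N N (\<lambda>(k, l). f \<omega> k l))) \<in> borel_measurable M"
    by (intro borel_measurable_divide borel_measurable_uminus borel_measurable_times
      borel_measurable_const
        borel_measurable_det f) auto
  ultimately show ?thesis by simp
qed

lemma (in prob_space) indep_vars_reindex:
  assumes "indep_vars M' X I" "inj_on f L" "f ` L \<subseteq> I"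
  shows "indep_vars (\<lambda>l. M' (f l)) (\<lambda>l. X (f l)) L"
proof -
  have "indep_vars (\<lambda>l. PiM {f l} M') (\<lambda>l \<omega>. restrict (\<lambda>i. X i \<omega>) {f l}) L"
    by (rule indep_vars_restrict[OF assms(1)])
      (use assms in \<open>auto simp: disjoint_family_on_def inj_on_def\<close>)
  from indep_vars_compose2[OF this, of "\<lambda>l x. x (f l)" "\<lambda>l. M' (f l)"] show ?thesis
    by (simp add: measurable_component_singleton)
qed

text \<open>
  Overwriting row and column \<open>i\<close> by zero keeps the size of the matrix; away from the index \<open>i\<close> the
  resolvent is that of the minor.
\<close>

definition minor_entry :: "nat \<Rightarrow> (nat \<Rightarrow> nat \<Rightarrow> real) \<Rightarrow> nat \<Rightarrow> nat \<Rightarrow> real" where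
  "minor_entry i H j k = (if j = i \<or> k = i then 0 else H j k)"

lemma is_resolvent_resolvent_entry:
  assumes "\<And>j k. j < N \<Longrightarrow> k < N \<Longrightarrow> H j k = H k j" "Im z \<noteq> 0"
  shows "is_resolvent {..<N} H z (resolvent_entry N H z)"
  unfolding is_resolvent_def by (intro ballI resolvent_entry_eq) (use assms in auto)

lemma is_resolvent_minor_entry:
  assumes "\<And>j k. j < N \<Longrightarrow> k < N \<Longrightarrow> H j k = H k j" "Im z \<noteq> 0"
  shows "is_resolvent ({..<N} - {i}) H z (resolvent_entry N (minor_entry i H) z)"
proof -
  have "(\<Sum>j\<in>{..<N} - {i}. complex_of_real (H k j) * g j)
      = (\<Sum>j<N. complex_of_real (minor_entry i H k j) * g j)"
    if "k \<noteq> i" for k g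
    using that by (intro sum.mono_neutral_cong_left) (auto simp: minor_entry_def)
  moreover have "is_resolvent {..<N} (minor_entry i H) z (resolvent_entry N (minor_entry i H) z)"
    by (rule is_resolvent_resolvent_entry) (use assms in \<open>auto simp: minor_entry_def\<close>)
  ultimately show ?thesis by (auto simp: is_resolvent_def)
qed

context prob_space begin

text \<open>
  For each \<open>i\<close> the minor is a function of the entries outside row and column \<open>i\<close>, so \<open>freezing\<close>
  reduces the error term of \<open>diagonal_near_fixed_point\<close> to a quadratic form with constant
  coefficients, whose columns have norm at most \<open>1 / \<bar>Im z\<bar>\<close>.
\<close>

theorem resolvent_diagonal_first_moment:
  fixes X :: "nat \<times> nat \<Rightarrow> 'a \<Rightarrow> real" and s :: "nat \<Rightarrow> nat \<Rightarrow> real" and N :: nat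
  defines "Ix \<equiv> {(j, k). j \<le> k \<and> k < N}"
  assumes ind: "indep_vars (\<lambda>_. borel) X Ix"
    and mean: "\<And>j k. j \<le> k \<Longrightarrow> k < N \<Longrightarrow> integrable M (X (j, k)) \<and> expectation (X (j, k)) = 0"
    and var: "\<And>j k. j \<le> k \<Longrightarrow> k < N \<Longrightarrow>
        integrable M (\<lambda>\<omega>. (X (j, k) \<omega>)\<^sup>2) \<and> expectation (\<lambda>\<omega>. (X (j, k) \<omega>)\<^sup>2) = s j k"
    and third: "\<And>j k. j \<le> k \<Longrightarrow> k < N \<Longrightarrow>
        integrable M (\<lambda>\<omega>. \<bar>X (j, k) \<omega>\<bar> ^ 3) \<and> expectation (\<lambda>\<omega>. \<bar>X (j, k) \<omega>\<bar> ^ 3) \<le> \<kappa> * s j k"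
    and s: "\<And>j k. s j k = s k j" "\<And>j k. j < N \<Longrightarrow> k < N \<Longrightarrow> s j k \<le> \<sigma>"
    and \<kappa>: "\<kappa> > 0"
    and C: "\<And>i. i < N \<Longrightarrow> (\<Sum>j<N. s i j) \<le> C" "2 * C \<le> (Im z)\<^sup>2" and z: "Im z \<noteq> 0"
    and w: "w * (- z - of_real V * w) = 1" "cmod w \<le> 1 / \<bar>Im z\<bar>"
  shows "(\<integral>\<^sup>+\<omega>. ennreal (\<Sum>i<N. cmod (resolvent_entry N (sym_entry (\<lambda>p. X p \<omega>)) z i i - w)) \<partial>M)
    \<le> ennreal (2 / (Im z)\<^sup>2 * ((\<Sum>i<N. \<bar>(\<Sum>j<N. s i j) - V\<bar>) / \<bar>Im z\<bar>
        + real N * (2 * \<sigma> / \<bar>Im z\<bar> + sqrt \<sigma>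
          + (sqrt (2 * \<sigma> * C) + sqrt (\<kappa> * C) + 2 * sqrt \<kappa> * C) / \<bar>Im z\<bar>)))"
proof (cases "N = 0")
  case False
  define \<delta> where "\<delta> = 1 / \<bar>Im z\<bar> * (sqrt (2 * \<sigma> * C) + sqrt (\<kappa> * C) + 2 * sqrt \<kappa> * C)"
  have Xm[measurable]: "X p \<in> borel_measurable M" if "p \<in> Ix" for p
    using ind that by (auto simp: indep_vars_def)
  have Ix: "(min j k, max j k) \<in> Ix" if "j < N" "k < N" for j k
    using that by (auto simp: Ix_def)
  define H where "H \<omega> = sym_entry (\<lambda>p. X p \<omega>)" for \<omega>
  define G' where "G' x i = resolvent_entry N (minor_entry i (sym_entry x)) z"
      for x :: "nat \<times> nat \<Rightarrow> real" and i
  define Q where "Q x y i = (\<Sum>j\<in>{..<N} - {i}. \<Sum>k\<in>{..<N} - {i}.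
      complex_of_real (sym_entry x i j) * complex_of_real (sym_entry x i k) * G' y i j k)
      - (\<Sum>j\<in>{..<N} - {i}. s i j * G' y i j j)" for x y i
  have entry: "integrable M (\<lambda>\<omega>. sym_entry (\<lambda>p. X p \<omega>) j k)
      \<and> expectation (\<lambda>\<omega>. sym_entry (\<lambda>p. X p \<omega>) j k) = 0"
      "integrable M (\<lambda>\<omega>. (sym_entry (\<lambda>p. X p \<omega>) j k)\<^sup>2)
          \<and> expectation (\<lambda>\<omega>. (sym_entry (\<lambda>p. X p \<omega>) j k)\<^sup>2) = s j k"
      "integrable M (\<lambda>\<omega>. \<bar>sym_entry (\<lambda>p. X p \<omega>) j k\<bar> ^ 3)
          \<and> expectation (\<lambda>\<omega>. \<bar>sym_entry (\<lambda>p. X p \<omega>) j k\<bar> ^ 3) \<le> \<kappa> * s j k"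
    if "j < N" "k < N" for j k
  proof -
    have "s j k = s (min j k) (max j k)" using s(1)[of j k] by (simp add: min_def max_def)
    then show "integrable M (\<lambda>\<omega>. sym_entry (\<lambda>p. X p \<omega>) j k)
        \<and> expectation (\<lambda>\<omega>. sym_entry (\<lambda>p. X p \<omega>) j k) = 0"
      "integrable M (\<lambda>\<omega>. (sym_entry (\<lambda>p. X p \<omega>) j k)\<^sup>2)
          \<and> expectation (\<lambda>\<omega>. (sym_entry (\<lambda>p. X p \<omega>) j k)\<^sup>2) = s j k"
      "integrable M (\<lambda>\<omega>. \<bar>sym_entry (\<lambda>p. X p \<omega>) j k\<bar> ^ 3)
          \<and> expectation (\<lambda>\<omega>. \<bar>sym_entry (\<lambda>p. X p \<omega>) j k\<bar> ^ 3) \<le> \<kappa> * s j k"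
      using mean[of "min j k" "max j k"] var[of "min j k" "max j k"] third[of "min j k" "max j k"]
          that
      by (simp_all add: sym_entry_def)
  qed
  have s0: "s j k \<ge> 0" if "j < N" "k < N" for j k
  proof -
    have "0 \<le> expectation (\<lambda>\<omega>. (sym_entry (\<lambda>p. X p \<omega>) j k)\<^sup>2)" by simp
    then show ?thesis using entry(2)[OF that] by simp
  qed
  have \<sigma>0: "\<sigma> \<ge> 0" using s0[of 0 0] s(2)[of 0 0] False by linarith
  have quad: "(\<integral>\<^sup>+\<omega>. ennreal (cmod (Q (\<lambda>p. X p \<omega>) (\<lambda>p. X p \<omega>) i)) \<partial>M) \<le> ennreal \<delta>" if i: "i < N"
      for i
  proof -
    define A where "A = (\<lambda>j. (min i j, max i j)) ` {..<N}"
    have A: "A \<subseteq> Ix" using Ix i by (auto simp: A_def)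
    have inA: "(min i j, max i j) \<in> A" if "j < N" for j using that by (auto simp: A_def)
    have inB: "(min j k, max j k) \<in> Ix - A" if "j < N" "k < N" "j \<noteq> i" "k \<noteq> i" for j k
      using that Ix by (auto simp: A_def min_def max_def split: if_splits)
    let ?S = "PiM A (\<lambda>_. borel :: real measure)" and ?T = "PiM (Ix - A) (\<lambda>_. borel :: real measure)"
    let ?x = "\<lambda>\<omega>. restrict (\<lambda>p. X p \<omega>) A" and ?y = "\<lambda>\<omega>. restrict (\<lambda>p. X p \<omega>) (Ix - A)"
    have ind': "indep_var ?S ?x ?T ?y"
      by (rule indep_var_restrict[OF ind]) (use A in auto)
    have "minor_entry i (sym_entry (?y \<omega>)) j k = minor_entry i (sym_entry (\<lambda>p. X p \<omega>)) j k"
        if "j < N" "k < N" for \<omega> j k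
      using inB that by (simp add: minor_entry_def sym_entry_def)
    then have G': "G' (?y \<omega>) i = G' (\<lambda>p. X p \<omega>) i" for \<omega>
      unfolding G'_def by (intro resolvent_entry_cong)
    have xA: "sym_entry (restrict f A) i j = sym_entry f i j" if "j < N"
        for f :: "nat \<times> nat \<Rightarrow> real" and j
      using inA[OF that] by (simp add: sym_entry_def)
    have Q: "Q (\<lambda>p. X p \<omega>) (\<lambda>p. X p \<omega>) i = Q (?x \<omega>) (?y \<omega>) i" for \<omega>
      unfolding Q_def G' by (intro arg_cong2[of _ _ _ _ "(-)"] sum.cong refl) (auto simp: xA)
    have mG: "(\<lambda>p. G' (snd p) i j k) \<in> borel_measurable (?S \<Otimes>\<^sub>M ?T)" if "j < N" "k < N" for j k
      unfolding G'_def
    proof (rule borel_measurable_resolvent_entry)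
      fix k l assume kl: "k < N" "l < N"
      show "(\<lambda>p. minor_entry i (sym_entry (snd p)) k l) \<in> borel_measurable (?S \<Otimes>\<^sub>M ?T)"
      proof (cases "k = i \<or> l = i")
        case False
        then have "(min k l, max k l) \<in> Ix - A" using inB kl by auto
        from measurable_compose[OF measurable_snd measurable_component_singleton[OF this]]
        show ?thesis using False by (simp add: minor_entry_def sym_entry_def)
      qed (auto simp: minor_entry_def)
    qed (use that in auto)
    have mx: "(\<lambda>p. sym_entry (fst p) i j) \<in> borel_measurable (?S \<Otimes>\<^sub>M ?T)" if "j < N" for j
      unfolding sym_entry_def by (rule measurable_compose[OF measurable_fst
          measurable_component_singleton[OF inA[OF that]]])
    have mQ: "(\<lambda>p. ennreal (cmod (Q (fst p) (snd p) i))) \<in> borel_measurable (?S \<Otimes>\<^sub>M ?T)"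
      unfolding Q_def
      supply mG[measurable] mx[measurable] by measurable
    have "(\<integral>\<^sup>+\<omega>. (\<lambda>p. ennreal (cmod (Q (fst p) (snd p) i))) (?x \<omega>, ?y \<omega>) \<partial>M) \<le> ennreal \<delta>"
    proof (rule freezing[OF ind' mQ], simp only: fst_conv snd_conv)
      fix y assume "y \<in> space ?T"
      interpret symmetric_resolvent "{..<N} - {i}" "sym_entry y" z "G' y i"
        unfolding G'_def
        by unfold_locales (use z is_resolvent_minor_entry[OF sym_entry_commute z] in \<open>auto intro:
          sym_entry_commute\<close>)
      have "inj_on (\<lambda>j. (min i j, max i j)) {..<N}"
          by (auto simp: inj_on_def min_def max_def split: if_splits)
      then have "indep_vars (\<lambda>_. borel) (\<lambda>j. X (min i j, max i j)) ({..<N} - {i})"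
        by (intro indep_vars_reindex[OF ind]) (use Ix i in \<open>auto intro: inj_on_subset\<close>)
      then have "(\<integral>\<^sup>+\<omega>. ennreal (cmod ((\<Sum>j\<in>{..<N} - {i}. \<Sum>k\<in>{..<N} - {i}.
           of_real (X (min i j, max i j) \<omega>) * of_real (X (min i k, max i k) \<omega>) * G' y i j k)
           - (\<Sum>j\<in>{..<N} - {i}. s i j * G' y i j j))) \<partial>M) \<le> ennreal \<delta>"
        unfolding \<delta>_def
      proof (rule quadratic_form_first_moment[rotated])
        show "(\<Sum>u\<in>{..<N} - {i}. s i u) \<le> C"
          using C(1)[OF i] s0[OF i i] i by (simp add: sum_diff1)
        show "(\<Sum>j\<in>{..<N} - {i}. (cmod (G' y i j k))\<^sup>2) \<le> (1 / \<bar>Im z\<bar>)\<^sup>2" if "k \<in> {..<N} - {i}" for k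
          using column_norm_le'[OF that] by (simp add: power_divide)
        show "integrable M (X (min i u, max i u)) \<and> expectation (X (min i u, max i u)) = 0"
          "integrable M (\<lambda>\<omega>. (X (min i u, max i u) \<omega>)\<^sup>2)
              \<and> expectation (\<lambda>\<omega>. (X (min i u, max i u) \<omega>)\<^sup>2) = s i u"
          "integrable M (\<lambda>\<omega>. \<bar>X (min i u, max i u) \<omega>\<bar> ^ 3)
              \<and> expectation (\<lambda>\<omega>. \<bar>X (min i u, max i u) \<omega>\<bar> ^ 3) \<le> \<kappa> * s i u"
          "s i u \<le> \<sigma>" if "u \<in> {..<N} - {i}" for u
          using entry[of i u] s(2)[of i u] i that by (simp_all add: sym_entry_def)
      qed (use \<kappa> in auto)
      also have "(\<lambda>\<omega>. ennreal (cmod ((\<Sum>j\<in>{..<N} - {i}. \<Sum>k\<in>{..<N} - {i}.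
           of_real (X (min i j, max i j) \<omega>) * of_real (X (min i k, max i k) \<omega>) * G' y i j k)
           - (\<Sum>j\<in>{..<N} - {i}. s i j * G' y i j j)))) = (\<lambda>\<omega>. ennreal (cmod (Q (?x \<omega>) y i)))"
        unfolding Q_def
        by (intro ext arg_cong[of _ _ ennreal] arg_cong[of _ _ cmod] arg_cong2[of _ _ _ _ "(-)"]
          sum.cong refl)
          (simp add: xA, simp add: sym_entry_def)
      finally show "(\<integral>\<^sup>+\<omega>. ennreal (cmod (Q (?x \<omega>) y i)) \<partial>M) \<le> ennreal \<delta>" .
    qed
    then show ?thesis unfolding Q by simp
  qed
  have diag: "(\<integral>\<^sup>+\<omega>. ennreal \<bar>H \<omega> i i\<bar> \<partial>M) \<le> ennreal (sqrt \<sigma>)" if i: "i < N" for i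
  proof -
    have m: "(\<lambda>\<omega>. H \<omega> i i) \<in> borel_measurable M" using entry(1)[OF i i] by (auto simp: H_def)
    have int: "integrable M (\<lambda>\<omega>. (H \<omega> i i)\<^sup>2)" using entry(2)[OF i i] by (auto simp: H_def)
    have "(\<integral>\<^sup>+\<omega>. ennreal \<bar>H \<omega> i i\<bar> \<partial>M) = ennreal (expectation (\<lambda>\<omega>. \<bar>H \<omega> i i\<bar>))"
      using expectation_abs_le_sqrt(1)[OF m int] by (intro nn_integral_eq_integral) auto
    also have "expectation (\<lambda>\<omega>. \<bar>H \<omega> i i\<bar>) \<le> sqrt (s i i)"
      using expectation_abs_le_sqrt(2)[OF m int] entry(2)[OF i i] by (simp add: H_def)
    also have "\<dots> \<le> sqrt \<sigma>" using s(2)[OF i i] by simp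
    finally show ?thesis by (simp add: ennreal_leI)
  qed
  have mH: "(\<lambda>\<omega>. H \<omega> j k) \<in> borel_measurable M" if "j < N" "k < N" for j k
    using entry(1)[OF that] by (auto simp: H_def)
  have mG: "(\<lambda>\<omega>. G' (\<lambda>p. X p \<omega>) i j k) \<in> borel_measurable M" if "j < N" "k < N" for i j k
    unfolding G'_def using that mH
    by (intro borel_measurable_resolvent_entry) (auto simp: minor_entry_def H_def)
  have mQ: "(\<lambda>\<omega>. Q (\<lambda>p. X p \<omega>) (\<lambda>p. X p \<omega>) i) \<in> borel_measurable M" if i: "i < N" for i
    unfolding Q_def H_def[symmetric]
    supply mG[measurable] mH[OF i, measurable] by measurable
  define a where "a i = \<bar>(\<Sum>j<N. s i j) - V\<bar> / \<bar>Im z\<bar> + 2 * \<sigma> / \<bar>Im z\<bar>" for i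
  have a: "a i \<ge> 0" for i using \<sigma>0 by (simp add: a_def)
  have point: "(\<Sum>i<N. cmod (resolvent_entry N (H \<omega>) z i i - w))
     \<le> 2 / (Im z)\<^sup>2 * (\<Sum>i<N. a i + \<bar>H \<omega> i i\<bar> + cmod (Q (\<lambda>p. X p \<omega>) (\<lambda>p. X p \<omega>) i))" for \<omega>
  proof -
    interpret symmetric_resolvent "{..<N}" "H \<omega>" z "resolvent_entry N (H \<omega>) z"
      unfolding H_def
      by unfold_locales (use z is_resolvent_resolvent_entry[OF sym_entry_commute z] in \<open>auto
        intro: sym_entry_commute\<close>)
    show ?thesis unfolding Q_def a_def H_def[symmetric]
    proof (rule diagonal_near_fixed_point[where s = s and G' = "G' (\<lambda>p. X p \<omega>)" and C
        = C, unfolded of_real_mult])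
      show "is_resolvent ({..<N} - {i}) (H \<omega>) z (G' (\<lambda>p. X p \<omega>) i)" for i
        unfolding G'_def H_def by (rule is_resolvent_minor_entry[OF sym_entry_commute z])
      show "0 \<le> s i j \<and> s i j \<le> \<sigma> \<and> s i j = s j i" if "i \<in> {..<N}" "j \<in> {..<N}" for i j
        using s(1)[of i j] s(2)[of i j] s0[of i j] that by simp
    qed (use C w in auto)
  qed
  have en: "ennreal (K * (\<Sum>i<N. t i + u i + r i))
      = ennreal K * (\<Sum>i<N. ennreal (t i) + ennreal (u i) + ennreal (r i))"
    if "K \<ge> 0" "\<And>i. t i \<ge> 0" "\<And>i. u i \<ge> 0" "\<And>i. r i \<ge> 0" for K :: real and t u r :: "nat \<Rightarrow> real"
  proof -
    have "(\<Sum>i<N. ennreal (t i) + ennreal (u i) + ennreal (r i)) = (\<Sum>i<N. ennreal (t i + u i + r i))"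
      using that by (intro sum.cong refl) simp
    also have "\<dots> = ennreal (\<Sum>i<N. t i + u i + r i)" using that by (intro sum_ennreal) simp
    finally show ?thesis using that by (simp only: ennreal_mult sum_nonneg add_nonneg_nonneg)
  qed
  have "(\<integral>\<^sup>+\<omega>. ennreal (\<Sum>i<N. cmod (resolvent_entry N (H \<omega>) z i i - w)) \<partial>M)
    \<le> (\<integral>\<^sup>+\<omega>. ennreal (2 / (Im z)\<^sup>2) * (\<Sum>i<N. ennreal (a i) + ennreal \<bar>H \<omega> i i\<bar>
        + ennreal (cmod (Q (\<lambda>p. X p \<omega>) (\<lambda>p. X p \<omega>) i))) \<partial>M)"
  proof -
    have "ennreal (\<Sum>i<N. cmod (resolvent_entry N (H \<omega>) z i i - w))
        \<le> ennreal (2 / (Im z)\<^sup>2) * (\<Sum>i<N. ennreal (a i) + ennreal \<bar>H \<omega> i i\<bar>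
            + ennreal (cmod (Q (\<lambda>p. X p \<omega>) (\<lambda>p. X p \<omega>) i)))" for \<omega>
      using ennreal_leI[OF point[of \<omega>]] a by (subst (asm) en) auto
    then show ?thesis by (rule nn_integral_mono)
  qed
  also have "\<dots> = ennreal (2 / (Im z)\<^sup>2) * (\<Sum>i<N. ennreal (a i) + (\<integral>\<^sup>+\<omega>. ennreal \<bar>H \<omega> i i\<bar> \<partial>M)
      + (\<integral>\<^sup>+\<omega>. ennreal (cmod (Q (\<lambda>p. X p \<omega>) (\<lambda>p. X p \<omega>) i)) \<partial>M))"
  proof -
    have [measurable]: "(\<lambda>\<omega>. H \<omega> i i) \<in> borel_measurable M" "(\<lambda>\<omega>. Q (\<lambda>p. X p \<omega>) (\<lambda>p. X p \<omega>) i)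
        \<in> borel_measurable M"
      if "i < N" for i using mH mQ that by auto
    have "(\<integral>\<^sup>+\<omega>. ennreal (a i) + ennreal \<bar>H \<omega> i i\<bar>
        + ennreal (cmod (Q (\<lambda>p. X p \<omega>) (\<lambda>p. X p \<omega>) i)) \<partial>M)
        = ennreal (a i) + (\<integral>\<^sup>+\<omega>. ennreal \<bar>H \<omega> i i\<bar> \<partial>M)
        + (\<integral>\<^sup>+\<omega>. ennreal (cmod (Q (\<lambda>p. X p \<omega>) (\<lambda>p. X p \<omega>) i)) \<partial>M)" if "i < N" for i
      using that by (simp add: nn_integral_add emeasure_space_1)
    moreover have "(\<integral>\<^sup>+\<omega>. ennreal (2 / (Im z)\<^sup>2) * (\<Sum>i<N. ennreal (a i) + ennreal \<bar>H \<omega> i i\<bar>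
        + ennreal (cmod (Q (\<lambda>p. X p \<omega>) (\<lambda>p. X p \<omega>) i))) \<partial>M)
       = ennreal (2 / (Im z)\<^sup>2) * (\<Sum>i<N. \<integral>\<^sup>+\<omega>. ennreal (a i) + ennreal \<bar>H \<omega> i i\<bar>
           + ennreal (cmod (Q (\<lambda>p. X p \<omega>) (\<lambda>p. X p \<omega>) i)) \<partial>M)"
      by (subst nn_integral_cmult, measurable, subst nn_integral_sum) measurable
    ultimately show ?thesis by simp
  qed
  also have "\<dots> \<le> ennreal (2 / (Im z)\<^sup>2) * (\<Sum>i<N. ennreal (a i) + ennreal (sqrt \<sigma>) + ennreal \<delta>)"
    using diag quad by (intro mult_left_mono sum_mono add_mono) auto
  also have "\<dots> = ennreal (2 / (Im z)\<^sup>2 * (\<Sum>i<N. a i + sqrt \<sigma> + \<delta>))"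
  proof -
    have "C \<ge> 0" using C(1)[of 0] False s0[of 0] sum_nonneg[of "{..<N}" "\<lambda>j. s 0 j"] by force
    then have "\<delta> \<ge> 0" using \<sigma>0 \<kappa> by (auto simp: \<delta>_def)
    then show ?thesis using a \<sigma>0 by (subst en) auto
  qed
  also have "(\<Sum>i<N. a i + sqrt \<sigma> + \<delta>) = (\<Sum>i<N. \<bar>(\<Sum>j<N. s i j) - V\<bar>) / \<bar>Im z\<bar>
        + real N * (2 * \<sigma> / \<bar>Im z\<bar> + sqrt \<sigma> + (sqrt (2 * \<sigma> * C) + sqrt (\<kappa> * C) + 2 * sqrt \<kappa> * C)
            / \<bar>Im z\<bar>)"
    by (simp add: a_def \<delta>_def sum.distrib sum_divide_distrib add_divide_distrib algebra_simps)
  finally show ?thesis unfolding H_def .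
qed simp

end

section \<open>Row sums of a band profile\<close>

locale even_profile =
  fixes \<psi> :: "real \<Rightarrow> real"
  assumes range: "\<And>t. 0 \<le> \<psi> t \<and> \<psi> t \<le> 1"
    and cont: "continuous_on UNIV \<psi>"
    and even: "\<And>t. \<psi> (- t) = \<psi> t"
    and noninc: "\<And>s t. 0 \<le> s \<Longrightarrow> s \<le> t \<Longrightarrow> \<psi> t \<le> \<psi> s"
    and int: "integrable lborel \<psi>" "integral\<^sup>L lborel \<psi> = 1"
begin

text \<open>
  The sums are compared with integrals from 0 to \<open>x\<close>, which increase to \<open>1 / 2\<close> by symmetry.
\<close>

definition half_mass :: "real \<Rightarrow> real" where
  "half_mass x = integral {0..x} \<psi>"

lemma integrable_interval: "\<psi> integrable_on {x..y}"
  by (intro integrable_continuous_interval continuous_on_subset[OF cont]) auto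

lemma half_mass_step:
  assumes "0 \<le> x" "x \<le> y"
  shows "(y - x) * \<psi> y \<le> half_mass y - half_mass x" "half_mass y - half_mass x \<le> (y - x) * \<psi> x"
proof -
  have eq: "half_mass y - half_mass x = integral {x..y} \<psi>"
    using Henstock_Kurzweil_Integration.integral_combine[OF assms integrable_interval]
        by (simp add: half_mass_def)
  have "integral {x..y} (\<lambda>_. \<psi> y) \<le> integral {x..y} \<psi>"
    using assms by (intro integral_le integrable_interval) (auto intro: noninc)
  then show "(y - x) * \<psi> y \<le> half_mass y - half_mass x" using assms unfolding eq by simp
  have "integral {x..y} \<psi> \<le> integral {x..y} (\<lambda>_. \<psi> x)"
    using assms by (intro integral_le integrable_interval) (auto intro: noninc)
  then show "half_mass y - half_mass x \<le> (y - x) * \<psi> x" using assms unfolding eq by simp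
qed

lemma half_mass_mono: "0 \<le> x \<Longrightarrow> x \<le> y \<Longrightarrow> half_mass x \<le> half_mass y"
  using half_mass_step(1)[of x y] range[of y] mult_nonneg_nonneg[of "y - x" "\<psi> y"] by linarith

lemma half_mass_double:
  assumes "0 \<le> x" shows "2 * half_mass x = (LINT t:{- x..x}|lborel. \<psi> t)"
proof -
  have "integral {- x..- 0} (\<lambda>t. \<psi> (- t)) = integral {0..x} \<psi>"
      by (rule Henstock_Kurzweil_Integration.integral_reflect_real)
  then have "integral {- x..0} \<psi> = half_mass x" by (simp add: even half_mass_def)
  moreover have "integral {- x..0} \<psi> + integral {0..x} \<psi> = integral {- x..x} \<psi>"
    using assms by (intro Henstock_Kurzweil_Integration.integral_combine integrable_interval) auto
  moreover have "(LINT t:{- x..x}|lborel. \<psi> t) = integral {- x..x} \<psi>"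
    by (intro set_borel_integral_eq_integral borel_integrable_atLeastAtMost'
      continuous_on_subset[OF cont]) auto
  ultimately show ?thesis by (simp add: half_mass_def)
qed

lemma half_mass_le: assumes "0 \<le> x" shows "half_mass x \<le> 1 / 2"
proof -
  have "(LINT t:{- x..x}|lborel. \<psi> t) \<le> integral\<^sup>L lborel \<psi>"
    unfolding set_lebesgue_integral_def using int(1) range
    by (intro integral_mono integrable_mult_indicator) (auto simp: indicator_def)
  then show ?thesis using half_mass_double[OF assms] int by simp
qed

lemma half_mass_tendsto: "(\<lambda>n. half_mass (real n)) \<longlonglongrightarrow> 1 / 2"
proof -
  have "(\<lambda>n. LINT t|lborel. indicator {- real n..real n} t *\<^sub>R \<psi> t) \<longlonglongrightarrow> integral\<^sup>L lborel \<psi>"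
  proof (rule integral_dominated_convergence[where w = \<psi>])
    show "AE t in lborel. (\<lambda>n. indicator {- real n..real n} t *\<^sub>R \<psi> t) \<longlonglongrightarrow> \<psi> t"
    proof (rule AE_I2, rule tendsto_eventually)
      fix t :: real
      obtain m :: nat where "\<bar>t\<bar> \<le> real m" using real_arch_simple by blast
      then have "indicator {- real n..real n} t *\<^sub>R \<psi> t = \<psi> t" if "n \<ge> m" for n
        using that by (auto simp: indicator_def)
      then show "\<forall>\<^sub>F n in sequentially. indicator {- real n..real n} t *\<^sub>R \<psi> t = \<psi> t"
        by (auto simp: eventually_sequentially)
    qed
  qed (use int range in \<open>auto simp: indicator_def\<close>)
  then have "(\<lambda>n. 2 * half_mass (real n)) \<longlonglongrightarrow> 1"
    by (simp add: half_mass_double set_lebesgue_integral_def int)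
  from tendsto_mult_left[OF this, of "1 / 2"] show ?thesis by simp
qed

text \<open>
  The sum over right endpoints lies below the integral because \<open>\<psi>\<close> decreases. The sum over left
  endpoints lies above it and exceeds the former by at most \<open>\<psi> 0 / \<beta>\<close>.
\<close>

lemma riemann_sum_bounds:
  assumes "\<beta> > 0"
  shows "(\<Sum>k<m. \<psi> (real (Suc k) / \<beta>) / \<beta>) \<le> half_mass (real m / \<beta>)"
    and "half_mass (real m / \<beta>) - \<psi> 0 / \<beta> \<le> (\<Sum>k<m. \<psi> (real (Suc k) / \<beta>) / \<beta>)"
proof -
  have step: "real (Suc k) / \<beta> - real k / \<beta> = 1 / \<beta>" for k
      by (simp add: diff_divide_distrib[symmetric])
  have 1: "\<psi> (real (Suc k) / \<beta>) / \<beta> \<le> half_mass (real (Suc k) / \<beta>) - half_mass (real k / \<beta>)" for k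
    using half_mass_step(1)[of "real k / \<beta>" "real (Suc k) / \<beta>"] assms unfolding step
        by (simp add: divide_right_mono)
  have 2: "half_mass (real (Suc k) / \<beta>) - half_mass (real k / \<beta>) \<le> \<psi> (real k / \<beta>) / \<beta>" for k
    using half_mass_step(2)[of "real k / \<beta>" "real (Suc k) / \<beta>"] assms unfolding step
        by (simp add: divide_right_mono)
  have z: "half_mass 0 = 0" by (simp add: half_mass_def)
  have tel: "(\<Sum>k<m. half_mass (real (Suc k) / \<beta>) - half_mass (real k / \<beta>)) = half_mass (real m / \<beta>)"
    by (subst sum_lessThan_telescope) (simp add: z)
  show "(\<Sum>k<m. \<psi> (real (Suc k) / \<beta>) / \<beta>) \<le> half_mass (real m / \<beta>)"
    unfolding tel[symmetric] by (intro sum_mono 1)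
  have "half_mass (real m / \<beta>) \<le> (\<Sum>k<m. \<psi> (real k / \<beta>) / \<beta>)"
    unfolding tel[symmetric] by (intro sum_mono 2)
  also have "\<dots> = (\<Sum>k<m. \<psi> (real (Suc k) / \<beta>) / \<beta>) - (\<psi> (real m / \<beta>) / \<beta> - \<psi> 0 / \<beta>)"
    using sum_lessThan_telescope[of "\<lambda>k. \<psi> (real k / \<beta>) / \<beta>" m] by (simp add: sum_subtractf)
  also have "\<dots> \<le> (\<Sum>k<m. \<psi> (real (Suc k) / \<beta>) / \<beta>) + \<psi> 0 / \<beta>"
    using range assms by simp
  finally show "half_mass (real m / \<beta>) - \<psi> 0 / \<beta> \<le> (\<Sum>k<m. \<psi> (real (Suc k) / \<beta>) / \<beta>)" by simp
qed

definition band_row_sum :: "real \<Rightarrow> nat \<Rightarrow> nat \<Rightarrow> real" where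
  "band_row_sum \<beta> N i = (\<Sum>j<N. \<psi> ((real i - real j) / \<beta>) / \<beta>)"

text \<open>
  By symmetry of \<open>\<psi>\<close> the two sides of the diagonal are Riemann sums over \<open>i\<close> and \<open>N - Suc i\<close>
  points.
\<close>

lemma band_row_sum_split:
  assumes "i < N"
  shows "band_row_sum \<beta> N i = \<psi> 0 / \<beta> + (\<Sum>k<i. \<psi> (real (Suc k) / \<beta>) / \<beta>)
    + (\<Sum>k<N - Suc i. \<psi> (real (Suc k) / \<beta>) / \<beta>)"
proof -
  let ?f = "\<lambda>j. \<psi> ((real i - real j) / \<beta>) / \<beta>"
  have "(\<Sum>j<N. ?f j) = (\<Sum>j<Suc i. ?f j) + (\<Sum>j = Suc i..<N. ?f j)"
    unfolding lessThan_atLeast0 by (rule sum.atLeastLessThan_concat[symmetric]) (use assms in auto)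
  also have "(\<Sum>j = Suc i..<N. ?f j) = (\<Sum>k<N - Suc i. ?f (k + Suc i))"
    using assms sum.shift_bounds_nat_ivl[of ?f 0 "Suc i" "N - Suc i"]
        by (simp add: lessThan_atLeast0)
  also have "\<dots> = (\<Sum>k<N - Suc i. \<psi> (real (Suc k) / \<beta>) / \<beta>)"
  proof (intro sum.cong refl)
    fix k
    have "(real i - real (k + Suc i)) / \<beta> = - (real (Suc k) / \<beta>)" by (simp add: minus_divide_left)
    then show "?f (k + Suc i) = \<psi> (real (Suc k) / \<beta>) / \<beta>" by (metis even)
  qed
  also have "(\<Sum>j<Suc i. ?f j) = \<psi> 0 / \<beta> + (\<Sum>j<i. ?f j)" by simp
  also have "(\<Sum>j<i. ?f j) = (\<Sum>k<i. ?f (i - Suc k))" by (rule sum.nat_diff_reindex[symmetric])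
  also have "\<dots> = (\<Sum>k<i. \<psi> (real (Suc k) / \<beta>) / \<beta>)"
    by (intro sum.cong refl) (simp add: of_nat_diff)
  finally show ?thesis by (simp add: band_row_sum_def)
qed

lemma band_row_sum_le:
  assumes "i < N" "\<beta> > 0" shows "band_row_sum \<beta> N i \<le> 1 + 1 / \<beta>"
proof -
  have "\<psi> 0 / \<beta> \<le> 1 / \<beta>" using range[of 0] assms by (simp add: divide_right_mono)
  then show ?thesis
    unfolding band_row_sum_split[OF assms(1)]
    using riemann_sum_bounds(1)[OF assms(2), of i] riemann_sum_bounds(1)[OF assms(2), of "N
        - Suc i"]
      half_mass_le[of "real i / \<beta>"] half_mass_le[of "real (N - Suc i) / \<beta>"] assms
    by (simp add: add.commute)
qed

lemma band_row_sum_deviation: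
  assumes "i < N" "\<beta> > 0"
  shows "\<bar>band_row_sum \<beta> N i - 1\<bar> \<le> 1 / \<beta> + (1 / 2 - half_mass (real i / \<beta>)) + (1 / 2
      - half_mass (real (N - Suc i) / \<beta>))"
proof -
  have "\<psi> 0 / \<beta> \<le> 1 / \<beta>" using range[of 0] assms by (simp add: divide_right_mono)
  moreover have "half_mass (real i / \<beta>) \<le> 1 / 2" "half_mass (real (N - Suc i) / \<beta>) \<le> 1 / 2"
    by (intro half_mass_le; use assms in simp)+
  moreover note band_row_sum_le[OF assms] band_row_sum_split[OF assms(1), of \<beta>]
    riemann_sum_bounds(2)[OF assms(2), of i] riemann_sum_bounds(2)[OF assms(2), of "N - Suc i"]
  ultimately show ?thesis by linarith
qed

text \<open>
  Row \<open>i\<close> misses the mass beyond the two ends of the matrix. At either end the loss is at most \<open>\<epsilon>\<close>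
  unless the distance to that end is at most \<open>L * \<beta>\<close>, which concerns at most \<open>L * \<beta> + 1\<close> rows,
  with a loss of at most \<open>1 / 2\<close> each.
\<close>

lemma average_deviation_le:
  assumes "\<beta> > 0" "N > 0" "half_mass L \<ge> 1 / 2 - \<epsilon>" "L \<ge> 0" "\<epsilon> \<ge> 0"
  shows "(\<Sum>i<N. \<bar>band_row_sum \<beta> N i - 1\<bar>) / real N \<le> 1 / \<beta> + (L * \<beta> + 1) / real N + 2 * \<epsilon>"
proof -
  define g where "g i = 1 / 2 - half_mass (real i / \<beta>)" for i
  have half0: "half_mass x \<ge> 0" if "x \<ge> 0" for x
    using half_mass_mono[of 0 x] that by (simp add: half_mass_def)
  have g: "g i \<le> (if real i \<le> L * \<beta> then 1 / 2 else 0) + \<epsilon>" for i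
  proof (cases "real i \<le> L * \<beta>")
    case False
    then have "L \<le> real i / \<beta>" using assms(1) by (simp add: field_simps)
    from half_mass_mono[OF assms(4) this] show ?thesis using assms(3) False by (simp add: g_def)
  qed (use half0[of "real i / \<beta>"] assms in \<open>auto simp: g_def\<close>)
  have card: "(\<Sum>i<N. if real i \<le> L * \<beta> then 1 / 2 else 0 :: real) \<le> (L * \<beta> + 1) / 2"
  proof -
    have "(\<Sum>i<N. if real i \<le> L * \<beta> then 1 / 2 else 0 :: real) \<le> (\<Sum>i\<le>nat \<lfloor>L * \<beta>\<rfloor>. 1 / 2)"
    proof (subst sum.inter_filter[symmetric], simp, rule sum_mono2)
      show "{x \<in> {..<N}. real x \<le> L * \<beta>} \<subseteq> {..nat \<lfloor>L * \<beta>\<rfloor>}"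
        by (auto simp: le_nat_floor)
    qed auto
    also have "\<dots> = (real (nat \<lfloor>L * \<beta>\<rfloor>) + 1) / 2" by (simp add: add.commute)
    also have "\<dots> \<le> (L * \<beta> + 1) / 2"
      using assms by (intro divide_right_mono add_right_mono of_nat_floor) auto
    finally show ?thesis .
  qed
  have "(\<Sum>i<N. \<bar>band_row_sum \<beta> N i - 1\<bar>) \<le> (\<Sum>i<N. 1 / \<beta> + g i + g (N - Suc i))"
    using band_row_sum_deviation assms by (intro sum_mono) (auto simp: g_def)
  also have "\<dots> = N / \<beta> + (\<Sum>i<N. g i) + (\<Sum>i<N. g (N - Suc i))" by (simp add: sum.distrib)
  also have "(\<Sum>i<N. g (N - Suc i)) = (\<Sum>i<N. g i)" by (rule sum.nat_diff_reindex)
  also have "(\<Sum>i<N. g i) \<le> (\<Sum>i<N. (if real i \<le> L * \<beta> then 1 / 2 else 0) + \<epsilon>)" by (intro sum_mono g)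
  also have "\<dots> \<le> (L * \<beta> + 1) / 2 + N * \<epsilon>" using card by (simp add: sum.distrib)
  finally have "(\<Sum>i<N. \<bar>band_row_sum \<beta> N i - 1\<bar>) \<le> N / \<beta> + (L * \<beta> + 1) + 2 * (N * \<epsilon>)"
    by (simp add: algebra_simps)
  from divide_right_mono[OF this, of "real N"] show ?thesis
    using assms(2) by (simp add: add_divide_distrib)
qed

theorem average_deviation_tendsto:
  fixes \<beta> :: "nat \<Rightarrow> real"
  assumes pos: "\<forall>\<^sub>F n in sequentially. \<beta> n > 0" and infty: "filterlim \<beta> at_top sequentially"
    and small: "(\<lambda>n. \<beta> n / real n) \<longlonglongrightarrow> 0"
  shows "(\<lambda>n. (\<Sum>i<2 * n + 1. \<bar>band_row_sum (\<beta> n) (2 * n + 1) i - 1\<bar>) / real (2 * n + 1)) \<longlonglongrightarrow> 0"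
proof (rule tendstoI)
  fix e :: real assume e: "e > 0"
  have "\<forall>\<^sub>F n in sequentially. half_mass (real n) > 1 / 2 - e / 4"
    using half_mass_tendsto e by (intro order_tendstoD) auto
  then obtain L where L: "half_mass (real L) > 1 / 2 - e / 4"
      by (auto simp: eventually_sequentially)
  have "(\<lambda>n. 1 / \<beta> n) \<longlonglongrightarrow> 0" using tendsto_inverse_0_at_top[OF infty] by (simp add: inverse_eq_divide)
  moreover have "(\<lambda>n. real L * (\<beta> n / real n) + 1 / real n) \<longlonglongrightarrow> real L * 0 + 0"
    by (intro tendsto_intros small lim_1_over_n)
  ultimately have "(\<lambda>n. 1 / \<beta> n + (real L * (\<beta> n / real n) + 1 / real n) + 2 * (e / 4)) \<longlonglongrightarrow> 0
      + (real L * 0 + 0) + 2 * (e / 4)"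
    by (rule tendsto_add[OF tendsto_add tendsto_const])
  then have "\<forall>\<^sub>F n in sequentially. 1 / \<beta> n + (real L * (\<beta> n / real n) + 1 / real n) + 2 * (e / 4)
      < e"
    by (rule order_tendstoD(2)) (use e in auto)
  then show "\<forall>\<^sub>F n in sequentially. dist ((\<Sum>i<2 * n + 1. \<bar>band_row_sum (\<beta> n) (2 * n + 1) i - 1\<bar>)
      / real (2 * n + 1)) 0 < e"
    using pos eventually_gt_at_top[of 0]
  proof eventually_elim
    case (elim n)
    have "(\<Sum>i<2 * n + 1. \<bar>band_row_sum (\<beta> n) (2 * n + 1) i - 1\<bar>) / real (2 * n + 1)
      \<le> 1 / \<beta> n + (real L * \<beta> n + 1) / real (2 * n + 1) + 2 * (e / 4)"
      using elim L e by (intro average_deviation_le) auto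
    also have "(real L * \<beta> n + 1) / real (2 * n + 1) \<le> (real L * \<beta> n + 1) / real n"
      using elim by (intro divide_left_mono) auto
    also have "\<dots> = real L * (\<beta> n / real n) + 1 / real n" by (simp add: add_divide_distrib)
    finally have "(\<Sum>i<2 * n + 1. \<bar>band_row_sum (\<beta> n) (2 * n + 1) i - 1\<bar>) / real (2 * n + 1) < e"
      using elim by simp
    then show ?case by (simp add: sum_nonneg)
  qed
qed

end

section \<open>Products of two independent families\<close>

context prob_space begin

text \<open>
  With disjoint copies of the index sets each product \<open>A k * D k\<close> is a function of its own two
  members of the joint family, so the products inherit independence from it.
\<close>

lemma indep_vars_Plus:
  fixes A :: "'i \<Rightarrow> 'a \<Rightarrow> 'b" and D :: "'i \<Rightarrow> 'a \<Rightarrow> 'b"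
  assumes A: "indep_vars (\<lambda>_. N) A I" and D: "indep_vars (\<lambda>_. N) D J"
    and AD: "indep_var (PiM I (\<lambda>_. N)) (\<lambda>\<omega>. restrict (\<lambda>i. A i \<omega>) I) (PiM J (\<lambda>_. N)) (\<lambda>\<omega>. restrict
        (\<lambda>j. D j \<omega>) J)"
  shows "indep_vars (\<lambda>_. N) (case_sum A D) (I <+> J)"
  unfolding indep_vars_def2
proof (intro conjI ballI indep_setsI)
  have rA: "A i \<in> measurable M N" if "i \<in> I" for i using A that by (auto simp: indep_vars_def)
  have rD: "D j \<in> measurable M N" if "j \<in> J" for j using D that by (auto simp: indep_vars_def)
  show rv: "case_sum A D k \<in> measurable M N" if "k \<in> I <+> J" for k
    using that rA rD by auto
  show "{case_sum A D k -` B \<inter> space M |B. B \<in> sets N} \<subseteq> events" if "k \<in> I <+> J" for k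
    using measurable_sets[OF rv[OF that]] by auto
  fix E L
  assume L: "L \<subseteq> I <+> J" "finite L" and E: "\<forall>k\<in>L. E k \<in> {case_sum A D k -` B \<inter> space M |B. B
      \<in> sets N}"
  have "\<forall>k\<in>L. \<exists>B. B \<in> sets N \<and> E k = case_sum A D k -` B \<inter> space M" using E by blast
  then obtain B where "\<forall>k\<in>L. B k \<in> sets N \<and> E k = case_sum A D k -` B k \<inter> space M"
    by (rule bchoice[THEN exE])
  then have B: "B k \<in> sets N \<and> E k = case_sum A D k -` B k \<inter> space M" if "k \<in> L" for k
    using that by blast
  define L1 L2 where "L1 = Inl -` L" and "L2 = Inr -` L"
  have "k \<in> L \<longleftrightarrow> k \<in> Inl ` L1 \<union> Inr ` L2" for k
    by (cases k) (auto simp: L1_def L2_def)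
  then have L12: "L = Inl ` L1 \<union> Inr ` L2" by blast
  have fin: "finite L1" "finite L2" unfolding L1_def L2_def using L by (auto intro: finite_vimageI)
  have sub: "L1 \<subseteq> I" "L2 \<subseteq> J" using L by (auto simp: L1_def L2_def)
  define XA where "XA = {x \<in> space (PiM I (\<lambda>_. N)). \<forall>i\<in>L1. x i \<in> B (Inl i)}"
  define XD where "XD = {x \<in> space (PiM J (\<lambda>_. N)). \<forall>j\<in>L2. x j \<in> B (Inr j)}"
  have component: "{x \<in> space (PiM K (\<lambda>_. N)). x i \<in> C} \<in> sets (PiM K (\<lambda>_. N))"
      if "i \<in> K" "C \<in> sets N" for K i C
  proof -
    have "(\<lambda>x. x i) -` C \<inter> space (PiM K (\<lambda>_. N)) \<in> sets (PiM K (\<lambda>_. N))"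
      by (rule measurable_sets[OF measurable_component_singleton[OF that(1)] that(2)])
    also have "(\<lambda>x. x i) -` C \<inter> space (PiM K (\<lambda>_. N)) = {x \<in> space (PiM K (\<lambda>_. N)). x i
        \<in> C}" by blast
    finally show ?thesis .
  qed
  have BN: "B (Inl i) \<in> sets N" if "i \<in> L1" for i using B[of "Inl i"] that by (simp add: L1_def)
  have BN': "B (Inr i) \<in> sets N" if "i \<in> L2" for i using B[of "Inr i"] that by (simp add: L2_def)
  have sets: "XA \<in> sets (PiM I (\<lambda>_. N))" "XD \<in> sets (PiM J (\<lambda>_. N))"
    unfolding XA_def XD_def using sub BN BN'
    by (intro sets.sets_Collect_finite_All fin component; blast)+
  let ?A = "\<lambda>\<omega>. restrict (\<lambda>i. A i \<omega>) I" and ?D = "\<lambda>\<omega>. restrict (\<lambda>j. D j \<omega>) J"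
  have spA: "?A \<omega> \<in> space (PiM I (\<lambda>_. N))" "?D \<omega> \<in> space (PiM J (\<lambda>_. N))" if "\<omega> \<in> space M" for \<omega>
    using that rA rD by (auto simp: space_PiM dest: measurable_space)
  have PA: "prob (?A -` XA \<inter> space M) = (\<Prod>i\<in>L1. prob (E (Inl i)))"
  proof (cases "L1 = {}")
    case True
    then have "?A -` XA \<inter> space M = space M" using spA by (auto simp: XA_def)
    then show ?thesis using True by (simp add: prob_space)
  next
    case False
    have "?A -` XA \<inter> space M = (\<Inter>i\<in>L1. A i -` B (Inl i) \<inter> space M)"
      using False spA sub by (auto simp: XA_def subset_eq)
    also have "prob \<dots> = (\<Prod>i\<in>L1. prob (A i -` B (Inl i) \<inter> space M))"
      by (rule indep_varsD[OF A False fin(1) sub(1) BN])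
    also have "\<dots> = (\<Prod>i\<in>L1. prob (E (Inl i)))"
      using B by (intro prod.cong) (auto simp: L1_def)
    finally show ?thesis .
  qed
  have PD: "prob (?D -` XD \<inter> space M) = (\<Prod>i\<in>L2. prob (E (Inr i)))"
  proof (cases "L2 = {}")
    case True
    then have "?D -` XD \<inter> space M = space M" using spA by (auto simp: XD_def)
    then show ?thesis using True by (simp add: prob_space)
  next
    case False
    have "?D -` XD \<inter> space M = (\<Inter>i\<in>L2. D i -` B (Inr i) \<inter> space M)"
      using False spA sub by (auto simp: XD_def subset_eq)
    also have "prob \<dots> = (\<Prod>i\<in>L2. prob (D i -` B (Inr i) \<inter> space M))"
      by (rule indep_varsD[OF D False fin(2) sub(2) BN'])
    also have "\<dots> = (\<Prod>i\<in>L2. prob (E (Inr i)))"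
      using B by (intro prod.cong) (auto simp: L2_def)
    finally show ?thesis .
  qed
  assume "L \<noteq> {}"
  have "(\<Inter>k\<in>L. E k) = (\<lambda>\<omega>. (?A \<omega>, ?D \<omega>)) -` (XA \<times> XD) \<inter> space M"
  proof (intro equalityI subsetI)
    fix \<omega> assume \<omega>: "\<omega> \<in> (\<Inter>k\<in>L. E k)"
    then have "\<omega> \<in> space M" using \<open>L \<noteq> {}\<close> B by auto
    moreover have "A i \<omega> \<in> B (Inl i)" if "i \<in> L1" for i
      using \<omega> B[of "Inl i"] that by (auto simp: L1_def)
    moreover have "D i \<omega> \<in> B (Inr i)" if "i \<in> L2" for i
      using \<omega> B[of "Inr i"] that by (auto simp: L2_def)
    ultimately show "\<omega> \<in> (\<lambda>\<omega>. (?A \<omega>, ?D \<omega>)) -` (XA \<times> XD) \<inter> space M"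
      using spA sub by (auto simp: XA_def XD_def subset_eq)
  next
    fix \<omega> assume \<omega>: "\<omega> \<in> (\<lambda>\<omega>. (?A \<omega>, ?D \<omega>)) -` (XA \<times> XD) \<inter> space M"
    show "\<omega> \<in> (\<Inter>k\<in>L. E k)"
    proof
      fix k assume k: "k \<in> L"
      show "\<omega> \<in> E k"
      proof (cases k)
        case (Inl i)
        then show ?thesis using \<omega> k B[OF k] sub by (auto simp: XA_def L1_def subset_eq)
      next
        case (Inr i)
        then show ?thesis using \<omega> k B[OF k] sub by (auto simp: XD_def L2_def subset_eq)
      qed
    qed
  qed
  then have "prob (\<Inter>k\<in>L. E k) = (\<Prod>i\<in>L1. prob (E (Inl i))) * (\<Prod>i\<in>L2. prob (E (Inr i)))"
    using indep_varD[OF AD sets] PA PD by simp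
  also have "\<dots> = (\<Prod>k\<in>L. prob (E k))"
    unfolding L12 using fin by (subst prod.union_disjoint) (auto simp: prod.reindex)
  finally show "prob (\<Inter>k\<in>L. E k) = (\<Prod>k\<in>L. prob (E k))" .
qed

lemma indep_vars_mult:
  fixes A D :: "'i \<Rightarrow> 'a \<Rightarrow> real"
  assumes A: "indep_vars (\<lambda>_. borel) A I" and D: "indep_vars (\<lambda>_. borel) D J"
    and AD: "indep_var (PiM I (\<lambda>_. borel)) (\<lambda>\<omega>. restrict (\<lambda>i. A i \<omega>) I) (PiM J (\<lambda>_. borel)) (\<lambda>\<omega>.
        restrict (\<lambda>j. D j \<omega>) J)"
    and K: "K \<subseteq> I" "K \<subseteq> J"
  shows "indep_vars (\<lambda>_. borel) (\<lambda>k \<omega>. A k \<omega> * D k \<omega>) K"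
proof -
  have "indep_vars (\<lambda>k. PiM {Inl k, Inr k} (\<lambda>_. borel)) (\<lambda>k \<omega>. restrict (\<lambda>l. case_sum A D l \<omega>)
      {Inl k, Inr k}) K"
    by (rule indep_vars_restrict[OF indep_vars_Plus[OF A D AD]]) (use K in \<open>auto simp:
      disjoint_family_on_def\<close>)
  from indep_vars_compose2[OF this, of "\<lambda>k x. x (Inl k) * x (Inr k)" "\<lambda>_. borel"] show ?thesis
    by (simp add: measurable_component_singleton borel_measurable_times)
qed

lemma indep_var_component_mult:
  fixes A D :: "'i \<Rightarrow> 'a \<Rightarrow> real"
  assumes AD: "indep_var (PiM I (\<lambda>_. borel)) (\<lambda>\<omega>. restrict (\<lambda>i. A i \<omega>) I) (PiM J (\<lambda>_. borel)) (\<lambda>\<omega>.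
      restrict (\<lambda>j. D j \<omega>) J)"
    and k: "k \<in> I" "k \<in> J"
    and [measurable]: "f \<in> borel_measurable borel" "g \<in> borel_measurable borel"
    and int: "integrable M (\<lambda>\<omega>. f (A k \<omega>) :: real)" "integrable M (\<lambda>\<omega>. g (D k \<omega>) :: real)"
  shows "integrable M (\<lambda>\<omega>. f (A k \<omega>) * g (D k \<omega>))"
    and "expectation (\<lambda>\<omega>. f (A k \<omega>) * g (D k \<omega>))
        = expectation (\<lambda>\<omega>. f (A k \<omega>)) * expectation (\<lambda>\<omega>. g (D k \<omega>))"
proof -
  have m: "(\<lambda>x. f (x k)) \<in> borel_measurable (PiM I (\<lambda>_. borel))" "(\<lambda>x. g (x k))
      \<in> borel_measurable (PiM J (\<lambda>_. borel))"
    using k by measurable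
  have *: "indep_var borel (\<lambda>\<omega>. f (A k \<omega>)) borel (\<lambda>\<omega>. g (D k \<omega>))"
    using indep_var_compose[OF AD m] k by (simp add: comp_def)
  show "integrable M (\<lambda>\<omega>. f (A k \<omega>) * g (D k \<omega>))" by (rule indep_var_integrable[OF * int])
  show "expectation (\<lambda>\<omega>. f (A k \<omega>) * g (D k \<omega>))
      = expectation (\<lambda>\<omega>. f (A k \<omega>)) * expectation (\<lambda>\<omega>. g (D k \<omega>))"
    by (rule indep_var_lebesgue_integral[OF * int])
qed

text \<open>
  The variable is 0 or 1 almost surely, where \<open>f\<close> is the identity; so all its moments agree.
\<close>

lemma bernoulli_moment:
  assumes [measurable]: "D \<in> borel_measurable M"
    and p: "prob {\<omega> \<in> space M. D \<omega> = 1} = p" "prob {\<omega> \<in> space M. D \<omega> = 0} = 1 - p"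
    and [measurable]: "f \<in> borel_measurable borel" and f: "f 0 = 0" "f 1 = (1 :: real)"
  shows "integrable M (\<lambda>\<omega>. f (D \<omega> :: real))" "expectation (\<lambda>\<omega>. f (D \<omega>)) = p"
proof -
  let ?S = "{\<omega> \<in> space M. D \<omega> = 1}" and ?T = "{\<omega> \<in> space M. D \<omega> = 0}"
  have "prob (?S \<union> ?T) = prob ?S + prob ?T" by (rule finite_measure_Union) auto
  then have "AE \<omega> in M. \<omega> \<in> ?S \<union> ?T" using p by (intro AE_prob_1) simp
  then have ae: "AE \<omega> in M. f (D \<omega>) = indicator ?S \<omega>" by eventually_elim (use f in auto)
  have i: "integrable M (indicator ?S :: 'a \<Rightarrow> real)"
      by (rule integrable_real_indicator) (auto simp: emeasure_eq_measure)
  show "integrable M (\<lambda>\<omega>. f (D \<omega>))" using i ae by (subst integrable_cong_AE) auto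
  have "expectation (\<lambda>\<omega>. f (D \<omega>)) = expectation (indicator ?S)" using ae
      by (intro integral_cong_AE) auto
  then show "expectation (\<lambda>\<omega>. f (D \<omega>)) = p" using p by simp
qed

end

section \<open>The Stieltjes transform of the semicircle law\<close>

lemma integral_sin_sin_multiple:
  fixes m :: nat
  assumes "m \<ge> 1"
  shows "((\<lambda>t. complex_of_real (sin t * sin (real m * t))) has_integral (if m
      = 1 then of_real (pi / 2) else 0)) {0..pi}"
proof -
  have "((\<lambda>t. sin t * sin (real m * t)) has_integral (if m = 1 then pi / 2 else 0)) {0..pi}"
  proof (cases "m = 1")
    case True
    have "((\<lambda>t. sin t * sin t) has_integral (pi / 2 - sin (2 * pi) / 4) - (0 / 2 - sin (2 * 0)
        / 4)) {0..pi}"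
    proof (rule fundamental_theorem_of_calculus)
      fix t :: real
      have "((\<lambda>t. t / 2 - sin (2 * t) / 4) has_real_derivative 1 / 2 - cos (2 * t)
          / 2) (at t within {0..pi})"
        by (auto intro!: derivative_eq_intros)
      also have "1 / 2 - cos (2 * t) / 2 = sin t * sin t"
        by (simp add: cos_double_sin power2_eq_square diff_divide_distrib)
      finally show "((\<lambda>t. t / 2 - sin (2 * t) / 4) has_vector_derivative sin t
          * sin t) (at t within {0..pi})"
        by (simp add: has_real_derivative_iff_has_vector_derivative)
    qed simp
    then show ?thesis using True by simp
  next
    case False
    define F where "F t = sin ((real m - 1) * t) / (2 * (real m - 1)) - sin ((real m + 1) * t)
        / (2 * (real m + 1))" for t
    have ne: "real m - 1 \<noteq> 0" "real m + 1 \<noteq> 0" using False assms by auto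
    have "((\<lambda>t. sin t * sin (real m * t)) has_integral F pi - F 0) {0..pi}"
    proof (rule fundamental_theorem_of_calculus)
      fix t :: real
      have *: "((\<lambda>t. sin (c * t) / (2 * c)) has_real_derivative cos (c * t)
          / 2) (at t within {0..pi})" if "c \<noteq> 0" for c :: real
        using that by (auto intro!: derivative_eq_intros)
      have "(F has_real_derivative (cos ((real m - 1) * t) - cos ((real m + 1) * t))
          / 2) (at t within {0..pi})"
        unfolding F_def diff_divide_distrib using ne by (intro DERIV_diff *)
      also have "(cos ((real m - 1) * t) - cos ((real m + 1) * t)) / 2 = sin t * sin (real m * t)"
        by (simp add: left_diff_distrib distrib_right cos_diff cos_add)
      finally show "(F has_vector_derivative sin t * sin (real m * t)) (at t within {0..pi})"
        by (simp add: has_real_derivative_iff_has_vector_derivative)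
    qed simp
    moreover have "sin ((real m - 1) * pi) = 0" "sin ((real m + 1) * pi) = 0"
      by (auto simp: left_diff_distrib distrib_right sin_diff sin_add)
    ultimately show ?thesis using False by (simp add: F_def)
  qed
  from has_integral_of_real[OF this] show ?thesis by (auto split: if_splits)
qed

text \<open>
  Let \<open>J m\<close> be the integral with one factor \<open>sin t\<close> replaced by \<open>sin (m * t)\<close>. The addition
  formula \<open>sin ((m - 1) * t) + sin ((m + 1) * t) = 2 * cos t * sin (m * t)\<close> cancels the
  denominator and gives a three-term recursion, which says that \<open>D m = J (m + 1) - q * J m\<close>
  satisfies \<open>D m = q * D (m + 1)\<close> for \<open>m \<ge> 1\<close>. As \<open>D\<close> is bounded and \<open>cmod q < 1\<close>, \<open>D 1\<close> vanishes,
  and the recursion at \<open>m = 1\<close> yields \<open>J 1\<close>.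
\<close>

lemma integral_sin_squared_over_poisson:
  fixes q :: complex
  assumes q: "cmod q < 1" and nz: "\<And>t. 1 - 2 * q * of_real (cos t) + q\<^sup>2 \<noteq> 0"
  shows "integral {0..pi} (\<lambda>t. of_real (sin t * sin t) / (1 - 2 * q * of_real (cos t) + q\<^sup>2))
      = of_real (pi / 2)"
proof -
  define d where "d t = 1 - 2 * q * complex_of_real (cos t) + q\<^sup>2" for t
  have d0: "d t \<noteq> 0" for t using nz by (simp add: d_def)
  define f where "f m t = complex_of_real (sin t * sin (real m * t)) / d t" for m t
  define J where "J m = integral {0..pi} (f m)" for m
  have cont: "continuous_on {0..pi} (f m)" for m
    unfolding f_def d_def by (intro continuous_intros) (use nz in auto)
  have int: "(f m has_integral J m) {0..pi}" for m
    unfolding J_def by (intro integrable_integral integrable_continuous_interval cont)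
  have rec: "(J m - q * J (m - 1)) - q * (J (m + 1) - q * J m) = (if m
      = 1 then of_real (pi / 2) else 0)" if "m \<ge> 1" for m
  proof -
    have "((\<lambda>t. (f m t - q * f (m - 1) t) - q * (f (m + 1) t - q * f m t)) has_integral
        (J m - q * J (m - 1)) - q * (J (m + 1) - q * J m)) {0..pi}"
      by (intro has_integral_diff has_integral_mult_right int)
    moreover have "(f m t - q * f (m - 1) t) - q * (f (m + 1) t - q * f m t)
        = of_real (sin t * sin (real m * t))" for t
    proof -
      have "sin (real (m - 1) * t) + sin (real (m + 1) * t) = 2 * cos t * sin (real m * t)"
        using that by (simp add: of_nat_diff left_diff_distrib distrib_right sin_diff sin_add)
      then have *: "complex_of_real (sin (real (m - 1) * t)) + of_real (sin (real (m + 1) * t))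
          = 2 * of_real (cos t) * of_real (sin (real m * t))"
        by (metis of_real_add of_real_mult of_real_numeral)
      have "(f m t - q * f (m - 1) t) - q * (f (m + 1) t - q * f m t) =
        of_real (sin t) * ((1 + q\<^sup>2) * of_real (sin (real m * t)) - q * (of_real (sin (real (m
            - 1) * t)) + of_real (sin (real (m + 1) * t)))) / d t"
        using d0[of t] by (simp add: f_def field_simps power2_eq_square)
      also have "\<dots> = of_real (sin t) * of_real (sin (real m * t)) * d t / d t"
        unfolding * d_def by (simp add: algebra_simps)
      finally show ?thesis using d0[of t] by simp
    qed
    ultimately show ?thesis
      using has_integral_unique[OF _ integral_sin_sin_multiple[OF that]] by simp
  qed
  define D where "D m = J (m + 1) - q * J m" for m
  have D: "D m = q * D (m + 1)" if "m \<ge> 1" for m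
    using rec[of "m + 1"] that by (simp add: D_def)
  have D1: "D 1 = q ^ k * D (k + 1)" for k
  proof (induction k)
    case (Suc k)
    then show ?case using D[of "k + 1"] by simp
  qed simp
  have "bounded (range D)"
  proof -
    have "continuous_on {0..pi} (\<lambda>t. 1 / d t)" unfolding d_def
        by (intro continuous_intros) (use nz in auto)
    from compact_continuous_image[OF this] have "bounded ((\<lambda>t. 1 / d t) ` {0..pi})"
      by (auto intro: compact_imp_bounded)
    then obtain B where "B > 0" "\<forall>x\<in>(\<lambda>t. 1 / d t) ` {0..pi}. cmod x \<le> B"
      by (meson bounded_pos)
    then have B: "B > 0" "\<And>t. t \<in> {0..pi} \<Longrightarrow> cmod (1 / d t) \<le> B" by blast+
    have J: "cmod (J m) \<le> B * pi" for m
    proof -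
      have "cmod (J m) \<le> integral {0..pi} (\<lambda>_. B)" unfolding J_def
      proof (rule integral_norm_bound_integral)
        show "f m integrable_on {0..pi}" using int by blast
        show "cmod (f m t) \<le> B" if "t \<in> {0..pi}" for t
        proof -
          have "cmod (f m t) = \<bar>sin t\<bar> * \<bar>sin (real m * t)\<bar> * cmod (1 / d t)"
            by (simp add: f_def norm_mult norm_divide)
          also have "\<dots> \<le> 1 * 1 * B" using B that by (intro mult_mono) auto
          finally show ?thesis by simp
        qed
      qed (use B in auto)
      then show ?thesis by (simp add: mult.commute)
    qed
    have "cmod (D m) \<le> B * pi + B * pi" for m
    proof -
      have "cmod q * cmod (J m) \<le> 1 * (B * pi)"
        using q by (intro mult_mono J) auto
      then have "cmod (J (m + 1)) + cmod (q * J m) \<le> B * pi + B * pi"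
        using J[of "m + 1"] by (simp add: norm_mult)
      then show ?thesis unfolding D_def using norm_triangle_ineq4 by (rule order_trans[rotated])
    qed
    then show ?thesis unfolding bounded_iff by blast
  qed
  then obtain B where B: "\<And>m. cmod (D m) \<le> B" by (auto simp: bounded_iff)
  have "(\<lambda>k. cmod q ^ k * B) \<longlonglongrightarrow> 0 * B" using q by (intro tendsto_mult LIMSEQ_power_zero) auto
  moreover have "cmod (D 1) \<le> cmod q ^ k * B" for k
    unfolding D1[of k] norm_mult norm_power by (intro mult_left_mono B) auto
  then have "\<forall>\<^sub>F k in sequentially. cmod (D 1) \<le> cmod q ^ k * B" by (simp add: always_eventually)
  ultimately have "cmod (D 1) \<le> 0 * B" by (intro tendsto_lowerbound) auto
  then have "D 1 = 0" by simp
  moreover have "J 0 = 0" by (simp add: J_def f_def[abs_def])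
  ultimately have "J 1 = of_real (pi / 2)" using rec[of 1] by (simp add: D_def)
  then show ?thesis by (simp add: J_def f_def[abs_def] d_def)
qed

text \<open>
  The substitution \<open>x = - 2 * v * cos t\<close>; the sign makes it increasing on \<open>{0..pi}\<close>.
\<close>

lemma stieltjes_semicircle_trig:
  assumes "v > 0" "Im z \<noteq> 0"
  shows "stieltjes (semicircle_law v) z
    = integral {0..pi} (\<lambda>t. of_real (2 / pi * (sin t * sin t)) / (of_real (- 2 * v * cos t) - z))"
proof -
  define r where "r x = sqrt (4 * v\<^sup>2 - x\<^sup>2) / (2 * pi * v\<^sup>2)" for x
  define h where "h x = r x *\<^sub>R (1 / (complex_of_real x - z))" for x
  have xz: "complex_of_real x - z \<noteq> 0" for x using assms(2) by (auto simp: complex_eq_iff)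
  have cont: "continuous_on S h" for S
    unfolding h_def r_def using assms xz by (intro continuous_intros) auto
  have r0: "r x \<ge> 0" if "\<bar>x\<bar> \<le> 2 * v" for x
    using power_mono[OF that, of 2] by (simp add: r_def power_mult_distrib)
  have "stieltjes (semicircle_law v) z
      = (LINT x|lborel. (if \<bar>x\<bar> \<le> 2 * v then sqrt (4 * v\<^sup>2 - x\<^sup>2) / (2 * pi * v\<^sup>2) else 0) *\<^sub>R (1
          / (complex_of_real x - z)))"
    unfolding stieltjes_def semicircle_law_def
    by (rule integral_density) (use r0 in \<open>auto simp: r_def\<close>)
  also have "\<dots> = (LINT x:{- 2 * v..2 * v}|lborel. h x)"
    unfolding set_lebesgue_integral_def h_def r_def
    by (intro Bochner_Integration.integral_cong refl) (auto simp: indicator_def abs_le_iff)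
  also have "\<dots> = integral {- 2 * v..2 * v} h"
    by (intro set_borel_integral_eq_integral borel_integrable_atLeastAtMost' cont)
  also have "\<dots> = integral {- 2 * v * cos 0..- 2 * v * cos pi} h" by simp
  also have "\<dots> = integral {0..pi} (\<lambda>t. (2 * v * sin t) *\<^sub>R h (- 2 * v * cos t))"
  proof (rule integral_unique[symmetric], rule has_integral_substitution[where c = "- 2 * v" and d
      = "2 * v"])
    show "(\<lambda>t. - 2 * v * cos t) ` {0..pi} \<subseteq> {- 2 * v..2 * v}"
      using assms by (auto simp: mult_le_cancel_left1) (smt (verit) cos_le_one cos_ge_minus_one
          mult_left_le mult_minus_right)+
    show "((\<lambda>t. - 2 * v * cos t) has_real_derivative 2 * v * sin t) (at t within {0..pi})" for t
      by (auto intro!: derivative_eq_intros)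
  qed (use assms cont in auto)
  also have "\<dots> = integral {0..pi} (\<lambda>t. of_real (2 / pi * (sin t * sin t)) / (of_real (- 2 * v
      * cos t) - z))"
  proof (intro integral_cong)
    fix t assume t: "t \<in> {0..pi}"
    have "4 * v\<^sup>2 - (- 2 * v * cos t)\<^sup>2 = (2 * v * sin t)\<^sup>2"
      by (simp add: power_mult_distrib sin_squared_eq algebra_simps)
    then have "sqrt (4 * v\<^sup>2 - (- 2 * v * cos t)\<^sup>2) = 2 * v * sin t"
      using t assms sin_ge_zero by (simp del: power_mult_distrib add: real_sqrt_unique)
    then have "2 * v * sin t * r (- 2 * v * cos t) = 2 / pi * (sin t * sin t)"
      unfolding r_def using assms by (simp add: field_simps power2_eq_square)
    then show "(2 * v * sin t) *\<^sub>R h (- 2 * v * cos t)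
        = of_real (2 / pi * (sin t * sin t)) / (of_real (- 2 * v * cos t) - z)"
      unfolding h_def scaleR_scaleR by (simp add: scaleR_conv_of_real)
  qed
  finally show ?thesis .
qed

text \<open>
  The two roots \<open>q\<close> of this quadratic equation have product 1, and a root of modulus 1 would make
  \<open>z\<close> real.
\<close>

lemma small_root:
  assumes v: "v > 0" and z: "Im z \<noteq> 0"
  obtains q where "q \<noteq> 0" "cmod q < 1" "z = - (of_real v / q) * (1 + q\<^sup>2)"
proof -
  define p where "p = (- z + csqrt (z\<^sup>2 - 4 * (of_real v)\<^sup>2)) / (2 * of_real v)"
  have "of_real v * p\<^sup>2 + z * p + of_real v = 0"
  proof -
    have "(2 * of_real v * p + z)\<^sup>2 = z\<^sup>2 - 4 * (of_real v)\<^sup>2"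
      using v by (simp add: p_def)
    then have "4 * of_real v * (of_real v * p\<^sup>2 + z * p + of_real v) = 0"
      by (simp add: power2_eq_square algebra_simps)
    then show ?thesis using v by simp
  qed
  moreover from this have p0: "p \<noteq> 0" using v by auto
  ultimately have "z * p = - (of_real v * (1 + p\<^sup>2))"
    by (simp add: algebra_simps add_eq_0_iff)
  then have "z = - (of_real v * (1 + p\<^sup>2)) / p"
    using p0 by (metis nonzero_eq_divide_eq)
  then have "z = - (of_real v / p) * (1 + p\<^sup>2)" by simp
  note p = p0 this
  have "cmod p \<noteq> 1"
  proof
    assume "cmod p = 1"
    then have "p * cnj p = 1" by (simp add: complex_norm_square[symmetric])
    then have "1 / p = cnj p" using p(1) by (simp add: field_simps)
    moreover have "z = - of_real v * (1 / p + p)"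
      unfolding p(2) using p(1) by (simp add: field_simps power2_eq_square)
    ultimately have "z = - of_real v * (cnj p + p)" by simp
    then have "Im z = 0" by simp
    with z show False by simp
  qed
  then consider "cmod p < 1" | "cmod p > 1" by linarith
  then show ?thesis
  proof cases
    case 2
    have "z = - (of_real v / (1 / p)) * (1 + (1 / p)\<^sup>2)"
      unfolding p(2) using p(1) by (simp add: field_simps power2_eq_square)
    moreover have "cmod (1 / p) < 1" using 2 p(1) by (simp add: norm_divide divide_less_eq)
    ultimately show ?thesis using p(1) that[of "1 / p"] by simp
  qed (use p that in blast)
qed

text \<open>
  In the parameter \<open>q\<close> of \<open>small_root\<close> the denominator \<open>- 2 * v * cos t - z\<close> becomes
  \<open>(v / q) * (1 - 2 * q * cos t + q\<^sup>2)\<close>, so the Stieltjes transform is \<open>q / v\<close>.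
\<close>

theorem stieltjes_semicircle_fixed_point:
  assumes v: "v > 0" and z: "Im z \<noteq> 0"
  defines "w \<equiv> stieltjes (semicircle_law v) z"
  shows "w * (- z - of_real (v\<^sup>2) * w) = 1" "cmod w \<le> 1 / \<bar>Im z\<bar>"
proof -
  obtain q where q: "q \<noteq> 0" "cmod q < 1" "z = - (of_real v / q) * (1 + q\<^sup>2)"
    using small_root[OF v z] by blast
  have den: "of_real (- 2 * v * cos t) - z = (of_real v / q) * (1 - 2 * q * of_real (cos t)
      + q\<^sup>2)" for t
    using q v by (simp add: field_simps power2_eq_square)
  have nz: "1 - 2 * q * of_real (cos t) + q\<^sup>2 \<noteq> 0" for t
  proof
    assume "1 - 2 * q * of_real (cos t) + q\<^sup>2 = 0"
    then have "of_real (- 2 * v * cos t) - z = 0" unfolding den by simp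
    then show False using z by (auto simp: complex_eq_iff)
  qed
  have "w = integral {0..pi} (\<lambda>t. (of_real (2 / pi) * q / of_real v) * (of_real (sin t * sin t)
      / (1 - 2 * q * of_real (cos t) + q\<^sup>2)))"
    unfolding w_def stieltjes_semicircle_trig[OF v z] den
    using q v by (intro integral_cong) (simp add: field_simps)
  also have "\<dots> = (of_real (2 / pi) * q / of_real v) * of_real (pi / 2)"
    unfolding integral_mult_right integral_sin_squared_over_poisson[OF q(2) nz] ..
  also have "\<dots> = q / of_real v" by simp
  finally have w: "w = q / of_real v" .
  show "w * (- z - of_real (v\<^sup>2) * w) = 1"
    unfolding w q(3) using q(1) v by (simp add: field_simps power2_eq_square)
  have "z = - of_real v * (q + inverse q)" unfolding q(3) using q(1)
      by (simp add: field_simps power2_eq_square)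
  then have "Im z = - v * (Im q - Im q / (cmod q)\<^sup>2)"
    by (simp add: cmod_power2)
  also have "\<dots> = v * Im q * (1 - (cmod q)\<^sup>2) / (cmod q)\<^sup>2"
    using q(1) by (simp add: field_simps)
  finally have "\<bar>Im z\<bar> = v * \<bar>Im q\<bar> * (1 - (cmod q)\<^sup>2) / (cmod q)\<^sup>2"
    using q v by (simp add: abs_mult power_le_one)
  also have "\<dots> \<le> v * cmod q * 1 / (cmod q)\<^sup>2"
    using q v abs_Im_le_cmod[of q] by (intro divide_right_mono mult_mono) (auto simp: power_le_one)
  finally have "\<bar>Im z\<bar> * cmod q \<le> v" using q(1) by (simp add: field_simps power2_eq_square)
  then show "cmod w \<le> 1 / \<bar>Im z\<bar>"
    unfolding w using v z by (simp add: norm_divide field_simps)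
qed

lemma stieltjes_semicircle_holomorphic:
  assumes v: "v > 0" and U: "convex U" "\<And>z. z \<in> U \<Longrightarrow> Im z \<noteq> 0"
  shows "stieltjes (semicircle_law v) holomorphic_on U"
proof -
  have nz: "of_real (- 2 * v * cos t) - z \<noteq> 0" if "z \<in> U" for z t
    using U(2)[OF that] by (auto simp: complex_eq_iff)
  have "(\<lambda>z. integral (cbox 0 pi) (\<lambda>t. of_real (2 / pi * (sin t * sin t)) / (of_real (- 2 * v
      * cos t) - z))) holomorphic_on U"
  proof (rule leibniz_rule_holomorphic[where fx
      = "\<lambda>z t. of_real (2 / pi * (sin t * sin t)) / (of_real (- 2 * v * cos t) - z)\<^sup>2"])
    fix z t assume "z \<in> U"
    then show "((\<lambda>z. of_real (2 / pi * (sin t * sin t)) / (of_real (- 2 * v * cos t)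
        - z)) has_field_derivative
        of_real (2 / pi * (sin t * sin t)) / (of_real (- 2 * v * cos t) - z)\<^sup>2) (at z within U)"
      using nz[of z t] by (auto intro!: derivative_eq_intros simp: power2_eq_square)
  next
    fix z assume "z \<in> U"
    then show "(\<lambda>t. of_real (2 / pi * (sin t * sin t)) / (of_real (- 2 * v * cos t)
        - z)) integrable_on cbox 0 pi"
      using nz[of z] by (intro integrable_continuous continuous_intros) auto
  next
    show "continuous_on (U \<times> cbox 0 pi) (\<lambda>(z, t). of_real (2 / pi * (sin t * sin t))
        / (of_real (- 2 * v * cos t) - z)\<^sup>2)"
      unfolding case_prod_unfold using nz by (intro continuous_intros) auto
  qed fact
  then show ?thesis
    by (rule holomorphic_transform) (simp add: stieltjes_semicircle_trig[OF v] U(2) del: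
      of_real_mult of_real_divide)
qed

section \<open>Holomorphic functions bounded by the inverse imaginary part\<close>

text \<open>
  Otherwise there are functions \<open>h m\<close> in the family that approach \<open>w\<close> at every \<open>\<zeta> k\<close> but stay away
  from \<open>w\<close> at \<open>z\<close>. A locally uniform limit of a subsequence agrees with \<open>w\<close> on a set with a limit
  point in \<open>S\<close>, hence everywhere. The number \<open>m\<close> of points and \<open>\<delta>\<close> are the same for the whole
  family, so the lemma applies to random \<open>h\<close> and turns into a union bound over \<open>m\<close> events.
\<close>

lemma half_plane_family_determined:
  fixes \<zeta> :: "nat \<Rightarrow> complex" and w :: "complex \<Rightarrow> complex"
  assumes S: "open S" "connected S" "\<And>x. x \<in> S \<Longrightarrow> Im x \<noteq> 0"
    and w: "w holomorphic_on S"
    and \<zeta>: "range \<zeta> \<subseteq> S" "\<xi> \<in> S" "\<xi> islimpt range \<zeta>" and z: "z \<in> S" and \<epsilon>: "\<epsilon> > 0"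
  obtains m \<delta> where "\<delta> > 0"
    "\<And>h. h holomorphic_on S \<Longrightarrow> (\<And>x. x \<in> S \<Longrightarrow> cmod (h x) \<le> 1 / \<bar>Im x\<bar>) \<Longrightarrow>
       (\<And>k. k < m \<Longrightarrow> cmod (h (\<zeta> k) - w (\<zeta> k)) \<le> \<delta>) \<Longrightarrow> cmod (h z - w z) \<le> \<epsilon>"
proof -
  define \<H> where "\<H> = {h. h holomorphic_on S \<and> (\<forall>x\<in>S. cmod (h x) \<le> 1 / \<bar>Im x\<bar>)}"
  have "\<exists>m \<delta>. \<delta> > 0 \<and> (\<forall>h\<in>\<H>. (\<forall>k<m. cmod (h (\<zeta> k) - w (\<zeta> k)) \<le> \<delta>) \<longrightarrow> cmod (h z - w z) \<le> \<epsilon>)"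
  proof (rule ccontr)
    assume neg: "\<not> ?thesis"
    have "\<exists>h\<in>\<H>. (\<forall>k<m. cmod (h (\<zeta> k) - w (\<zeta> k)) \<le> 1 / real (Suc m)) \<and> \<not> cmod (h z - w z) \<le> \<epsilon>" for m
    proof -
      have "1 / real (Suc m) > 0" by simp
      with neg show ?thesis by blast
    qed
    then have "\<exists>h. \<forall>m. h m \<in> \<H> \<and> (\<forall>k<m. cmod (h m (\<zeta> k) - w (\<zeta> k)) \<le> 1 / real (Suc m))
        \<and> cmod (h m z - w z) > \<epsilon>"
      unfolding not_le Bex_def by (intro choice allI)
    then obtain h where h: "\<And>m. h m \<in> \<H>" "\<And>m k. k < m
        \<Longrightarrow> cmod (h m (\<zeta> k) - w (\<zeta> k)) \<le> 1 / real (Suc m)"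
      "\<And>m. cmod (h m z - w z) > \<epsilon>" by blast
    have bounded: "\<exists>B. \<forall>h\<in>\<H>. \<forall>x\<in>K. cmod (h x) \<le> B" if K: "compact K" "K \<subseteq> S" for K
    proof -
      have "continuous_on K (\<lambda>x. 1 / \<bar>Im x\<bar>)" using K S(3) by (intro continuous_intros) auto
      then have "bounded ((\<lambda>x. 1 / \<bar>Im x\<bar>) ` K)"
        using K by (intro compact_imp_bounded compact_continuous_image)
      then obtain B where B: "\<forall>y\<in>(\<lambda>x. 1 / \<bar>Im x\<bar>) ` K. norm y \<le> B" unfolding bounded_iff by blast
      have "cmod (h x) \<le> B" if "h \<in> \<H>" "x \<in> K" for h x
      proof -
        have "cmod (h x) \<le> 1 / \<bar>Im x\<bar>" using that K(2) by (auto simp: \<H>_def)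
        also have "\<dots> \<le> B" using B that(2) by force
        finally show ?thesis .
      qed
      then show ?thesis by blast
    qed
    obtain g r where g: "g holomorphic_on S" "strict_mono (r :: nat \<Rightarrow> nat)"
      "\<And>x. x \<in> S \<Longrightarrow> (\<lambda>n. h (r n) x) \<longlonglongrightarrow> g x"
      by (rule Montel[OF S(1), of \<H> h]) (use bounded h(1) in \<open>auto simp: \<H>_def\<close>)
    have "g (\<zeta> k) - w (\<zeta> k) = 0" for k
    proof -
      have "(\<lambda>n. h (r n) (\<zeta> k) - w (\<zeta> k)) \<longlonglongrightarrow> g (\<zeta> k) - w (\<zeta> k)"
        using \<zeta>(1) by (intro tendsto_diff g tendsto_const) auto
      moreover have "(\<lambda>n. h (r n) (\<zeta> k) - w (\<zeta> k)) \<longlonglongrightarrow> 0"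
      proof (rule Lim_null_comparison)
        show "\<forall>\<^sub>F n in sequentially. cmod (h (r n) (\<zeta> k) - w (\<zeta> k)) \<le> 1 / real (Suc n)"
          using eventually_gt_at_top[of k]
        proof eventually_elim
          case (elim n)
          have "n \<le> r n" by (rule strict_mono_imp_increasing) (rule g(2))
          then have "cmod (h (r n) (\<zeta> k) - w (\<zeta> k)) \<le> 1 / real (Suc (r n))" using elim
              by (intro h(2)) auto
          also have "\<dots> \<le> 1 / real (Suc n)" using \<open>n \<le> r n\<close> by (intro divide_left_mono) auto
          finally show ?case .
        qed
        show "(\<lambda>n. 1 / real (Suc n)) \<longlonglongrightarrow> 0" by (rule LIMSEQ_Suc[OF lim_1_over_n])
      qed
      ultimately show ?thesis by (rule LIMSEQ_unique)
    qed
    then have "g z - w z = 0"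
      by (intro analytic_continuation[OF holomorphic_on_diff[OF g(1) w] S(1,2) \<zeta> _ z]) blast
    moreover have "(\<lambda>n. cmod (h (r n) z - w z)) \<longlonglongrightarrow> cmod (g z - w z)"
      using z by (intro tendsto_intros g)
    ultimately have "(\<lambda>n. cmod (h (r n) z - w z)) \<longlonglongrightarrow> 0" by simp
    then have "\<epsilon> \<le> 0" by (rule LIMSEQ_le_const) (use h(3) in \<open>auto intro: less_imp_le\<close>)
    with \<epsilon> show False by simp
  qed
  then obtain m \<delta> where "\<delta> > 0"
    and *: "\<forall>h\<in>\<H>. (\<forall>k<m. cmod (h (\<zeta> k) - w (\<zeta> k)) \<le> \<delta>) \<longrightarrow> cmod (h z - w z) \<le> \<epsilon>" by blast
  show ?thesis by (rule that[OF \<open>\<delta> > 0\<close>, of m]) (use * in \<open>simp add: \<H>_def\<close>)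
qed

text \<open>
  The poles are the eigenvalues, which are real, and a real number has distance at least \<open>\<bar>Im z\<bar>\<close>
  from \<open>z\<close>.
\<close>

lemma eigenvalue_stieltjes_holomorphic_bounded:
  fixes H :: "nat \<Rightarrow> nat \<Rightarrow> real"
  assumes sym: "\<And>j k. j < N \<Longrightarrow> k < N \<Longrightarrow> H j k = H k j" and S: "\<And>x. x \<in> S \<Longrightarrow> Im x \<noteq> 0"
  defines "A \<equiv> mat N N (\<lambda>(k, l). H k l)"
  shows "eigenvalue_stieltjes A holomorphic_on S"
    and "z \<in> S \<Longrightarrow> cmod (eigenvalue_stieltjes A z) \<le> 1 / \<bar>Im z\<bar>"
proof -
  obtain xs where xs: "mset xs = eigenvalue_mset A" using ex_mset by blast
  have real: "Im x = 0" if "x \<in> set xs" for x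
    using eigenvalue_real[of N H x] sym that xs unfolding A_def by (metis set_mset_mset)
  have len: "length xs = N"
    using size_eigenvalue_mset[of N H] sym xs unfolding A_def by (metis size_mset)
  have eq: "eigenvalue_stieltjes A z = (\<Sum>x\<leftarrow>xs. 1 / (x - z)) / of_nat N" for z
  proof -
    have "dim_row A = N" by (simp add: A_def)
    then show ?thesis
      by (simp add: eigenvalue_stieltjes_def xs[symmetric] sum_mset_sum_list[symmetric]
        mset_map[symmetric] del: mset_map)
  qed
  have "(\<lambda>z. \<Sum>x\<leftarrow>ys. 1 / (x - z)) holomorphic_on S" if "set ys \<subseteq> set xs" for ys
    using that
  proof (induction ys)
    case (Cons y ys)
    have "y - z \<noteq> 0" if "z \<in> S" for z using S[OF that] real[of y] Cons.prems by auto
    then show ?case using Cons by (auto intro!: holomorphic_intros)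
  qed simp
  then show "eigenvalue_stieltjes A holomorphic_on S"
    unfolding eq[abs_def] by (cases "N = 0") (auto intro!: holomorphic_intros)
  assume z: "z \<in> S"
  have "cmod (\<Sum>x\<leftarrow>ys. 1 / (x - z)) \<le> real (length ys) * (1 / \<bar>Im z\<bar>)" if "set ys \<subseteq> set xs" for ys
    using that
  proof (induction ys)
    case (Cons y ys)
    have "\<bar>Im z\<bar> \<le> cmod (y - z)" using abs_Im_le_cmod[of "y - z"] real[of y] Cons.prems by simp
    then have "cmod (1 / (y - z)) \<le> 1 / \<bar>Im z\<bar>"
      using S[OF z] by (simp add: norm_divide frac_le)
    then have "cmod (1 / (y - z)) + cmod (\<Sum>x\<leftarrow>ys. 1 / (x - z))
        \<le> real (length (y # ys)) * (1 / \<bar>Im z\<bar>)"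
      using Cons by (simp add: algebra_simps add_divide_distrib)
    then show ?case by (simp add: order_trans[OF norm_triangle_ineq])
  qed simp
  from this[of xs] show "cmod (eigenvalue_stieltjes A z) \<le> 1 / \<bar>Im z\<bar>"
    unfolding eq by (cases "N = 0") (auto simp: norm_divide len field_simps)
qed

section \<open>Convergence in probability\<close>

context long_range_percolation
begin

sublocale even_profile \<psi>
  using psi_range psi_cont psi_even psi_noninc psi_integral by unfold_locales auto

definition scaled_entry :: "nat \<Rightarrow> nat \<times> nat \<Rightarrow> 'w \<Rightarrow> real" where
  "scaled_entry n p \<omega> = a (int (fst p) - int n) (int (snd p) - int n) \<omega>
     * d n (int (fst p) - int n) (int (snd p) - int n) \<omega> / sqrt (real_of_int (b n))"

definition variance_profile :: "nat \<Rightarrow> nat \<Rightarrow> nat \<Rightarrow> real" where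
  "variance_profile n j k = v\<^sup>2 * (\<psi> ((real j - real k) / b n) / b n)"

lemma percolation_matrix_eq:
  "percolation_matrix a b d n \<omega>
    = mat (2 * n + 1) (2 * n + 1) (\<lambda>(k, l). sym_entry (\<lambda>p. scaled_entry n p \<omega>) k l)"
proof -
  have "min (int k - int n) (int l - int n) = int (min k l) - int n"
    "max (int k - int n) (int l - int n) = int (max k l) - int n" for k l by auto
  then show ?thesis
    by (simp add: percolation_matrix_def sym_entry_def scaled_entry_def Let_def)
qed

lemma b_pos: "n \<ge> 1 \<Longrightarrow> b n > 0" and b_ge_1: "n \<ge> 1 \<Longrightarrow> real_of_int (b n) \<ge> 1"
  using b_range[of n] by auto

lemma indep_scaled_entry:
  assumes n: "n \<ge> 1"
  shows "indep_vars (\<lambda>_. borel) (scaled_entry n) {(j, k). j \<le> k \<and> k < 2 * n + 1}"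
proof -
  let ?I = "{(i, j). i \<le> (j::int)}" and ?J = "{(i, j). - int n \<le> i \<and> i \<le> j \<and> j \<le> int n}"
  let ?A = "\<lambda>p. a (fst p) (snd p)" and ?D = "\<lambda>p. d n (fst p) (snd p)"
  have A: "indep_vars (\<lambda>_. borel) ?A ?I" using a_indep by (simp add: case_prod_unfold)
  have D: "indep_vars (\<lambda>_. borel) ?D ?J" using d_indep[OF n] by (simp add: case_prod_unfold)
  have AD: "indep_var (PiM ?I (\<lambda>_. borel)) (\<lambda>\<omega>. restrict (\<lambda>i. ?A i \<omega>) ?I) (PiM ?J (\<lambda>_. borel))
      (\<lambda>\<omega>. restrict (\<lambda>j. ?D j \<omega>) ?J)"
    using a_d_indep[OF n] by (simp add: case_prod_unfold)
  have "indep_vars (\<lambda>_. borel) (\<lambda>p \<omega>. ?A p \<omega> * ?D p \<omega>) ?J"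
    by (rule indep_vars_mult[OF A D AD]) auto
  from indep_vars_reindex[OF this, of "\<lambda>p. (int (fst p) - int n, int (snd p) - int n)" "{(j, k). j
      \<le> k \<and> k < 2 * n + 1}"]
  have "indep_vars (\<lambda>_. borel) (\<lambda>p \<omega>. ?A (int (fst p) - int n, int (snd p) - int n) \<omega>
      * ?D (int (fst p) - int n, int (snd p) - int n) \<omega>)
      {(j, k). j \<le> k \<and> k < 2 * n + 1}"
    by (force simp: inj_on_def)
  from indep_vars_compose2[OF this, of "\<lambda>_ x. x / sqrt (real_of_int (b n))" "\<lambda>_. borel"]
  show ?thesis by (simp add: scaled_entry_def[abs_def])
qed

text \<open>
  Applied to \<open>x\<close>, \<open>x\<^sup>2\<close> and \<open>\<bar>x\<bar> ^ 3\<close>: for a multiplicative \<open>f\<close> the expectation splits into the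
  contributions of \<open>a\<close>, of the Bernoulli variable and of the normalization.
\<close>

lemma scaled_entry_moment:
  fixes f :: "real \<Rightarrow> real"
  assumes n: "n \<ge> 1" and jk: "j \<le> k" "k < 2 * n + 1"
    and [measurable]: "f \<in> borel_measurable borel" and f: "f 0 = 0" "f 1 = 1" "\<And>x y. f (x * y)
        = f x * f y"
    and int: "integrable M (\<lambda>\<omega>. f (a (int j - int n) (int k - int n) \<omega>))"
  shows "integrable M (\<lambda>\<omega>. f (scaled_entry n (j, k) \<omega>))"
    and "expectation (\<lambda>\<omega>. f (scaled_entry n (j, k) \<omega>))
        = expectation (\<lambda>\<omega>. f (a (int j - int n) (int k - int n) \<omega>))
      * \<psi> ((real j - real k) / b n) * f (1 / sqrt (b n))"
proof -
  let ?I = "{(i, j). i \<le> (j::int)}" and ?J = "{(i, j). - int n \<le> i \<and> i \<le> j \<and> j \<le> int n}"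
  let ?A = "\<lambda>p. a (fst p) (snd p)" and ?D = "\<lambda>p. d n (fst p) (snd p)"
  let ?p = "(int j - int n, int k - int n)"
  have p: "?p \<in> ?I" "?p \<in> ?J" using jk by auto
  have AD: "indep_var (PiM ?I (\<lambda>_. borel)) (\<lambda>\<omega>. restrict (\<lambda>i. ?A i \<omega>) ?I) (PiM ?J (\<lambda>_. borel))
      (\<lambda>\<omega>. restrict (\<lambda>j. ?D j \<omega>) ?J)"
    using a_d_indep[OF n] by (simp add: case_prod_unfold)
  have D: "?D ?p \<in> borel_measurable M"
    using d_indep[OF n] p unfolding indep_vars_def by fastforce
  have prob: "prob {\<omega> \<in> space M. ?D ?p \<omega> = 1} = \<psi> ((real j - real k) / b n)"
    "prob {\<omega> \<in> space M. ?D ?p \<omega> = 0} = 1 - \<psi> ((real j - real k) / b n)"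
    using d_bernoulli[OF n, of "fst ?p" "snd ?p"] p by auto
  note bern = bernoulli_moment[OF D prob \<open>f \<in> borel_measurable borel\<close> f(1,2)]
  note prod = indep_var_component_mult[OF AD p \<open>f \<in> borel_measurable borel\<close> \<open>f
      \<in> borel_measurable borel\<close> _ bern(1)]
  have eq: "f (scaled_entry n (j, k) \<omega>) = f (?A ?p \<omega>) * f (?D ?p \<omega>) * f (1 / sqrt (b n))" for \<omega>
    by (simp add: scaled_entry_def f(3)[symmetric])
  show "integrable M (\<lambda>\<omega>. f (scaled_entry n (j, k) \<omega>))" unfolding eq using prod(1) int by simp
  show "expectation (\<lambda>\<omega>. f (scaled_entry n (j, k) \<omega>))
      = expectation (\<lambda>\<omega>. f (a (int j - int n) (int k - int n) \<omega>))
      * \<psi> ((real j - real k) / b n) * f (1 / sqrt (b n))"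
    unfolding eq using prod(2) int bern(2) by simp
qed

lemma borel_measurable_eigenvalue_stieltjes:
  assumes "n \<ge> 1" "Im z \<noteq> 0"
  shows "(\<lambda>\<omega>. eigenvalue_stieltjes (percolation_matrix a b d n \<omega>) z) \<in> borel_measurable M"
proof -
  have "(\<lambda>\<omega>. sym_entry (\<lambda>p. scaled_entry n p \<omega>) k l) \<in> borel_measurable M"
      if "k < 2 * n + 1" "l < 2 * n + 1" for k l
    using indep_scaled_entry[OF assms(1)] that by (auto simp: indep_vars_def sym_entry_def)
  then have "(\<lambda>\<omega>. (\<Sum>i<2 * n + 1. resolvent_entry (2 * n
      + 1) (sym_entry (\<lambda>p. scaled_entry n p \<omega>)) z i i) / of_nat (2 * n + 1)) \<in> borel_measurable M"
    by (intro borel_measurable_divide borel_measurable_sum borel_measurable_const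
      borel_measurable_resolvent_entry) auto
  then show ?thesis
    unfolding percolation_matrix_eq
    by (subst eigenvalue_stieltjes_eq_trace[OF sym_entry_commute assms(2)])
qed

text \<open>
  Here the variances are at most \<open>\<sigma> n = v\<^sup>2 / b n\<close>, their row sums at most \<open>2 * v\<^sup>2\<close>, and the
  third moments at most \<open>\<kappa> n\<close> times the variances with \<open>\<kappa> n\<close> of order \<open>1 / sqrt (b n)\<close>.
\<close>

lemma plim_far_from_axis:
  assumes third: "\<And>i j. i \<le> j \<Longrightarrow> integrable M (\<lambda>\<omega>. \<bar>a i j \<omega>\<bar> ^ 3)
      \<and> expectation (\<lambda>\<omega>. \<bar>a i j \<omega>\<bar> ^ 3) \<le> \<mu>"
    and z: "4 * v\<^sup>2 \<le> (Im z)\<^sup>2" and \<epsilon>: "\<epsilon> > 0"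
  shows "(\<lambda>n. prob {\<omega> \<in> space M. cmod (eigenvalue_stieltjes (percolation_matrix a b d n \<omega>) z
      - stieltjes (semicircle_law v) z) > \<epsilon>}) \<longlonglongrightarrow> 0"
proof -
  define \<eta> where "\<eta> = \<bar>Im z\<bar>"
  define w where "w = stieltjes (semicircle_law v) z"
  have z0: "Im z \<noteq> 0" using z v_pos by auto
  have \<eta>: "\<eta> > 0" "(Im z)\<^sup>2 = \<eta>\<^sup>2" using z0 by (auto simp: \<eta>_def)
  have w: "w * (- z - of_real (v\<^sup>2) * w) = 1" "cmod w \<le> 1 / \<bar>Im z\<bar>"
    unfolding w_def by (rule stieltjes_semicircle_fixed_point[OF v_pos z0])+
  have \<mu>: "\<mu> \<ge> 0"
  proof -
    have "0 \<le> expectation (\<lambda>\<omega>. \<bar>a 0 0 \<omega>\<bar> ^ 3)" by simp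
    also have "\<dots> \<le> \<mu>" using third[of 0 0] by blast
    finally show ?thesis .
  qed
  \<comment> \<open>The summand 1 keeps \<open>\<kappa> n\<close> positive even if \<open>\<mu> = 0\<close>.\<close>
  define \<kappa> where "\<kappa> n = (\<mu> + 1) / (v\<^sup>2 * sqrt (b n))" for n
  define \<sigma> where "\<sigma> n = v\<^sup>2 / b n" for n
  define dev where "dev n = (\<Sum>i<2 * n + 1. \<bar>band_row_sum (b n) (2 * n + 1) i - 1\<bar>) / real (2 * n
      + 1)" for n
  define err where "err n = 2 * \<sigma> n / \<eta> + sqrt (\<sigma> n)
     + (sqrt (2 * \<sigma> n * (2 * v\<^sup>2)) + sqrt (\<kappa> n * (2 * v\<^sup>2)) + 2 * sqrt (\<kappa> n) * (2 * v\<^sup>2)) / \<eta>" for n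
  define bound where "bound n = 2 / \<eta>\<^sup>2 * (v\<^sup>2 * dev n / \<eta> + err n)" for n
  let ?G = "\<lambda>n \<omega> i. resolvent_entry (2 * n + 1) (sym_entry (\<lambda>p. scaled_entry n p \<omega>)) z i i"
  have main: "(\<integral>\<^sup>+\<omega>. ennreal (\<Sum>i<2 * n + 1. cmod (?G n \<omega> i - w)) \<partial>M)
      \<le> ennreal (real (2 * n + 1) * bound n)"
    if n: "n \<ge> 1" for n
  proof -
    have bn: "real_of_int (b n) > 0" "real_of_int (b n) \<ge> 1" using b_ge_1[OF n] by auto
    have row: "(\<Sum>j<2 * n + 1. variance_profile n i j) = v\<^sup>2 * band_row_sum (b n) (2 * n + 1) i"
        for i
      unfolding variance_profile_def band_row_sum_def by (rule sum_distrib_left[symmetric])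
    have "(\<integral>\<^sup>+\<omega>. ennreal (\<Sum>i<2 * n + 1. cmod (?G n \<omega> i - w)) \<partial>M)
      \<le> ennreal (2 / (Im z)\<^sup>2 * ((\<Sum>i<2 * n + 1. \<bar>(\<Sum>j<2 * n + 1. variance_profile n i j) - v\<^sup>2\<bar>)
          / \<bar>Im z\<bar>
        + real (2 * n + 1) * (2 * \<sigma> n / \<bar>Im z\<bar> + sqrt (\<sigma> n)
          + (sqrt (2 * \<sigma> n * (2 * v\<^sup>2)) + sqrt (\<kappa> n * (2 * v\<^sup>2)) + 2 * sqrt (\<kappa> n) * (2 * v\<^sup>2))
              / \<bar>Im z\<bar>)))"
    proof (rule resolvent_diagonal_first_moment[OF indep_scaled_entry[OF n] _ _ _ _ _ _ _ _ z0 w])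
      fix j k :: nat assume jk: "j \<le> k" "k < 2 * n + 1"
      then have le: "int j - int n \<le> int k - int n" by simp
      show "integrable M (scaled_entry n (j, k)) \<and> expectation (scaled_entry n (j, k)) = 0"
        using scaled_entry_moment[OF n jk, of "\<lambda>x. x"] a_mean[OF le] by simp
      show "integrable M (\<lambda>\<omega>. (scaled_entry n (j, k) \<omega>)\<^sup>2)
          \<and> expectation (\<lambda>\<omega>. (scaled_entry n (j, k) \<omega>)\<^sup>2) = variance_profile n j k"
        using scaled_entry_moment[OF n jk, of "\<lambda>x. x\<^sup>2"] a_second_moment[OF le] bn
        by (simp add: power_mult_distrib power_divide variance_profile_def)
      have "expectation (\<lambda>\<omega>. \<bar>scaled_entry n (j, k) \<omega>\<bar> ^ 3)
          = expectation (\<lambda>\<omega>. \<bar>a (int j - int n) (int k - int n) \<omega>\<bar> ^ 3) * (\<psi> ((real j - real k)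
              / b n) * (1 / sqrt (b n)) ^ 3)"
        using scaled_entry_moment(2)[OF n jk, of "\<lambda>x. \<bar>x\<bar> ^ 3"] third[OF le] bn
        by (simp add: power_mult_distrib abs_mult)
      also have "\<dots> \<le> (\<mu> + 1) * (\<psi> ((real j - real k) / b n) * (1 / sqrt (b n)) ^ 3)"
        using third[OF le] psi_range bn by (intro mult_right_mono) auto
      also have "\<dots> = \<kappa> n * variance_profile n j k"
        using bn v_pos by (simp add: \<kappa>_def variance_profile_def power3_eq_cube)
      finally show "integrable M (\<lambda>\<omega>. \<bar>scaled_entry n (j, k) \<omega>\<bar> ^ 3)
          \<and> expectation (\<lambda>\<omega>. \<bar>scaled_entry n (j, k) \<omega>\<bar> ^ 3) \<le> \<kappa> n * variance_profile n j k"
        using scaled_entry_moment(1)[OF n jk, of "\<lambda>x. \<bar>x\<bar> ^ 3"] third[OF le]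
        by (simp add: power_mult_distrib abs_mult)
    next
      fix j k
      have "(real k - real j) / b n = - ((real j - real k) / b n)" by (simp add: minus_divide_left)
      then show "variance_profile n j k = variance_profile n k j"
        unfolding variance_profile_def by (metis psi_even)
      have "v\<^sup>2 * (\<psi> ((real j - real k) / b n) / b n) \<le> v\<^sup>2 * (1 / b n)"
        using psi_range bn by (intro mult_left_mono divide_right_mono) auto
      then show "variance_profile n j k \<le> \<sigma> n" by (simp add: variance_profile_def \<sigma>_def)
    next
      fix i assume i: "i < 2 * n + 1"
      have "band_row_sum (b n) (2 * n + 1) i \<le> 1 + 1 / b n" by (rule band_row_sum_le[OF i bn(1)])
      also have "\<dots> \<le> 2" using bn by simp
      finally have "v\<^sup>2 * band_row_sum (b n) (2 * n + 1) i \<le> v\<^sup>2 * 2" by (rule mult_left_mono) simp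
      then show "(\<Sum>j<2 * n + 1. variance_profile n i j) \<le> 2 * v\<^sup>2"
        unfolding row by (simp only: mult.commute[of "v\<^sup>2"])
    qed (use z bn v_pos \<mu> in \<open>auto simp: \<kappa>_def\<close>)
    also have "(\<Sum>i<2 * n + 1. \<bar>(\<Sum>j<2 * n + 1. variance_profile n i j) - v\<^sup>2\<bar>)
        = v\<^sup>2 * (real (2 * n + 1) * dev n)"
    proof -
      have "\<bar>v\<^sup>2 * x - v\<^sup>2\<bar> = v\<^sup>2 * \<bar>x - 1\<bar>" for x
        by (metis abs_mult abs_power2 mult.right_neutral right_diff_distrib)
      moreover have "real (2 * n + 1) * dev n
          = (\<Sum>i<2 * n + 1. \<bar>band_row_sum (b n) (2 * n + 1) i - 1\<bar>)"
        by (simp add: dev_def del: sum.lessThan_Suc)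
      ultimately show ?thesis unfolding row by (simp only: sum_distrib_left)
    qed
    also have "2 / (Im z)\<^sup>2 * (v\<^sup>2 * (real (2 * n + 1) * dev n) / \<bar>Im z\<bar>
        + real (2 * n + 1) * (2 * \<sigma> n / \<bar>Im z\<bar> + sqrt (\<sigma> n)
          + (sqrt (2 * \<sigma> n * (2 * v\<^sup>2)) + sqrt (\<kappa> n * (2 * v\<^sup>2)) + 2 * sqrt (\<kappa> n) * (2 * v\<^sup>2))
              / \<bar>Im z\<bar>))
        = real (2 * n + 1) * bound n"
    proof -
      have "2 / e * (x * (N * D) / h + N * E) = N * (2 / e * (x * D / h + E))"
          for e x N D h E :: real
        by (simp add: algebra_simps)
      then show ?thesis unfolding bound_def err_def \<eta>(2) \<eta>_def[symmetric] .
    qed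
    finally show ?thesis .
  qed
  have prob_le: "prob {\<omega> \<in> space M. cmod (eigenvalue_stieltjes (percolation_matrix a b d n \<omega>) z
      - w) > \<epsilon>} \<le> bound n / \<epsilon>"
    if n: "n \<ge> 1" for n
  proof -
    define Y where "Y \<omega> = (\<Sum>i<2 * n + 1. cmod (?G n \<omega> i - w))" for \<omega>
    let ?N = "real (2 * n + 1)"
    have N: "?N > 0" by simp
    have "(\<lambda>\<omega>. sym_entry (\<lambda>p. scaled_entry n p \<omega>) k l) \<in> borel_measurable M"
        if "k < 2 * n + 1" "l < 2 * n + 1" for k l
      using indep_scaled_entry[OF n] that by (auto simp: indep_vars_def sym_entry_def)
    then have "(\<lambda>\<omega>. ?G n \<omega> i) \<in> borel_measurable M" if "i < 2 * n + 1" for i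
      using that by (intro borel_measurable_resolvent_entry)
    then have [measurable]: "Y \<in> borel_measurable M" unfolding Y_def[abs_def] by measurable
    have le: "cmod (eigenvalue_stieltjes (percolation_matrix a b d n \<omega>) z - w) \<le> Y \<omega> / ?N" for \<omega>
    proof -
      have "eigenvalue_stieltjes (percolation_matrix a b d n \<omega>) z - w
          = (\<Sum>i<2 * n + 1. ?G n \<omega> i - w) / of_nat (2 * n + 1)"
        unfolding percolation_matrix_eq eigenvalue_stieltjes_eq_trace[OF sym_entry_commute z0]
        by (simp add: sum_subtractf diff_divide_distrib del: of_nat_Suc of_nat_add of_nat_mult
          sum.lessThan_Suc)
      also have "cmod \<dots> = cmod (\<Sum>i<2 * n + 1. ?G n \<omega> i - w) / ?N"
        by (simp only: norm_divide norm_of_nat)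
      also have "\<dots> \<le> Y \<omega> / ?N"
        unfolding Y_def by (intro divide_right_mono norm_sum) simp
      finally show ?thesis .
    qed
    have "emeasure M {\<omega> \<in> space M. cmod (eigenvalue_stieltjes (percolation_matrix a b d n \<omega>) z
        - w) > \<epsilon>}
        \<le> emeasure M {\<omega> \<in> space M. 1 \<le> ennreal (1 / (?N * \<epsilon>)) * ennreal (Y \<omega>)}"
    proof (intro emeasure_mono subsetI CollectI conjI)
      fix \<omega> assume "\<omega> \<in> {\<omega> \<in> space M. cmod (eigenvalue_stieltjes (percolation_matrix a b d n \<omega>) z
          - w) > \<epsilon>}"
      then have "\<omega> \<in> space M" "\<epsilon> < Y \<omega> / ?N" using le[of \<omega>] by auto
      then show "\<omega> \<in> space M" by simp
      have "1 \<le> 1 / (?N * \<epsilon>) * Y \<omega>"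
        using \<open>\<epsilon> < Y \<omega> / ?N\<close> N \<epsilon> by (simp add: field_simps del: of_nat_Suc of_nat_add of_nat_mult)
      then show "1 \<le> ennreal (1 / (?N * \<epsilon>)) * ennreal (Y \<omega>)"
        using \<epsilon> by (subst ennreal_mult[symmetric]) (auto simp: Y_def sum_nonneg
            ennreal_1[symmetric] simp del: ennreal_1)
    qed measurable
    also have "\<dots> \<le> ennreal (1 / (?N * \<epsilon>)) * (\<integral>\<^sup>+\<omega>. ennreal (Y \<omega>) * indicator (space M) \<omega> \<partial>M)"
      by (rule nn_integral_Markov_inequality) auto
    also have "(\<integral>\<^sup>+\<omega>. ennreal (Y \<omega>) * indicator (space M) \<omega> \<partial>M) = (\<integral>\<^sup>+\<omega>. ennreal (Y \<omega>) \<partial>M)"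
      by (intro nn_integral_cong) simp
    also have "ennreal (1 / (?N * \<epsilon>)) * \<dots> \<le> ennreal (1 / (?N * \<epsilon>)) * ennreal (?N * bound n)"
      unfolding Y_def by (intro mult_left_mono main[OF n]) simp
    also have "\<dots> = ennreal (bound n / \<epsilon>)"
      using N \<epsilon> by (subst ennreal_mult'[symmetric]) (simp_all del: of_nat_Suc of_nat_add
          of_nat_mult)
    finally have e: "ennreal (prob {\<omega> \<in> space M. cmod (eigenvalue_stieltjes (percolation_matrix a
        b d n \<omega>) z - w) > \<epsilon>}) \<le> ennreal (bound n / \<epsilon>)"
      by (simp add: emeasure_eq_measure)
    have "0 \<le> bound n"
      unfolding bound_def err_def dev_def \<sigma>_def \<kappa>_def using \<eta> \<mu> b_pos[OF n]
      by (intro mult_nonneg_nonneg add_nonneg_nonneg divide_nonneg_nonneg sum_nonneg) auto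
    then show ?thesis using e \<epsilon> by simp
  qed
  have b_real: "filterlim (\<lambda>n. real_of_int (b n)) at_top sequentially"
    by (rule filterlim_compose[OF filterlim_real_of_int_at_top b_infty])
  have inv: "(\<lambda>n. 1 / real_of_int (b n)) \<longlonglongrightarrow> 0"
    using tendsto_inverse_0_at_top[OF b_real] by (simp add: inverse_eq_divide)
  have "(\<lambda>n. v\<^sup>2 * (1 / b n)) \<longlonglongrightarrow> v\<^sup>2 * 0" by (intro tendsto_intros inv)
  then have \<sigma>: "\<sigma> \<longlonglongrightarrow> 0" by (simp add: \<sigma>_def[abs_def])
  have "(\<lambda>n. (\<mu> + 1) / v\<^sup>2 * sqrt (1 / b n)) \<longlonglongrightarrow> (\<mu> + 1) / v\<^sup>2 * sqrt 0" by (intro tendsto_intros inv)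
  then have \<kappa>: "\<kappa> \<longlonglongrightarrow> 0" by (simp add: \<kappa>_def[abs_def] real_sqrt_divide)
  have dev: "dev \<longlonglongrightarrow> 0"
    unfolding dev_def[abs_def]
  proof (rule average_deviation_tendsto)
    show "\<forall>\<^sub>F n in sequentially. 0 < real_of_int (b n)"
      using eventually_ge_at_top[of 1] by eventually_elim (simp add: b_pos)
  qed (fact b_real b_small)+
  have "(\<lambda>n. bound n / \<epsilon>) \<longlonglongrightarrow> (2 / \<eta>\<^sup>2 * (v\<^sup>2 * 0 / \<eta> + (2 * 0 / \<eta> + sqrt 0
     + (sqrt (2 * 0 * (2 * v\<^sup>2)) + sqrt (0 * (2 * v\<^sup>2)) + 2 * sqrt 0 * (2 * v\<^sup>2)) / \<eta>))) / \<epsilon>"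
    unfolding bound_def err_def using \<eta> \<epsilon> by (intro tendsto_intros \<sigma> \<kappa> dev) auto
  then have lim: "(\<lambda>n. bound n / \<epsilon>) \<longlonglongrightarrow> 0" by simp
  show ?thesis
    unfolding w_def[symmetric]
  proof (rule tendsto_sandwich[OF _ _ tendsto_const lim])
    show "\<forall>\<^sub>F n in sequentially. prob {\<omega> \<in> space M. cmod (eigenvalue_stieltjes (percolation_matrix
        a b d n \<omega>) z - w) > \<epsilon>} \<le> bound n / \<epsilon>"
      using eventually_ge_at_top[of 1] by eventually_elim (rule prob_le)
  qed simp
qed

text \<open>
  The points \<open>\<zeta> k\<close> lie on the imaginary axis, on the side of \<open>z\<close>, at distance at least \<open>2 * v\<close>
  from the real axis, and accumulate at \<open>\<xi>\<close>.
\<close>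

lemma plim_everywhere:
  assumes third: "\<And>i j. i \<le> j \<Longrightarrow> integrable M (\<lambda>\<omega>. \<bar>a i j \<omega>\<bar> ^ 3)
      \<and> expectation (\<lambda>\<omega>. \<bar>a i j \<omega>\<bar> ^ 3) \<le> \<mu>"
    and z: "Im z \<noteq> 0"
  shows "plim_const M (\<lambda>n \<omega>. eigenvalue_stieltjes (percolation_matrix a b d n \<omega>) z) (stieltjes
      (semicircle_law v) z)"
  unfolding plim_const_def
proof (intro allI impI)
  fix \<epsilon> :: real assume \<epsilon>: "\<epsilon> > 0"
  define g where "g n \<omega> = eigenvalue_stieltjes (percolation_matrix a b d n \<omega>)" for n \<omega>
  define w where "w = stieltjes (semicircle_law v)"
  define S where "S = {x. Im z * Im x > 0}"
  have S: "open S" "convex S" "\<And>x. x \<in> S \<Longrightarrow> Im x \<noteq> 0" "z \<in> S"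
  proof -
    have "S = {x. (\<i> * of_real (Im z)) \<bullet> x > 0}" by (auto simp: S_def inner_complex_def)
    then show "open S" "convex S" by (auto intro: open_halfspace_gt convex_halfspace_gt)
    show "z \<in> S" using z by (auto simp: S_def zero_less_mult_iff)
  qed (auto simp: S_def)
  define \<zeta> where "\<zeta> m = Complex 0 (sgn (Im z) * (2 * v + 1 / real (Suc m)))" for m
  define \<xi> where "\<xi> = Complex 0 (sgn (Im z) * (2 * v))"
  have pos: "2 * v + 1 / real (Suc m) > 0" for m using v_pos by (simp add: add_pos_pos)
  have \<zeta>S: "range \<zeta> \<subseteq> S" using pos z by (auto simp: S_def \<zeta>_def mult.assoc[symmetric]
      abs_sgn[symmetric])
  have \<xi>S: "\<xi> \<in> S" using v_pos z by (auto simp: S_def \<xi>_def mult.assoc[symmetric]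
      abs_sgn[symmetric])
  have lim: "\<xi> islimpt range \<zeta>"
    unfolding islimpt_sequential
  proof (intro exI conjI allI)
    show "\<zeta> m \<in> range \<zeta> - {\<xi>}" for m using z by (auto simp: \<zeta>_def \<xi>_def sgn_eq_0_iff)
    have "(\<lambda>m. Complex 0 (sgn (Im z) * (2 * v + 1 / real (Suc m)))) \<longlonglongrightarrow> Complex 0 (sgn (Im z) * (2
        * v + 0))"
      by (intro tendsto_intros LIMSEQ_Suc[OF lim_1_over_n])
    then show "\<zeta> \<longlonglongrightarrow> \<xi>" by (simp add: \<zeta>_def[abs_def] \<xi>_def)
  qed
  have hw: "w holomorphic_on S" unfolding w_def
    by (rule stieltjes_semicircle_holomorphic[OF v_pos S(2) S(3)])
  obtain m \<delta> where \<delta>: "\<delta> > 0"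
    "\<And>h. h holomorphic_on S \<Longrightarrow> (\<And>x. x \<in> S \<Longrightarrow> cmod (h x) \<le> 1 / \<bar>Im x\<bar>) \<Longrightarrow>
       (\<And>k. k < m \<Longrightarrow> cmod (h (\<zeta> k) - w (\<zeta> k)) \<le> \<delta>) \<Longrightarrow> cmod (h z - w z) \<le> \<epsilon>"
    using half_plane_family_determined[OF S(1) convex_connected[OF S(2)] S(3) hw \<zeta>S \<xi>S lim S(4) \<epsilon>]
        by metis
  have sub: "{\<omega> \<in> space M. cmod (g n \<omega> z - w z) > \<epsilon>} \<subseteq> (\<Union>k<m. {\<omega>
      \<in> space M. cmod (g n \<omega> (\<zeta> k) - w (\<zeta> k)) > \<delta>})" for n
  proof
    fix \<omega> assume \<omega>: "\<omega> \<in> {\<omega> \<in> space M. cmod (g n \<omega> z - w z) > \<epsilon>}"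
    have "g n \<omega> holomorphic_on S" "\<And>x. x \<in> S \<Longrightarrow> cmod (g n \<omega> x) \<le> 1 / \<bar>Im x\<bar>"
      unfolding g_def percolation_matrix_eq
      by (rule eigenvalue_stieltjes_holomorphic_bounded[OF sym_entry_commute S(3)]; assumption)+
    with \<delta>(2)[of "g n \<omega>"] \<omega> have "\<exists>k<m. cmod (g n \<omega> (\<zeta> k) - w (\<zeta> k)) > \<delta>" by force
    with \<omega> show "\<omega> \<in> (\<Union>k<m. {\<omega> \<in> space M. cmod (g n \<omega> (\<zeta> k) - w (\<zeta> k)) > \<delta>})" by auto
  qed
  have le: "prob {\<omega> \<in> space M. cmod (g n \<omega> z - w z) > \<epsilon>} \<le> (\<Sum>k<m. prob {\<omega>
      \<in> space M. cmod (g n \<omega> (\<zeta> k) - w (\<zeta> k)) > \<delta>})"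
    if n: "n \<ge> 1" for n
  proof -
    have [measurable]: "(\<lambda>\<omega>. g n \<omega> (\<zeta> k)) \<in> borel_measurable M" for k
      unfolding g_def using \<zeta>S S(3) by (intro borel_measurable_eigenvalue_stieltjes n) auto
    have sets: "{\<omega> \<in> space M. cmod (g n \<omega> (\<zeta> k) - w (\<zeta> k)) > \<delta>} \<in> events" for k by measurable
    have "prob {\<omega> \<in> space M. cmod (g n \<omega> z - w z) > \<epsilon>} \<le> prob (\<Union>k<m. {\<omega>
        \<in> space M. cmod (g n \<omega> (\<zeta> k) - w (\<zeta> k)) > \<delta>})"
      by (intro finite_measure_mono sub sets.finite_UN sets) auto
    also have "\<dots> \<le> (\<Sum>k<m. prob {\<omega> \<in> space M. cmod (g n \<omega> (\<zeta> k) - w (\<zeta> k)) > \<delta>})"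
      by (intro finite_measure_subadditive_finite) (use sets in auto)
    finally show ?thesis .
  qed
  have "(\<lambda>n. prob {\<omega> \<in> space M. cmod (g n \<omega> (\<zeta> k) - w (\<zeta> k)) > \<delta>}) \<longlonglongrightarrow> 0" for k
    unfolding g_def w_def
  proof (rule plim_far_from_axis[OF third _ \<delta>(1)])
    have "(2 * v)\<^sup>2 \<le> (2 * v + 1 / real (Suc k))\<^sup>2" using v_pos by (intro power_mono) auto
    then show "4 * v\<^sup>2 \<le> (Im (\<zeta> k))\<^sup>2" using z by (simp add: \<zeta>_def power_mult_distrib sgn_if)
  qed
  then have "(\<lambda>n. \<Sum>k<m. prob {\<omega> \<in> space M. cmod (g n \<omega> (\<zeta> k) - w (\<zeta> k)) > \<delta>}) \<longlonglongrightarrow> 0"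
    by (intro tendsto_null_sum)
  then have "(\<lambda>n. prob {\<omega> \<in> space M. cmod (g n \<omega> z - w z) > \<epsilon>}) \<longlonglongrightarrow> 0"
    by (rule tendsto_sandwich[OF _ _ tendsto_const, rotated 2])
       (auto intro!: eventually_sequentiallyI[of 1] le)
  then show "(\<lambda>n. prob {\<omega> \<in> space M. cmod (eigenvalue_stieltjes (percolation_matrix a b d n \<omega>) z
      - stieltjes (semicircle_law v) z) > \<epsilon>}) \<longlonglongrightarrow> 0"
    unfolding g_def w_def .
qed

end

theorem theorem2p2:
  fixes M :: "'w measure"
    and v :: real
    and a :: "int \<Rightarrow> int \<Rightarrow> 'w \<Rightarrow> real"
    and \<psi> :: "real \<Rightarrow> real"
    and b :: "nat \<Rightarrow> int"
    and d :: "nat \<Rightarrow> int \<Rightarrow> int \<Rightarrow> 'w \<Rightarrow> real"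
    and z :: complex
  assumes "long_range_percolation M v a \<psi> b d"
    and "(SUP (i, j)\<in>{(i, j). i \<le> j}. \<integral>\<^sup>+\<omega>. ennreal (\<bar>a i j \<omega>\<bar> ^ 3) \<partial>M) < \<infinity>"
    and "z \<notin> \<real>"
  shows "plim_const M (\<lambda>n \<omega>. eigenvalue_stieltjes (percolation_matrix a b d n \<omega>) z)
           (stieltjes (semicircle_law v) z)"
proof -
  interpret long_range_percolation M v a \<psi> b d by fact
  \<comment> \<open>Finiteness of the supremum turns into integrability with a common real bound.\<close>
  define \<mu> where "\<mu> = (SUP (i, j)\<in>{(i, j). i \<le> j}. \<integral>\<^sup>+\<omega>. ennreal (\<bar>a i j \<omega>\<bar> ^ 3) \<partial>M)"
  have \<mu>: "\<mu> < \<infinity>" using assms(2) by (simp add: \<mu>_def)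
  show ?thesis
  proof (rule plim_everywhere[where \<mu> = "enn2real \<mu>"])
    fix i j :: int assume ij: "i \<le> j"
    have [measurable]: "a i j \<in> borel_measurable M" using a_mean[OF ij] by auto
    have le: "(\<integral>\<^sup>+\<omega>. ennreal (\<bar>a i j \<omega>\<bar> ^ 3) \<partial>M) \<le> \<mu>"
      unfolding \<mu>_def using ij by (intro SUP_upper2[of "(i, j)"]) auto
    then have int: "integrable M (\<lambda>\<omega>. \<bar>a i j \<omega>\<bar> ^ 3)"
      using \<mu> by (intro integrableI_nonneg) (auto intro: le_less_trans)
    then have "ennreal (expectation (\<lambda>\<omega>. \<bar>a i j \<omega>\<bar> ^ 3)) \<le> \<mu>"
      using le by (subst (asm) nn_integral_eq_integral) auto
    also have "\<mu> = ennreal (enn2real \<mu>)" using \<mu> by simp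
    finally show "integrable M (\<lambda>\<omega>. \<bar>a i j \<omega>\<bar> ^ 3) \<and> expectation (\<lambda>\<omega>. \<bar>a i j \<omega>\<bar> ^ 3) \<le> enn2real \<mu>"
      using int by simp
  next
    show "Im z \<noteq> 0" using assms(3) by (simp add: complex_is_Real_iff)
  qed
qed

end
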